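(* Let $R$ be a commutative ring with unit, let $\mathcal{G}$ be an abelian monoid (written additively), let $\mathcal{H}\cong\mathbb{Z}^n$ with basis $e_1,\dots,e_n$, and suppose $\mathcal{G}\oplus\mathcal{H}$ carries a total ordering making it a totally ordered monoid. Write $x_i=t^{e_i}$. Suppose that for each $i=1,\dots,n$, $F_i\in R_w[\mathcal{G}\oplus\mathcal{H}]$ has $x$-initial term $f_i=a_ix_1^{b_{i1}}\cdots x_n^{b_{in}}$ with $a_i,a_i^{-1}\in R_w[\mathcal{G}]$. If the Jacobian number $j(F_1,\dots,F_n)=\det(b_{ij})_{1\le i,j\le n}$ is nonzero, then for any $\Phi(x_1,\dots,x_n)\in R_w^{\mathbf f}[\mathcal{G}\oplus\mathcal{H}]$, $$\mathop{\mathrm{CT}}_{x_1,\dots,x_n}\Phi(F_1,\dots,F_n)\,LJ(F_1,\dots,F_n)=j(F_1,\dots,F_n)\,\mathop{\mathrm{CT}}_{F_1,\dots,F_n}\Phi(F_1,\dots,F_n),$$ where on the left the constant term in $x_1,\dots,x_n$ is taken in $R_w[\mathcal{G}\oplus\mathcal{H}]$, and the right-hand constant term $\mathop{\mathrm{CT}}_{F_1,\dots,F_n}\Phi(F_1,\dots,F_n)$ means the constant term in $x_1,\dots,x_n$ of $\Phi(x_1,\dots,x_n)$ taken in $R_w^{\mathbf f}[\mathcal{G}\oplus\mathcal{H}]$.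
   Context: A totally ordered monoid is a monoid with a total ordering such that (in additive notation) $x<y$ implies $z+x<z+y$ and $x+z<y+z$ for all $z$. For an abelian totally ordered monoid $\mathcal{M}$, $R_w[\mathcal{M}]$ is the ring of Malcev-Neumann series: formal series $\eta=\sum_{m\in\mathcal{M}}c_mt^m$ ($c_m\in R$, $t^mt^{m'}=t^{m+m'}$) whose support $\{m:c_m\ne0\}$ is well-ordered, with the natural addition and multiplication. The order $\mathrm{ord}(\eta)$ is the minimum of the support. $\mathcal{G}$ and $\mathcal{H}$ are regarded as submonoids of $\mathcal{G}\oplus\mathcal{H}$, and $\mathcal{G}$ has the induced ordering. Each $\eta\in R_w[\mathcal{G}\oplus\mathcal{H}]$ can be written $\eta=\sum_{\mathbf k\in\mathbb{Z}^n}b_{\mathbf k}x_1^{k_1}\cdots x_n^{k_n}$ with $b_{\mathbf k}\in R_w[\mathcal{G}]$; the summands are its $x$-terms, the $x$-initial term is the $x$-term of least order, and $\mathrm{CT}_{x_1,\dots,x_n}\eta=b_{\mathbf 0}$. The operator $\partial/\partial x_j$ acts termwise, and $$LJ(F_1,\dots,F_n)=\frac{x_1\cdots x_n}{F_1\cdots F_n}\det\Big(\frac{\partial F_i}{\partial x_j}\Big)_{1\le i,j\le n}.$$ The endomorphism $\mathbf f$ of $\mathcal{G}\oplus\mathcal{H}$ is the identity on $\mathcal{G}$ and sends $e_i$ to $\mathrm{ord}(f_i)=\mathrm{ord}(a_i)+\sum_jb_{ij}e_j$; it is injective when $\det(b_{ij})\neq 0$. The ring $R_w^{\mathbf f}[\mathcal{G}\oplus\mathcal{H}]$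 is the ring of Malcev-Neumann series on $\mathcal{G}\oplus\mathcal{H}$ for the total ordering $\le^{\mathbf f}$ given by $h\le^{\mathbf f}h'\iff\mathbf f(h)\le\mathbf f(h')$. For $\Phi=\sum_{\mathbf k}b_{\mathbf k}x_1^{k_1}\cdots x_n^{k_n}$ (with $b_{\mathbf k}\in R_w[\mathcal{G}]$) in this ring, $\Phi(F_1,\dots,F_n)$ denotes the series $\sum_{\mathbf k}b_{\mathbf k}F_1^{k_1}\cdots F_n^{k_n}$ in $R_w[\mathcal{G}\oplus\mathcal{H}]$.
   Formalization: The formal theorem also assumes that the leading coefficient of each a_i is a unit of R (automatic when R is an integral domain); without this the claim fails, e.g. R = Q[ε]/(ε²), G = Z ordered first, F = (1+εt⁻¹)x + t⁻¹x², Φ = 1, where the two sides are 2 (mod ε) and 1. *)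

theory Defs
  imports
    "HOL-Analysis.Determinants"
    "HOL-Analysis.Product_Vector"
    "HOL-Library.Groups_Big_Fun"
    "HOL-Algebra.Ring"
begin

definition totally_ordered_monoid :: "('m::monoid_add) rel \<Rightarrow> bool" where
  "totally_ordered_monoid r \<longleftrightarrow> linear_order r \<and>
     (\<forall>x y z. (x, y) \<in> r - Id \<longrightarrow> (z + x, z + y) \<in> r - Id \<and> (x + z, y + z) \<in> r - Id)"


section \<open>Malcev-Neumann series\<close>

definition mn_supp :: "('m \<Rightarrow> 'r::zero) \<Rightarrow> 'm set" where
  "mn_supp \<eta> = {m. \<eta> m \<noteq> 0}"

text \<open>
  The order only enters through the carrier. The sum in the product is finite when both
  supports are well-ordered by a totally ordered monoid structure.
\<close>

definition mn_ring :: "('m::comm_monoid_add) rel \<Rightarrow> ('m \<Rightarrow> 'r::comm_ring_1) ring" where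
  "mn_ring r = \<lparr>
     carrier = {\<eta>. well_order_on (mn_supp \<eta>) (Restr r (mn_supp \<eta>))},
     mult = (\<lambda>\<eta> \<zeta> m. \<Sum>(p, q)\<in>{(p, q). p + q = m \<and> \<eta> p \<noteq> 0 \<and> \<zeta> q \<noteq> 0}. \<eta> p * \<zeta> q),
     one = (\<lambda>m. if m = 0 then 1 else 0),
     zero = (\<lambda>m. 0),
     add = (\<lambda>\<eta> \<zeta> m. \<eta> m + \<zeta> m)\<rparr>"

definition mn_ord :: "'m rel \<Rightarrow> ('m \<Rightarrow> 'r::zero) \<Rightarrow> 'm" where
  "mn_ord r \<eta> = (THE m. m \<in> mn_supp \<eta> \<and> (\<forall>m'\<in>mn_supp \<eta>. (m, m') \<in> r))"

definition mn_t :: "'m \<Rightarrow> 'm \<Rightarrow> 'r::zero_neq_one" where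
  "mn_t m = (\<lambda>m'. if m' = m then 1 else 0)"

text \<open>
  For coefficients in a domain, every invertible series has an invertible leading coefficient.
  This fails in general: if \<open>\<epsilon>\<^sup>2 = 0\<close>, then \<open>1 + \<epsilon> t\<^sup>-\<^sup>1\<close> has inverse
  \<open>1 - \<epsilon> t\<^sup>-\<^sup>1\<close>, and its leading coefficient is \<open>\<epsilon>\<close>. The orders of a unit and of
  its inverse then need not be opposite to each other, so over a ring with zero divisors the
  invertibility of the leading coefficients has to be assumed separately.
\<close>

lemma mn_ord_least:
  assumes r: "linear_order r"
    and \<eta>: "\<eta> \<in> carrier (mn_ring r)" and ne: "\<eta> \<noteq> (\<lambda>m. 0)"
  shows "\<eta> (mn_ord r \<eta>) \<noteq> 0" and "\<eta> m \<noteq> 0 \<Longrightarrow> (mn_ord r \<eta>, m) \<in> r"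
proof -
  let ?S = "mn_supp \<eta>"
  have wf: "wf (Restr r ?S - Id)"
    using \<eta> by (simp add: mn_ring_def well_order_on_def)
  have tot: "total r" and refl: "refl r" and anti: "antisym r"
    using r by (auto simp: order_on_defs)
  have "\<exists>m. m \<in> ?S"
    using ne by (auto simp: mn_supp_def fun_eq_iff)
  then obtain p where p: "p \<in> ?S" and min: "\<And>q. (q, p) \<in> Restr r ?S - Id \<Longrightarrow> q \<notin> ?S"
    using wfE_min[OF wf] by metis
  have le: "(p, q) \<in> r" if "q \<in> ?S" for q
    using that p min[of q] tot refl by (cases "q = p") (auto simp: total_on_def refl_on_def)
  have "mn_ord r \<eta> = p"
    unfolding mn_ord_def using p le anti by (intro the_equality) (auto dest: antisymD)
  then show "\<eta> (mn_ord r \<eta>) \<noteq> 0" and "\<eta> m \<noteq> 0 \<Longrightarrow> (mn_ord r \<eta>, m) \<in> r"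
    using p le by (auto simp: mn_supp_def)
qed

lemma mn_Units_leading_coeff:
  fixes \<eta> :: "'m::comm_monoid_add \<Rightarrow> 'r::idom"
  assumes r: "totally_ordered_monoid r" and "\<eta> \<in> Units (mn_ring r)"
  shows "\<eta> (mn_ord r \<eta>) dvd 1"
proof -
  obtain \<zeta> where \<eta>: "\<eta> \<in> carrier (mn_ring r)" and \<zeta>: "\<zeta> \<in> carrier (mn_ring r)"
    and inv: "\<eta> \<otimes>\<^bsub>mn_ring r\<^esub> \<zeta> = \<one>\<^bsub>mn_ring r\<^esub>"
    using assms(2) by (auto simp: Units_def)
  have lin: "linear_order r" and anti: "antisym r" and trans: "trans r"
    using r by (auto simp: totally_ordered_monoid_def order_on_defs)
  have prod: "(\<Sum>(p, q)\<in>{(p, q). p + q = m \<and> \<eta> p \<noteq> 0 \<and> \<zeta> q \<noteq> 0}. \<eta> p * \<zeta> q)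
      = (if m = 0 then 1 else 0)" for m
    using fun_cong[OF inv, of m] by (simp add: mn_ring_def)
  have "\<eta> \<noteq> (\<lambda>m. 0)" "\<zeta> \<noteq> (\<lambda>m. 0)"
    using prod[of 0] by auto
  note e = mn_ord_least[OF lin \<eta> this(1)] and z = mn_ord_least[OF lin \<zeta> this(2)]
  define p q where "p = mn_ord r \<eta>" and "q = mn_ord r \<zeta>"
  have uniq: "p' = p \<and> q' = q" if "p' + q' = p + q" "\<eta> p' \<noteq> 0" "\<zeta> q' \<noteq> 0" for p' q'
  proof -
    have le: "(p, p') \<in> r" "(q, q') \<in> r"
      using e(2) z(2) that by (auto simp: p_def q_def)
    have 1: "(p + q, p' + q) \<in> r - Id" if "p' \<noteq> p"
      using that le r by (auto simp: totally_ordered_monoid_def)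
    have 2: "(p' + q, p' + q') \<in> r - Id" if "q' \<noteq> q"
      using that le r by (auto simp: totally_ordered_monoid_def)
    show ?thesis
      using 1 2 that(1) anti by (metis DiffD1 DiffD2 IdI antisymD)
  qed
  have "{(p', q'). p' + q' = p + q \<and> \<eta> p' \<noteq> 0 \<and> \<zeta> q' \<noteq> 0} = {(p, q)}"
    using uniq e(1) z(1) by (auto simp: p_def q_def)
  then have "\<eta> p * \<zeta> q = (if p + q = 0 then 1 else 0)"
    using prod[of "p + q"] by simp
  moreover have "\<eta> p * \<zeta> q \<noteq> 0"
    using e(1) z(1) by (simp add: p_def q_def)
  ultimately have "\<eta> p * \<zeta> q = 1"
    by (metis (full_types))
  then show ?thesis
    unfolding p_def by (metis dvd_triv_left)
qed


section \<open>Series in the variables \<open>x\<^sub>i\<close>\<close>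

text \<open>
  Here \<open>\<H> = \<int>\<^sup>n\<close> is the type \<^typ>\<open>int ^ 'n\<close>, with \<open>e\<^sub>i = axis i 1\<close>, and \<open>\<G> \<oplus> \<H>\<close> is
  \<^typ>\<open>'g \<times> (int ^ 'n)\<close>.
\<close>

definition ordG :: "('g \<times> (int ^ 'n::finite)) rel \<Rightarrow> 'g rel" where
  "ordG r = inv_image r (\<lambda>g. (g, 0))"

definition mn_embG :: "('g \<Rightarrow> 'r::zero) \<Rightarrow> 'g \<times> (int ^ 'n::finite) \<Rightarrow> 'r" where
  "mn_embG b = (\<lambda>(g, k). if k = 0 then b g else 0)"

definition mn_X :: "'n::finite \<Rightarrow> ('g::zero) \<times> (int ^ 'n) \<Rightarrow> 'r::zero_neq_one" where
  "mn_X i = mn_t (0, axis i 1)"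

definition mpow :: "('a, 'b) monoid_scheme \<Rightarrow> ('n::finite \<Rightarrow> 'a) \<Rightarrow> int ^ 'n \<Rightarrow> 'a" where
  "mpow A y k = (\<Otimes>\<^bsub>A\<^esub>i\<in>UNIV. y i [^]\<^bsub>A\<^esub> (k $ i))"

text \<open>The coefficient \<open>b\<^sub>k\<close> of \<open>x\<^sup>k\<close>, as a series on \<open>\<G>\<close>.\<close>

definition xcoeff :: "('g \<times> (int ^ 'n::finite) \<Rightarrow> 'r) \<Rightarrow> int ^ 'n \<Rightarrow> 'g \<Rightarrow> 'r" where
  "xcoeff \<eta> k = (\<lambda>g. \<eta> (g, k))"

definition xterm ::
    "(('g::comm_monoid_add) \<times> (int ^ 'n::finite)) rel \<Rightarrow> ('g \<times> (int ^ 'n) \<Rightarrow> 'r::comm_ring_1)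
      \<Rightarrow> int ^ 'n \<Rightarrow> 'g \<times> (int ^ 'n) \<Rightarrow> 'r" where
  "xterm r \<eta> k = mn_embG (xcoeff \<eta> k) \<otimes>\<^bsub>mn_ring r\<^esub> mpow (mn_ring r) mn_X k"

definition is_xinitial ::
    "(('g::comm_monoid_add) \<times> (int ^ 'n::finite)) rel \<Rightarrow> ('g \<times> (int ^ 'n) \<Rightarrow> 'r::comm_ring_1)
      \<Rightarrow> ('g \<times> (int ^ 'n) \<Rightarrow> 'r) \<Rightarrow> bool" where
  "is_xinitial r \<eta> f \<longleftrightarrow> f \<noteq> \<zero>\<^bsub>mn_ring r\<^esub> \<and> (\<exists>k. f = xterm r \<eta> k) \<and>
     (\<forall>k. xterm r \<eta> k \<noteq> \<zero>\<^bsub>mn_ring r\<^esub> \<longrightarrow> (mn_ord r f, mn_ord r (xterm r \<eta> k)) \<in> r)"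

definition xCT :: "('g \<times> (int ^ 'n::finite) \<Rightarrow> 'r) \<Rightarrow> 'g \<Rightarrow> 'r" where
  "xCT \<eta> = xcoeff \<eta> 0"

text \<open>
  Termwise, \<open>b\<^sub>k x\<^sup>k\<close> is sent to \<open>k\<^sub>j b\<^sub>k x\<^bsup>k - e\<^sub>j\<^esup>\<close>.
\<close>

definition mn_deriv ::
    "'n::finite \<Rightarrow> ('g \<times> (int ^ 'n) \<Rightarrow> 'r::ring_1) \<Rightarrow> 'g \<times> (int ^ 'n) \<Rightarrow> 'r" where
  "mn_deriv j \<eta> = (\<lambda>(g, k). of_int (k $ j + 1) * \<eta> (g, k + axis j 1))"

definition ring_det :: "('a, 'b) ring_scheme \<Rightarrow> ('n::finite \<Rightarrow> 'n \<Rightarrow> 'a) \<Rightarrow> 'a" where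
  "ring_det A M = (\<Oplus>\<^bsub>A\<^esub>p\<in>{p. p permutes UNIV}. [sign p] \<cdot>\<^bsub>A\<^esub> (\<Otimes>\<^bsub>A\<^esub>i\<in>UNIV. M i (p i)))"

definition log_jacobian ::
    "(('g::comm_monoid_add) \<times> (int ^ 'n::finite)) rel
      \<Rightarrow> ('n \<Rightarrow> 'g \<times> (int ^ 'n) \<Rightarrow> 'r::comm_ring_1) \<Rightarrow> 'g \<times> (int ^ 'n) \<Rightarrow> 'r" where
  "log_jacobian r F =
     ((\<Otimes>\<^bsub>mn_ring r\<^esub>i\<in>UNIV. mn_X i) \<otimes>\<^bsub>mn_ring r\<^esub> inv\<^bsub>mn_ring r\<^esub> (\<Otimes>\<^bsub>mn_ring r\<^esub>i\<in>UNIV. F i))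
       \<otimes>\<^bsub>mn_ring r\<^esub> ring_det (mn_ring r) (\<lambda>i j. mn_deriv j (F i))"

text \<open>
  The endomorphism \<open>\<^bold>f\<close>. It is determined by these conditions because \<open>\<G>\<close> and the \<open>e\<^sub>i\<close>,
  which are invertible, generate \<open>\<G> \<oplus> \<H>\<close>.
\<close>

definition mn_endo ::
    "(('g::comm_monoid_add) \<times> (int ^ 'n::finite)) rel
      \<Rightarrow> ('n \<Rightarrow> 'g \<times> (int ^ 'n) \<Rightarrow> 'r::comm_ring_1) \<Rightarrow> 'g \<times> (int ^ 'n) \<Rightarrow> 'g \<times> (int ^ 'n)" where
  "mn_endo r f = (THE \<phi>.
     (\<forall>h h'. \<phi> (h + h') = \<phi> h + \<phi> h') \<and>
     (\<forall>g. \<phi> (g, 0) = (g, 0)) \<and>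
     (\<forall>i. \<phi> (0, axis i 1) = mn_ord r (f i)))"

text \<open>
  \<open>\<Phi>(F\<^sub>1, \<dots>, F\<^sub>n)\<close>: the sum is formal, that is, for every exponent only finitely many \<open>k\<close>
  contribute.
\<close>

definition mn_subst ::
    "(('g::comm_monoid_add) \<times> (int ^ 'n::finite)) rel \<Rightarrow> ('g \<times> (int ^ 'n) \<Rightarrow> 'r::comm_ring_1)
      \<Rightarrow> ('n \<Rightarrow> 'g \<times> (int ^ 'n) \<Rightarrow> 'r) \<Rightarrow> 'g \<times> (int ^ 'n) \<Rightarrow> 'r" where
  "mn_subst r \<Phi> F =
     (\<lambda>m. Sum_any (\<lambda>k. (mn_embG (xcoeff \<Phi> k) \<otimes>\<^bsub>mn_ring r\<^esub> mpow (mn_ring r) F k) m))"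

end

(*
  A row vector V of series is called parallel if the coefficient vector of every t^s is a multiple
  of the primitive integer vector in the direction of the x-degree of s. With the Euler derivations
  D_j = x_j d/dx_j, the vector (F^k F^-1 D_j F)_j is parallel for every integer k \<noteq> 0, and for
  k = 0 it is parallel up to the constant vector snd (ord F). Over the rationals this is exactness
  of F^k dF/F and of d log F minus d log of the initial term; over an arbitrary ring it follows
  from a symmetry of the exponents in F^(k-1) dF.
  The coefficient of t^(g,0) in F^k LJ(F) is a sum of determinants whose rows come from exponents
  of total x-degree 0. If some row is parallel, the rows that are parallel are linearly dependent over the
  integers, and the determinant vanishes. This leaves only k = 0 with all rows constant, which
  gives det b, and linearity in \<Phi> yields the formula.
*)

theory Submission
  imports Defs "HOL-Library.Ramsey"
begin

section \<open>Well-ordered sets in totally ordered monoids\<close>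

text \<open>Three obstacles shape the proof. First, the coefficient ring may have torsion, so no
  division by an integer is possible there. Primitive vectors get around this: an integer vector
  \<open>w\<close> with \<open>l * w = M * d\<close> and \<open>l\<close> nonzero is an integer
  multiple of the primitive vector of \<open>d\<close>, though in general not of \<open>d\<close>.
  All divisions thus happen among integers, and a determinant with parallel rows is a scalar times
  the image of an integer determinant, to which linear algebra over a field applies. Second, the
  exponents of the first component form only a monoid. Each initial exponent is therefore carried
  together with an additive inverse, which exists because the unit \<open>a i\<close> has an
  invertible leading coefficient. Third, the series for the substitution is infinite, so linearity
  needs finiteness. A single well-ordered submonoid \<open>gen S\<close> serves all
  \<open>F i\<close> and all their inverses, and the k-th power product is supported in a translate
  of \<open>gen S\<close> by the image of (0, k) under the endomorphism. As that endomorphism maps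
  the support of \<Phi> injectively onto a well-ordered set, only finitely many k reach a given
  exponent.\<close>

lemma disj_wf_Un: "wf R \<Longrightarrow> wf S \<Longrightarrow> disj_wf (R \<union> S)"
  unfolding disj_wf_def
  by (intro exI[of _ "\<lambda>i::nat. if i = 0 then R else S"] exI[of _ "2::nat"])
     (auto simp: numeral_2_eq_2 lessThan_Suc)

text \<open>The order is a relation and not a type class because the locale is also instantiated
  with derived orders: \<open>lex_int r\<close> on pairs and \<open>ordG r\<close> on the first
  component.\<close>

locale to_monoid =
  fixes r :: "('m::comm_monoid_add) rel"
  assumes to_monoid: "totally_ordered_monoid r"
begin

definition le (infix "\<le>\<^sub>r" 50) where "x \<le>\<^sub>r y \<longleftrightarrow> (x, y) \<in> r"
definition lt (infix "<\<^sub>r" 50) where "x <\<^sub>r y \<longleftrightarrow> (x, y) \<in> r \<and> x \<noteq> y"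

lemma lin: "linear_order r"
  using to_monoid by (simp add: totally_ordered_monoid_def)

lemma le_refl [simp]: "x \<le>\<^sub>r x"
  using lin by (auto simp: le_def order_on_defs refl_on_def)

lemma le_trans [trans]: "x \<le>\<^sub>r y \<Longrightarrow> y \<le>\<^sub>r z \<Longrightarrow> x \<le>\<^sub>r z"
  using lin by (auto simp: le_def order_on_defs dest: transD)

lemma le_antisym: "x \<le>\<^sub>r y \<Longrightarrow> y \<le>\<^sub>r x \<Longrightarrow> x = y"
  using lin by (auto simp: le_def order_on_defs dest: antisymD)

lemma lt_le: "x <\<^sub>r y \<longleftrightarrow> x \<le>\<^sub>r y \<and> x \<noteq> y"
  by (simp add: lt_def le_def)

lemma not_le: "\<not> x \<le>\<^sub>r y \<longleftrightarrow> y <\<^sub>r x"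
proof
  have "x \<le>\<^sub>r y \<or> y \<le>\<^sub>r x"
    using lin le_refl by (cases "x = y") (auto simp: le_def order_on_defs total_on_def)
  then show "\<not> x \<le>\<^sub>r y \<Longrightarrow> y <\<^sub>r x" by (auto simp: lt_le)
  show "y <\<^sub>r x \<Longrightarrow> \<not> x \<le>\<^sub>r y" using le_antisym by (auto simp: lt_le)
qed

lemma lt_irrefl [simp]: "\<not> x <\<^sub>r x"
  by (simp add: lt_le)

lemma lt_trans [trans]: "x <\<^sub>r y \<Longrightarrow> y <\<^sub>r z \<Longrightarrow> x <\<^sub>r z"
  by (metis le_antisym le_trans lt_le)

lemma le_lt_trans [trans]: "x \<le>\<^sub>r y \<Longrightarrow> y <\<^sub>r z \<Longrightarrow> x <\<^sub>r z"
  by (metis le_antisym le_trans lt_le)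

lemma lt_linear: "x <\<^sub>r y \<or> x = y \<or> y <\<^sub>r x"
  using not_le by (auto simp: lt_le)

lemma add_lt: "x <\<^sub>r y \<Longrightarrow> z + x <\<^sub>r z + y"
  using to_monoid by (auto simp: totally_ordered_monoid_def lt_def)

lemma add_le: "x \<le>\<^sub>r y \<Longrightarrow> z + x \<le>\<^sub>r z + y"
  using add_lt[of x y z] by (cases "x = y") (auto simp: lt_le)

lemma add_mono: "x \<le>\<^sub>r y \<Longrightarrow> x' \<le>\<^sub>r y' \<Longrightarrow> x + x' \<le>\<^sub>r y + y'"
  by (metis add.commute add_le le_trans)

text \<open>Cancellation comes from totality: if the arguments differ, one is strictly smaller, and
  translation keeps the inequality strict.\<close>

lemma add_cancel [simp]: "(z :: 'm) + x = z + y \<longleftrightarrow> x = y"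
  using add_lt[of x y z] add_lt[of y x z] lt_linear[of x y] by auto

lemma add_cancel_right [simp]: "(x :: 'm) + z = y + z \<longleftrightarrow> x = y"
  using add_cancel[of z x y] by (simp add: add.commute)

lemma add_lt_iff [simp]: "z + x <\<^sub>r z + y \<longleftrightarrow> x <\<^sub>r y"
  by (metis add_lt lt_linear lt_trans lt_irrefl)

lemma add_le_iff [simp]: "z + x \<le>\<^sub>r z + y \<longleftrightarrow> x \<le>\<^sub>r y"
  by (metis add_lt_iff not_le)

lemma add_less_le_mono: "x <\<^sub>r y \<Longrightarrow> x' \<le>\<^sub>r y' \<Longrightarrow> x + x' <\<^sub>r y + y'"
  by (metis add.commute add_le_iff add_lt_iff le_lt_trans)

text \<open>Minima of subsets are easier to handle under unions, images and sums than
  \<open>well_order_on\<close> with a restricted relation; \<open>wo_iff_wf\<close> and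
  \<open>carrier_iff\<close> translate between the two.\<close>

definition wo :: "'m set \<Rightarrow> bool" where
  "wo A \<longleftrightarrow> (\<forall>T\<subseteq>A. T \<noteq> {} \<longrightarrow> (\<exists>x\<in>T. \<forall>y\<in>T. x \<le>\<^sub>r y))"

lemma wo_iff_wf: "wo A \<longleftrightarrow> wf {(x, y). x \<in> A \<and> y \<in> A \<and> x <\<^sub>r y}"
proof
  assume A: "wo A"
  show "wf {(x, y). x \<in> A \<and> y \<in> A \<and> x <\<^sub>r y}"
  proof (rule wfI_min)
    fix x :: 'm and Q assume "x \<in> Q"
    show "\<exists>z\<in>Q. \<forall>y. (y, z) \<in> {(x, y). x \<in> A \<and> y \<in> A \<and> x <\<^sub>r y} \<longrightarrow> y \<notin> Q"
    proof (cases "Q \<inter> A = {}")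
      case False
      then obtain z where "z \<in> Q \<inter> A" "\<forall>y\<in>Q \<inter> A. z \<le>\<^sub>r y"
        using A unfolding wo_def by (metis inf_le2)
      then show ?thesis using not_le by blast
    qed (use \<open>x \<in> Q\<close> in auto)
  qed
next
  assume wf: "wf {(x, y). x \<in> A \<and> y \<in> A \<and> x <\<^sub>r y}"
  show "wo A"
    unfolding wo_def
  proof (intro allI impI)
    fix T assume T: "T \<subseteq> A" "T \<noteq> {}"
    then obtain t where "t \<in> T" by auto
    from wfE_min[OF wf this] obtain z where "z \<in> T"
      "\<And>y. (y, z) \<in> {(x, y). x \<in> A \<and> y \<in> A \<and> x <\<^sub>r y} \<Longrightarrow> y \<notin> T" by blast
    then show "\<exists>x\<in>T. \<forall>y\<in>T. x \<le>\<^sub>r y"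
      using T not_le by blast
  qed
qed

lemma wo_subset: "wo B \<Longrightarrow> A \<subseteq> B \<Longrightarrow> wo A"
  by (auto simp: wo_def)

lemma wo_empty [simp]: "wo {}"
  by (simp add: wo_def)

lemma wo_singleton [simp]: "wo {x}"
  by (auto simp: wo_def subset_singleton_iff)

lemma wo_Un:
  assumes "wo A" "wo B"
  shows "wo (A \<union> B)"
  unfolding wo_def
proof (intro allI impI)
  fix T assume T: "T \<subseteq> A \<union> B" "T \<noteq> {}"
  have A: "\<exists>x\<in>T \<inter> A. \<forall>y\<in>T \<inter> A. x \<le>\<^sub>r y" if "T \<inter> A \<noteq> {}"
    using assms(1) that unfolding wo_def by (meson inf_le2)
  have B: "\<exists>x\<in>T \<inter> B. \<forall>y\<in>T \<inter> B. x \<le>\<^sub>r y" if "T \<inter> B \<noteq> {}"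
    using assms(2) that unfolding wo_def by (meson inf_le2)
  show "\<exists>x\<in>T. \<forall>y\<in>T. x \<le>\<^sub>r y"
  proof (cases "T \<inter> A = {} \<or> T \<inter> B = {}")
    case True
    then have "T \<inter> A = T \<or> T \<inter> B = T" using T by auto
    then show ?thesis using A B T by metis
  next
    case False
    then obtain x y where x: "x \<in> T" "\<forall>z\<in>T \<inter> A. x \<le>\<^sub>r z" and y: "y \<in> T" "\<forall>z\<in>T \<inter> B. y \<le>\<^sub>r z"
      using A B by blast
    have "x \<le>\<^sub>r z \<or> y \<le>\<^sub>r z" if "z \<in> T" for z
      using x y that T by blast
    moreover have "x \<le>\<^sub>r y \<or> y \<le>\<^sub>r x"
      using not_le lt_le by blast
    ultimately show ?thesis
      using x(1) y(1) le_trans by blast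
  qed
qed

lemma wo_image_mono:
  assumes "wo A" "\<And>x y. x \<in> A \<Longrightarrow> y \<in> A \<Longrightarrow> x \<le>\<^sub>r y \<Longrightarrow> h x \<le>\<^sub>r h y"
  shows "wo (h ` A)"
  unfolding wo_def
proof (intro allI impI)
  fix T assume T: "T \<subseteq> h ` A" "T \<noteq> {}"
  define T' where "T' = {x\<in>A. h x \<in> T}"
  have "T' \<subseteq> A" "T' \<noteq> {}" using T by (auto simp: T'_def)
  then obtain x where "x \<in> T'" "\<forall>y\<in>T'. x \<le>\<^sub>r y"
    using assms(1) unfolding wo_def by meson
  then show "\<exists>x\<in>T. \<forall>y\<in>T. x \<le>\<^sub>r y"
    using T assms(2) by (auto simp: T'_def intro!: bexI[of _ "h x"])
qed

lemma wo_translate: "wo A \<Longrightarrow> wo ((+) z ` A)"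
  by (rule wo_image_mono) auto

definition sumset :: "'m set \<Rightarrow> 'm set \<Rightarrow> 'm set" where
  "sumset A B = {a + b | a b. a \<in> A \<and> b \<in> B}"

lemma sumsetI [intro]: "a \<in> A \<Longrightarrow> b \<in> B \<Longrightarrow> a + b \<in> sumset A B"
  by (auto simp: sumset_def)

lemma lt_sum_cases: "a + b <\<^sub>r a' + b' \<Longrightarrow> a <\<^sub>r a' \<or> b <\<^sub>r b'"
  by (meson add_mono not_le)

text \<open>Pairs are compared by their sums. If the sum drops, one of the components drops, so this
  transitive relation is covered by two well-founded ones. By Ramsey's theorem, in the form
  \<open>trans_disj_wf_implies_wf\<close>, it is well-founded itself.\<close>

lemma wo_sumset:
  assumes "wo A" "wo B"
  shows "wo (sumset A B)"
proof -
  let ?Q = "{(x, y). x \<in> A \<times> B \<and> y \<in> A \<times> B \<and> fst x + snd x <\<^sub>r fst y + snd y}"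
  let ?R1 = "?Q \<inter> {(x, y). fst x <\<^sub>r fst y}"
  let ?R2 = "?Q \<inter> {(x, y). snd x <\<^sub>r snd y}"
  have "trans ?Q"
    by (auto intro!: transI intro: lt_trans)
  moreover have "disj_wf ?Q"
  proof -
    have 1: "wf (inv_image {(x, y). x \<in> A \<and> y \<in> A \<and> x <\<^sub>r y} fst)"
      using assms(1) by (simp add: wo_iff_wf)
    have 2: "wf (inv_image {(x, y). x \<in> B \<and> y \<in> B \<and> x <\<^sub>r y} snd)"
      using assms(2) by (simp add: wo_iff_wf)
    have "disj_wf (?R1 \<union> ?R2)"
      by (rule disj_wf_Un[OF wf_subset[OF 1] wf_subset[OF 2]]) auto
    moreover have "?R1 \<union> ?R2 = ?Q"
      using lt_sum_cases by auto
    ultimately show ?thesis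
      by (rule back_subst[of disj_wf])
  qed
  ultimately have wf: "wf ?Q"
    by (rule trans_disj_wf_implies_wf)
  show ?thesis
    unfolding wo_def
  proof (intro allI impI)
    fix T assume T: "T \<subseteq> sumset A B" "T \<noteq> {}"
    define T' where "T' = {x \<in> A \<times> B. fst x + snd x \<in> T}"
    obtain t where "t \<in> T'"
      using T by (fastforce simp: T'_def sumset_def)
    from wfE_min[OF wf this] obtain z where z: "z \<in> T'" "\<And>y. (y, z) \<in> ?Q \<Longrightarrow> y \<notin> T'"
      by blast
    have "fst z + snd z \<le>\<^sub>r y" if y: "y \<in> T" for y
    proof -
      obtain a b where ab: "y = a + b" "a \<in> A" "b \<in> B"
        using T y unfolding sumset_def by blast
      then have "(a, b) \<in> T'" using y by (auto simp: T'_def)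
      then have "((a, b), z) \<notin> ?Q" using z(2) by blast
      then show ?thesis using ab z(1) not_le by (auto simp: T'_def)
    qed
    then show "\<exists>x\<in>T. \<forall>y\<in>T. x \<le>\<^sub>r y"
      using z(1) by (auto simp: T'_def)
  qed
qed

text \<open>Two different representations of \<open>m\<close> move in opposite directions: one
  component falls while the other rises. In an infinite sequence of them, any two indices thus show
  a descent in one of the components, and the same Ramsey argument would make the reversed order of
  the natural numbers well-founded.\<close>

lemma finite_sum_reps:
  assumes "wo A" "wo B"
  shows "finite {(p, q). p \<in> A \<and> q \<in> B \<and> p + q = m}"
proof (rule ccontr)
  assume "infinite {(p, q). p \<in> A \<and> q \<in> B \<and> p + q = m}"
  then obtain h :: "nat \<Rightarrow> _" where inj: "inj h"
    and h: "range h \<subseteq> {(p, q). p \<in> A \<and> q \<in> B \<and> p + q = m}"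
    using infinite_countable_subset by blast
  let ?Q = "{(j, i::nat). i < j}"
  let ?R1 = "{(j, i::nat). i < j \<and> fst (h j) <\<^sub>r fst (h i)}"
  let ?R2 = "{(j, i::nat). i < j \<and> snd (h j) <\<^sub>r snd (h i)}"
  have "h i \<in> {(p, q). p \<in> A \<and> q \<in> B \<and> p + q = m}" for i
    using subsetD[OF h rangeI] .
  then have hA: "fst (h i) \<in> A" and hB: "snd (h i) \<in> B" and hm: "fst (h i) + snd (h i) = m" for i
    by (simp_all add: case_prod_beta)
  have cov: "fst (h j) <\<^sub>r fst (h i) \<or> snd (h j) <\<^sub>r snd (h i)" if "i < j" for i j
  proof -
    have "h i \<noteq> h j" using inj that by (metis injD less_irrefl)
    moreover have "snd (h i) = snd (h j)" if "fst (h i) = fst (h j)"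
    proof -
      have "fst (h i) + snd (h i) = fst (h i) + snd (h j)"
        using hm[of i] hm[of j] that by simp
      then show ?thesis by simp
    qed
    ultimately have "fst (h i) \<noteq> fst (h j)" by (metis prod.expand)
    moreover have "snd (h j) <\<^sub>r snd (h i)" if "fst (h i) <\<^sub>r fst (h j)"
    proof (rule ccontr)
      assume "\<not> snd (h j) <\<^sub>r snd (h i)"
      then have "snd (h i) \<le>\<^sub>r snd (h j)" using not_le by blast
      from add_less_le_mono[OF that this] show False by (simp add: hm)
    qed
    ultimately show ?thesis using lt_linear by blast
  qed
  have "wf ?Q"
  proof (rule trans_disj_wf_implies_wf)
    show "trans ?Q" by (auto intro: transI)
    have 1: "wf (inv_image {(x, y). x \<in> A \<and> y \<in> A \<and> x <\<^sub>r y} (fst \<circ> h))"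
      using assms(1) by (simp add: wo_iff_wf)
    have 2: "wf (inv_image {(x, y). x \<in> B \<and> y \<in> B \<and> x <\<^sub>r y} (snd \<circ> h))"
      using assms(2) by (simp add: wo_iff_wf)
    have "disj_wf (?R1 \<union> ?R2)"
      by (rule disj_wf_Un[OF wf_subset[OF 1] wf_subset[OF 2]]) (use hA hB in auto)
    moreover have "?R1 \<union> ?R2 = ?Q"
      using cov by auto
    ultimately show "disj_wf ?Q"
      by (rule back_subst[of disj_wf])
  qed
  then obtain z :: nat where "\<And>y. (y, z) \<in> ?Q \<Longrightarrow> y \<notin> UNIV"
    by (rule wfE_min[of _ 0 UNIV]) auto
  from this[of "Suc z"] show False by simp
qed

section \<open>Neumann's lemma on submonoids generated by positive elements\<close>

definition gen :: "'m set \<Rightarrow> 'm set" where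
  "gen S = sum_list ` lists S"

lemma zero_in_gen: "0 \<in> gen S"
  by (force simp: gen_def intro: image_eqI[of _ _ "[]"])

lemma gen_mono: "S \<subseteq> T \<Longrightarrow> gen S \<subseteq> gen T"
  by (auto simp: gen_def)

lemma gen_add: "x \<in> gen S \<Longrightarrow> y \<in> gen S \<Longrightarrow> x + y \<in> gen S"
  unfolding gen_def by (force intro: image_eqI[of _ _ "_ @ _"])

lemma gen_incl: "x \<in> S \<Longrightarrow> x \<in> gen S"
  unfolding gen_def by (force intro: image_eqI[of _ _ "[_]"])

text \<open>An element outside the smaller submonoid must use a summand that is not below
  \<open>a\<close>, and commutativity lets this summand be split off.\<close>

lemma gen_split:
  assumes "x \<in> gen S" "x \<notin> gen {s\<in>S. s <\<^sub>r a}"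
  shows "\<exists>s\<in>S. \<exists>y\<in>gen S. a \<le>\<^sub>r s \<and> x = s + y"
proof -
  obtain xs where xs: "x = sum_list xs" "set xs \<subseteq> S"
    using assms(1) by (auto simp: gen_def)
  have "\<exists>s\<in>set xs. a \<le>\<^sub>r s"
    using assms(2) xs not_le unfolding gen_def by (auto simp: image_iff)
  then obtain s where s: "s \<in> set xs" "a \<le>\<^sub>r s" by auto
  have "x = s + sum_list (remove1 s xs)"
    using xs s by (simp add: sum_list_map_remove1[of s xs "\<lambda>x. x", simplified])
  moreover have "sum_list (remove1 s xs) \<in> gen S"
    using xs set_remove1_subset unfolding gen_def by (force simp: image_iff)
  ultimately show ?thesis using s xs by blast
qed

lemma gen_nonneg:
  assumes "\<And>s. s \<in> S \<Longrightarrow> 0 <\<^sub>r s" "x \<in> gen S"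
  shows "0 \<le>\<^sub>r x"
proof -
  have "set xs \<subseteq> S \<Longrightarrow> 0 \<le>\<^sub>r sum_list xs" for xs
    by (induction xs) (use assms(1) add_mono[of 0 _ 0] in \<open>auto simp: lt_le\<close>)
  then show ?thesis using assms(2) by (auto simp: gen_def)
qed

text \<open>\<open>low S as\<close> contains every element of \<open>gen S\<close> that is not above \<open>sum_list as\<close>. It only
  involves \<open>gen\<close> of proper initial segments of \<open>S\<close>, which makes well-founded induction possible
  in the proof of Neumann's lemma \<open>wo_gen\<close>.\<close>

fun low :: "'m set \<Rightarrow> 'm list \<Rightarrow> 'm set" where
  "low S [] = {}"
| "low S (a # as) = gen {s\<in>S. s <\<^sub>r a} \<union> sumset S (low S as)"

text \<open>Induction on the list: either \<open>x\<close> uses only summands below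
  \<open>a\<close>, or \<open>x = s + y\<close> with \<open>s\<close> at least \<open>a\<close>. In
  the second case the induction hypothesis for \<open>y\<close> gives membership in the sumset or,
  adding the two inequalities, the bound.\<close>

lemma gen_low:
  assumes "\<And>s. s \<in> S \<Longrightarrow> 0 <\<^sub>r s" "x \<in> gen S"
  shows "x \<in> low S as \<or> sum_list as \<le>\<^sub>r x"
  using assms(2)
proof (induction as arbitrary: x)
  case Nil
  then show ?case using gen_nonneg[OF assms(1)] by simp
next
  case (Cons a as)
  show ?case
  proof (cases "x \<in> gen {s\<in>S. s <\<^sub>r a}")
    case False
    then obtain s y where "s \<in> S" "y \<in> gen S" "a \<le>\<^sub>r s" "x = s + y"
      using gen_split Cons.prems by blast
    then show ?thesis using Cons.IH[of y] by (auto simp: add_mono)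
  qed auto
qed

text \<open>To find a minimum of \<open>T\<close>, pick any element \<open>sum_list as\<close> of
  it. Everything in \<open>T\<close> not above that element lies in \<open>low S as\<close>, which
  is well-ordered as a finite combination of sumsets and unions.\<close>

lemma wo_gen_step:
  assumes S: "wo S" "\<And>s. s \<in> S \<Longrightarrow> 0 <\<^sub>r s"
    and IH: "\<And>a. a \<in> S \<Longrightarrow> wo (gen {s\<in>S. s <\<^sub>r a})"
  shows "wo (gen S)"
  unfolding wo_def
proof (intro allI impI)
  fix T assume T: "T \<subseteq> gen S" "T \<noteq> {}"
  then obtain t where "t \<in> T" "t \<in> gen S" by auto
  then obtain as where as: "sum_list as \<in> T" "set as \<subseteq> S" by (auto simp: gen_def)
  have "wo (low S bs)" if "set bs \<subseteq> S" for bs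
    using that by (induction bs) (auto intro!: wo_Un wo_sumset S IH)
  then have wo: "wo (low S as)" using as by blast
  show "\<exists>x\<in>T. \<forall>y\<in>T. x \<le>\<^sub>r y"
  proof (cases "T \<inter> low S as = {}")
    case True
    then show ?thesis using as T gen_low[OF S(2)] by blast
  next
    case False
    then obtain x where x: "x \<in> T \<inter> low S as" "\<forall>y\<in>T \<inter> low S as. x \<le>\<^sub>r y"
      using wo unfolding wo_def by (metis inf_le2)
    have *: "x \<le>\<^sub>r y \<or> sum_list as \<le>\<^sub>r y" if y: "y \<in> T" for y
    proof -
      have "y \<in> low S as \<or> sum_list as \<le>\<^sub>r y"
        by (rule gen_low[OF S(2)]) (use y T in auto)
      then show ?thesis using x y by blast
    qed
    show ?thesis
    proof (cases "x \<le>\<^sub>r sum_list as")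
      case True
      then show ?thesis using x * le_trans by blast
    next
      case False
      then have "sum_list as \<le>\<^sub>r x" by (simp add: not_le lt_le)
      then show ?thesis using as * le_trans by blast
    qed
  qed
qed

text \<open>\<open>wo_gen_step\<close> reduces the claim to proper initial segments of
  \<open>S\<close>. An initial segment of such a segment is again one of \<open>S\<close>, so
  well-founded induction along \<open>S\<close> closes the recursion.\<close>

lemma wo_gen:
  assumes S: "wo S" "\<And>s. s \<in> S \<Longrightarrow> 0 <\<^sub>r s"
  shows "wo (gen S)"
proof (rule wo_gen_step[OF S])
  have wf: "wf {(x, y). x \<in> S \<and> y \<in> S \<and> x <\<^sub>r y}"
    using S(1) by (simp add: wo_iff_wf)
  fix a assume "a \<in> S"
  then show "wo (gen {s\<in>S. s <\<^sub>r a})"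
  proof (induction a rule: wf_induct_rule[OF wf])
    case (1 a)
    show ?case
    proof (rule wo_gen_step)
      show "wo {s\<in>S. s <\<^sub>r a}" by (rule wo_subset[OF S(1)]) auto
    next
      fix a' assume a': "a' \<in> {s\<in>S. s <\<^sub>r a}"
      then have "{s \<in> {s\<in>S. s <\<^sub>r a}. s <\<^sub>r a'} = {s\<in>S. s <\<^sub>r a'}"
        using lt_trans by auto
      then show "wo (gen {s \<in> {s\<in>S. s <\<^sub>r a}. s <\<^sub>r a'})"
        using 1 a' by auto
    qed (use S in auto)
  qed
qed

end

text \<open>Counting summands with weight \<open>-1\<close> turns a bound on the number of summands into
  well-ordering for the lexicographic order.\<close>

definition lex_int :: "'m rel \<Rightarrow> ('m \<times> int) rel" where
  "lex_int r = {((x, a), (y, b)). (x, y) \<in> r \<and> x \<noteq> y \<or> x = y \<and> a \<le> b}"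

lemma to_monoid_lex_int:
  fixes r :: "('m::comm_monoid_add) rel"
  assumes "to_monoid r"
  shows "to_monoid (lex_int r)"
proof -
  interpret to_monoid r by fact
  have eq: "((x, a), (y, b)) \<in> lex_int r \<longleftrightarrow> x <\<^sub>r y \<or> x = y \<and> a \<le> b" for x y a b
    by (auto simp: lex_int_def lt_def)
  have "linear_order (lex_int r)"
    unfolding order_on_defs total_on_def
    by (auto simp: eq refl_on_def intro!: transI antisymI dest: lt_trans)
       (use lt_linear lt_trans lt_irrefl in blast)+
  moreover have "((z + x, w + a), (z + y, w + b)) \<in> lex_int r - Id"
    if "((x, a), (y, b)) \<in> lex_int r - Id" for x y z a b w
    using that by (auto simp: eq)
  ultimately show ?thesis
    by unfold_locales (auto simp: totally_ordered_monoid_def add.commute)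
qed

context to_monoid
begin

text \<open>Apply Neumann's lemma to the pairs \<open>(s, -1)\<close>, which remain positive since
  the first component decides. A list with sum \<open>x\<close> then yields the pair of
  \<open>x\<close> and minus its length, so a least pair over \<open>x\<close> belongs to a longest
  list.\<close>

lemma length_bounded:
  assumes S: "wo S" "\<And>s. s \<in> S \<Longrightarrow> 0 <\<^sub>r s"
  shows "\<exists>L. \<forall>xs\<in>lists S. sum_list xs = x \<longrightarrow> length xs < L"
proof -
  interpret lx: to_monoid "lex_int r"
    by (rule to_monoid_lex_int) unfold_locales
  let ?S = "(\<lambda>s. (s, -1 :: int)) ` S"
  have eq: "lx.le (x, a) (y, b) \<longleftrightarrow> x <\<^sub>r y \<or> x = y \<and> a \<le> b" for x y a b
    unfolding lx.le_def by (auto simp: lex_int_def lt_def)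
  have "lx.wo ?S"
    unfolding lx.wo_def
  proof (intro allI impI)
    fix T assume T: "T \<subseteq> ?S" "T \<noteq> {}"
    then have "fst ` T \<subseteq> S" "fst ` T \<noteq> {}" by auto
    then obtain s where "s \<in> fst ` T" "\<forall>y\<in>fst ` T. s \<le>\<^sub>r y"
      using S(1) unfolding wo_def by meson
    then show "\<exists>x\<in>T. \<forall>y\<in>T. lx.le x y"
      using T by (intro bexI[of _ "(s, -1)"]) (force simp: eq lt_le)+
  qed
  moreover have "lx.lt 0 s" if "s \<in> ?S" for s
    using that S(2) by (auto simp: lx.lt_le zero_prod_def eq)
  ultimately have wo: "lx.wo (lx.gen ?S)"
    by (rule lx.wo_gen)
  have sl: "sum_list (map (\<lambda>s. (s, -1 :: int)) xs) = (sum_list xs, - int (length xs))" for xs :: "'m list"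
    by (induction xs) (auto simp: zero_prod_def)
  define T where "T = (\<lambda>xs. (x, - int (length xs))) ` {xs \<in> lists S. sum_list xs = x}"
  have "T \<subseteq> lx.gen ?S"
  proof
    fix t assume "t \<in> T"
    then obtain xs where xs: "xs \<in> lists S" "t = sum_list (map (\<lambda>s. (s, -1 :: int)) xs)"
      by (auto simp: T_def sl)
    then show "t \<in> lx.gen ?S"
      unfolding lx.gen_def xs(2) by (intro imageI) auto
  qed
  show ?thesis
  proof (cases "T = {}")
    case False
    then obtain t where t: "t \<in> T" "\<forall>y\<in>T. lx.le t y"
      using wo \<open>T \<subseteq> _\<close> unfolding lx.wo_def by meson
    then obtain xs0 :: "'m list" where xs0: "t = (x, - int (length xs0))"
      using t(1) unfolding T_def by blast
    have "length xs < Suc (length xs0)" if "xs \<in> lists S" "sum_list xs = x" for xs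
    proof -
      have "(x, - int (length xs)) \<in> T"
        unfolding T_def using that by (intro imageI) auto
      then have "lx.le (x, - int (length xs0)) (x, - int (length xs))"
        using t xs0 by blast
      then show ?thesis by (simp add: eq)
    qed
    then show ?thesis by blast
  qed (auto simp: T_def)
qed

end

section \<open>The ring of Malcev-Neumann series\<close>

context to_monoid
begin

lemma carrier_iff: "\<eta> \<in> carrier (mn_ring r) \<longleftrightarrow> wo (mn_supp \<eta>)"
proof -
  have "Restr r (mn_supp \<eta>) - Id = {(x, y). x \<in> mn_supp \<eta> \<and> y \<in> mn_supp \<eta> \<and> x <\<^sub>r y}"
    by (auto simp: lt_def)
  moreover have "linear_order_on (mn_supp \<eta>) (Restr r (mn_supp \<eta>))"
    using lin by (auto simp: order_on_defs refl_on_def total_on_def antisym_def trans_def)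
  ultimately show ?thesis
    by (simp add: mn_ring_def well_order_on_def wo_iff_wf)
qed

lemma carrierI: "mn_supp \<eta> \<subseteq> A \<Longrightarrow> wo A \<Longrightarrow> \<eta> \<in> carrier (mn_ring r)"
  using wo_subset by (auto simp: carrier_iff)

text \<open>The index sets may be any well-ordered supersets of the supports, so that several
  products can be compared over one common index set.\<close>

lemma mult_eq:
  assumes "mn_supp \<eta> \<subseteq> A" "mn_supp \<zeta> \<subseteq> B" "wo A" "wo B"
  shows "(\<eta> \<otimes>\<^bsub>mn_ring r\<^esub> \<zeta>) m = (\<Sum>(p, q)\<in>{(p, q). p \<in> A \<and> q \<in> B \<and> p + q = m}. \<eta> p * \<zeta> q)"
  using assms unfolding mn_ring_def monoid.simps
  by (intro sum.mono_neutral_left finite_sum_reps) (auto simp: mn_supp_def)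

lemma add_apply [simp]: "(\<eta> \<oplus>\<^bsub>mn_ring r\<^esub> \<zeta>) m = \<eta> m + \<zeta> m"
  by (simp add: mn_ring_def)

lemma zero_apply [simp]: "\<zero>\<^bsub>mn_ring r\<^esub> m = 0"
  by (simp add: mn_ring_def)

lemma one_apply: "\<one>\<^bsub>mn_ring r\<^esub> m = (if m = 0 then 1 else 0)"
  by (simp add: mn_ring_def)

lemma supp_mult:
  assumes "mn_supp \<eta> \<subseteq> A" "mn_supp \<zeta> \<subseteq> B"
  shows "mn_supp (\<eta> \<otimes>\<^bsub>mn_ring r\<^esub> \<zeta>) \<subseteq> sumset A B"
proof
  fix m assume "m \<in> mn_supp (\<eta> \<otimes>\<^bsub>mn_ring r\<^esub> \<zeta>)"
  then have "{(p, q). p + q = m \<and> \<eta> p \<noteq> 0 \<and> \<zeta> q \<noteq> 0} \<noteq> {}"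
    unfolding mn_supp_def mn_ring_def monoid.simps mem_Collect_eq by (metis (no_types, lifting) sum.empty)
  then show "m \<in> sumset A B"
    using assms by (auto simp: mn_supp_def)
qed

lemma supp_one: "mn_supp \<one>\<^bsub>mn_ring r\<^esub> \<subseteq> {0}"
  by (auto simp: mn_supp_def one_apply)

lemma mult_comm: "\<eta> \<otimes>\<^bsub>mn_ring r\<^esub> \<zeta> = \<zeta> \<otimes>\<^bsub>mn_ring r\<^esub> \<eta>"
  unfolding mn_ring_def monoid.simps
  by (rule ext, rule sum.reindex_bij_witness[of _ prod.swap prod.swap])
     (auto simp: add.commute mult.commute)

text \<open>The triple sum is symmetric in the three factors. Associativity then follows by rotating
  the factors and using commutativity.\<close>

lemma mult_mult_eq_sum:
  fixes \<eta> \<zeta> \<xi> :: "'m \<Rightarrow> 'r::comm_ring_1"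
  assumes "wo (mn_supp \<eta>)" "wo (mn_supp \<zeta>)" "wo (mn_supp \<xi>)"
  shows "((\<eta> \<otimes>\<^bsub>mn_ring r\<^esub> \<zeta>) \<otimes>\<^bsub>mn_ring r\<^esub> \<xi>) m =
    (\<Sum>(p, q, s)\<in>{(p, q, s). p \<in> mn_supp \<eta> \<and> q \<in> mn_supp \<zeta> \<and> s \<in> mn_supp \<xi> \<and> p + q + s = m}. \<eta> p * \<zeta> q * \<xi> s)"
proof -
  let ?A = "mn_supp \<eta>" and ?B = "mn_supp \<zeta>" and ?C = "mn_supp \<xi>"
  let ?T = "{(x, s). x \<in> sumset ?A ?B \<and> s \<in> ?C \<and> x + s = m}"
  let ?P = "\<lambda>x. {(p, q). p \<in> ?A \<and> q \<in> ?B \<and> p + q = x}"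
  have fin: "finite ?T" "finite (?P x)" for x
    by (intro finite_sum_reps wo_sumset assms)+
  have "((\<eta> \<otimes>\<^bsub>mn_ring r\<^esub> \<zeta>) \<otimes>\<^bsub>mn_ring r\<^esub> \<xi>) m = (\<Sum>(x, s)\<in>?T. (\<eta> \<otimes>\<^bsub>mn_ring r\<^esub> \<zeta>) x * \<xi> s)"
    by (intro mult_eq supp_mult wo_sumset assms order_refl)
  also have "\<dots> = (\<Sum>z\<in>?T. \<Sum>y\<in>?P (fst z). \<eta> (fst y) * \<zeta> (snd y) * \<xi> (snd z))"
    by (intro sum.cong refl) (auto simp: mult_eq[OF order_refl order_refl assms(1,2)] sum_distrib_right case_prod_beta)
  also have "\<dots> = (\<Sum>(z, y)\<in>Sigma ?T (\<lambda>z. ?P (fst z)). \<eta> (fst y) * \<zeta> (snd y) * \<xi> (snd z))"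
    by (rule sum.Sigma) (use fin in auto)
  also have "\<dots> = (\<Sum>(p, q, s)\<in>{(p, q, s). p \<in> ?A \<and> q \<in> ?B \<and> s \<in> ?C \<and> p + q + s = m}. \<eta> p * \<zeta> q * \<xi> s)"
    by (rule sum.reindex_bij_witness[of _ "\<lambda>(p, q, s). ((p + q, s), (p, q))" "\<lambda>((x, s), (p, q)). (p, q, s)"]) auto
  finally show ?thesis .
qed

lemma mult_assoc:
  fixes \<eta> \<zeta> \<xi> :: "'m \<Rightarrow> 'r::comm_ring_1"
  assumes "wo (mn_supp \<eta>)" "wo (mn_supp \<zeta>)" "wo (mn_supp \<xi>)"
  shows "(\<eta> \<otimes>\<^bsub>mn_ring r\<^esub> \<zeta>) \<otimes>\<^bsub>mn_ring r\<^esub> \<xi> = \<eta> \<otimes>\<^bsub>mn_ring r\<^esub> (\<zeta> \<otimes>\<^bsub>mn_ring r\<^esub> \<xi>)"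
proof
  fix m
  have "(\<eta> \<otimes>\<^bsub>mn_ring r\<^esub> (\<zeta> \<otimes>\<^bsub>mn_ring r\<^esub> \<xi>)) m = ((\<zeta> \<otimes>\<^bsub>mn_ring r\<^esub> \<xi>) \<otimes>\<^bsub>mn_ring r\<^esub> \<eta>) m"
    by (simp add: mult_comm)
  also have "\<dots> = ((\<eta> \<otimes>\<^bsub>mn_ring r\<^esub> \<zeta>) \<otimes>\<^bsub>mn_ring r\<^esub> \<xi>) m"
    unfolding mult_mult_eq_sum[OF assms(2,3,1)] mult_mult_eq_sum[OF assms]
    by (rule sum.reindex_bij_witness[of _ "\<lambda>(p, q, s). (q, s, p)" "\<lambda>(q, s, p). (p, q, s)"])
       (auto simp: ac_simps)
  finally show "((\<eta> \<otimes>\<^bsub>mn_ring r\<^esub> \<zeta>) \<otimes>\<^bsub>mn_ring r\<^esub> \<xi>) m = (\<eta> \<otimes>\<^bsub>mn_ring r\<^esub> (\<zeta> \<otimes>\<^bsub>mn_ring r\<^esub> \<xi>)) m"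
    by simp
qed

lemma one_mult: "wo (mn_supp \<eta>) \<Longrightarrow> \<one>\<^bsub>mn_ring r\<^esub> \<otimes>\<^bsub>mn_ring r\<^esub> \<eta> = \<eta>"
proof
  fix m assume wo: "wo (mn_supp \<eta>)"
  have "(\<one>\<^bsub>mn_ring r\<^esub> \<otimes>\<^bsub>mn_ring r\<^esub> \<eta>) m =
      (\<Sum>(p, q)\<in>{(p, q). p \<in> {0} \<and> q \<in> mn_supp \<eta> \<and> p + q = m}. \<one>\<^bsub>mn_ring r\<^esub> p * \<eta> q)"
    by (rule mult_eq) (auto simp: wo supp_one)
  also have "{(p, q). p \<in> {0} \<and> q \<in> mn_supp \<eta> \<and> p + q = m} = (if m \<in> mn_supp \<eta> then {(0, m)} else {})"
    by auto
  also have "(\<Sum>(p, q)\<in>(if m \<in> mn_supp \<eta> then {(0, m)} else {}). \<one>\<^bsub>mn_ring r\<^esub> p * \<eta> q) = \<eta> m"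
    by (simp add: one_apply mn_supp_def)
  finally show "(\<one>\<^bsub>mn_ring r\<^esub> \<otimes>\<^bsub>mn_ring r\<^esub> \<eta>) m = \<eta> m" .
qed

lemma cring_mn_ring: "cring (mn_ring r :: ('m \<Rightarrow> 'r::comm_ring_1) ring)"
proof (rule cringI)
  show "abelian_group (mn_ring r :: ('m \<Rightarrow> 'r) ring)"
  proof (rule abelian_groupI)
    fix x y :: "'m \<Rightarrow> 'r" assume "x \<in> carrier (mn_ring r)" "y \<in> carrier (mn_ring r)"
    then show "x \<oplus>\<^bsub>mn_ring r\<^esub> y \<in> carrier (mn_ring r)"
      unfolding carrier_iff by (rule wo_subset[OF wo_Un]) (auto simp: mn_supp_def)
  next
    fix x :: "'m \<Rightarrow> 'r" assume "x \<in> carrier (mn_ring r)"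
    then show "\<exists>y\<in>carrier (mn_ring r). y \<oplus>\<^bsub>mn_ring r\<^esub> x = \<zero>\<^bsub>mn_ring r\<^esub>"
      by (intro bexI[of _ "\<lambda>m. - x m"]) (auto simp: carrier_iff mn_supp_def)
  qed (auto simp: carrier_iff mn_supp_def fun_eq_iff add_ac)
  show "comm_monoid (mn_ring r :: ('m \<Rightarrow> 'r) ring)"
  proof (rule comm_monoidI)
    fix x y :: "'m \<Rightarrow> 'r" assume "x \<in> carrier (mn_ring r)" "y \<in> carrier (mn_ring r)"
    then show "x \<otimes>\<^bsub>mn_ring r\<^esub> y \<in> carrier (mn_ring r)"
      using wo_subset[OF wo_sumset supp_mult] by (auto simp: carrier_iff)
  next
    show "\<one>\<^bsub>mn_ring r\<^esub> \<in> carrier (mn_ring r :: ('m \<Rightarrow> 'r) ring)"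
      using wo_subset[OF wo_singleton supp_one] by (auto simp: carrier_iff)
  next
    fix x y :: "'m \<Rightarrow> 'r"
    show "x \<otimes>\<^bsub>mn_ring r\<^esub> y = y \<otimes>\<^bsub>mn_ring r\<^esub> x" by (rule mult_comm)
  qed (auto simp: carrier_iff mult_assoc one_mult)
next
  fix x y z :: "'m \<Rightarrow> 'r"
  assume "x \<in> carrier (mn_ring r)" "y \<in> carrier (mn_ring r)" "z \<in> carrier (mn_ring r)"
  then have wo: "wo (mn_supp x)" "wo (mn_supp y)" "wo (mn_supp z)" "wo (mn_supp x \<union> mn_supp y)"
    by (auto simp: carrier_iff wo_Un)
  show "(x \<oplus>\<^bsub>mn_ring r\<^esub> y) \<otimes>\<^bsub>mn_ring r\<^esub> z = x \<otimes>\<^bsub>mn_ring r\<^esub> z \<oplus>\<^bsub>mn_ring r\<^esub> y \<otimes>\<^bsub>mn_ring r\<^esub> z"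
  proof
    fix m
    note eq = mult_eq[of _ "mn_supp x \<union> mn_supp y" z "mn_supp z" m, OF _ order_refl wo(4) wo(3)]
    have "((x \<oplus>\<^bsub>mn_ring r\<^esub> y) \<otimes>\<^bsub>mn_ring r\<^esub> z) m = (x \<otimes>\<^bsub>mn_ring r\<^esub> z) m + (y \<otimes>\<^bsub>mn_ring r\<^esub> z) m"
      by (subst (1 2 3) eq)
         (auto simp: mn_supp_def sum.distrib[symmetric] algebra_simps intro!: sum.cong)
    then show "((x \<oplus>\<^bsub>mn_ring r\<^esub> y) \<otimes>\<^bsub>mn_ring r\<^esub> z) m = (x \<otimes>\<^bsub>mn_ring r\<^esub> z \<oplus>\<^bsub>mn_ring r\<^esub> y \<otimes>\<^bsub>mn_ring r\<^esub> z) m"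
      by simp
  qed
qed

end

sublocale to_monoid \<subseteq> mn: cring "mn_ring r :: ('m \<Rightarrow> 'r::comm_ring_1) ring"
  by (rule cring_mn_ring)

context to_monoid
begin

section \<open>Coefficients and supports of sums, powers and finite products\<close>

lemma uminus_eq: "\<eta> \<in> carrier (mn_ring r) \<Longrightarrow> \<ominus>\<^bsub>mn_ring r\<^esub> \<eta> = (\<lambda>m. - \<eta> m)"
  by (rule mn.minus_equality) (auto simp: carrier_iff mn_supp_def fun_eq_iff)

lemma minus_apply:
  "\<eta> \<in> carrier (mn_ring r) \<Longrightarrow> \<zeta> \<in> carrier (mn_ring r) \<Longrightarrow> (\<eta> \<ominus>\<^bsub>mn_ring r\<^esub> \<zeta>) m = \<eta> m - \<zeta> m"
  by (simp add: a_minus_def uminus_eq)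

lemma finsum_apply:
  "finite I \<Longrightarrow> (\<And>i. i \<in> I \<Longrightarrow> V i \<in> carrier (mn_ring r)) \<Longrightarrow>
    (\<Oplus>\<^bsub>mn_ring r\<^esub>i\<in>I. V i) m = (\<Sum>i\<in>I. V i m)"
  by (induction I rule: finite_induct) (auto simp: mn.finsum_insert)

lemma add_pow_apply:
  assumes "\<eta> \<in> carrier (mn_ring r)"
  shows "([(k::int)] \<cdot>\<^bsub>mn_ring r\<^esub> \<eta>) m = of_int k * \<eta> m"
proof -
  have n: "([(n::nat)] \<cdot>\<^bsub>mn_ring r\<^esub> \<eta>) m = of_nat n * \<eta> m" for n
    by (induction n) (auto simp: mn.add.nat_pow_Suc algebra_simps)
  have c: "[(n::nat)] \<cdot>\<^bsub>mn_ring r\<^esub> \<eta> \<in> carrier (mn_ring r)" for n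
    using assms by (rule mn.add.nat_pow_closed)
  show ?thesis
    using n[of "nat k"] n[of "nat (- k)"] uminus_eq[OF c, of "nat (- k)"]
    by (auto simp: add_pow_def int_pow_def2 nat_pow_def a_inv_def Let_def fun_eq_iff)
qed

text \<open>The exact number of summands is recorded so that \<open>pow_eventually_zero\<close> can
  play it off against the bound from \<open>length_bounded\<close>.\<close>

lemma supp_pow:
  assumes "mn_supp \<eta> \<subseteq> A"
  shows "mn_supp (\<eta> [^]\<^bsub>mn_ring r\<^esub> (n::nat)) \<subseteq> {sum_list xs | xs. xs \<in> lists A \<and> length xs = n}"
proof (induction n)
  case 0
  then show ?case using supp_one by (auto simp: mn.nat_pow_0)
next
  case (Suc n)
  have "mn_supp (\<eta> [^]\<^bsub>mn_ring r\<^esub> Suc n) \<subseteq> sumset {sum_list xs | xs. xs \<in> lists A \<and> length xs = n} A"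
    unfolding mn.nat_pow_Suc by (rule supp_mult[OF Suc assms])
  also have "\<dots> \<subseteq> {sum_list xs | xs. xs \<in> lists A \<and> length xs = Suc n}"
  proof
    fix x assume "x \<in> sumset {sum_list xs | xs. xs \<in> lists A \<and> length xs = n} A"
    then obtain xs a where "x = sum_list xs + a" "xs \<in> lists A" "length xs = n" "a \<in> A"
      unfolding sumset_def by blast
    then show "x \<in> {sum_list xs | xs. xs \<in> lists A \<and> length xs = Suc n}"
      by (intro CollectI exI[of _ "a # xs"]) (auto simp: add.commute)
  qed
  finally show ?case .
qed

lemma supp_pow_gen: "mn_supp \<eta> \<subseteq> A \<Longrightarrow> mn_supp (\<eta> [^]\<^bsub>mn_ring r\<^esub> (n::nat)) \<subseteq> gen A"
  using supp_pow[of \<eta> A n] by (auto simp: gen_def)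

lemma wo_sum_PiE:
  assumes "finite I" "\<And>i. i \<in> I \<Longrightarrow> wo (A i)"
  shows "wo {sum \<phi> I | \<phi>. \<phi> \<in> PiE I A}"
  using assms
proof (induction I rule: finite_induct)
  case (insert i I)
  have "{sum \<phi> (insert i I) | \<phi>. \<phi> \<in> PiE (insert i I) A} \<subseteq> sumset (A i) {sum \<phi> I | \<phi>. \<phi> \<in> PiE I A}"
  proof
    fix x assume "x \<in> {sum \<phi> (insert i I) | \<phi>. \<phi> \<in> PiE (insert i I) A}"
    then obtain \<phi> where \<phi>: "x = sum \<phi> (insert i I)" "\<phi> \<in> PiE (insert i I) A" by auto
    have "x = \<phi> i + sum (restrict \<phi> I) I"
      using \<phi> insert by simp
    moreover have "restrict \<phi> I \<in> PiE I A" using \<phi> by auto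
    ultimately show "x \<in> sumset (A i) {sum \<phi> I | \<phi>. \<phi> \<in> PiE I A}"
      using \<phi> unfolding sumset_def by blast
  qed
  then show ?case
    using insert by (blast intro: wo_subset wo_sumset)
qed auto

text \<open>The three claims share one induction: to compute the value for
  \<open>insert i I\<close>, \<open>mult_eq\<close> needs the smaller product to be supported in a
  well-ordered set, and merging the nested sums needs the finiteness.\<close>

lemma finprod_eq:
  fixes V :: "'i \<Rightarrow> 'm \<Rightarrow> 'r::comm_ring_1"
  assumes "finite I" "\<And>i. i \<in> I \<Longrightarrow> wo (A i)" "\<And>i. i \<in> I \<Longrightarrow> mn_supp (V i) \<subseteq> A i"
  shows "finite {\<phi> \<in> PiE I A. sum \<phi> I = m} \<and>
    mn_supp (\<Otimes>\<^bsub>mn_ring r\<^esub>i\<in>I. V i) \<subseteq> {sum \<phi> I | \<phi>. \<phi> \<in> PiE I A} \<and>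
    (\<Otimes>\<^bsub>mn_ring r\<^esub>i\<in>I. V i) m = (\<Sum>\<phi>\<in>{\<phi> \<in> PiE I A. sum \<phi> I = m}. \<Prod>i\<in>I. V i (\<phi> i))"
  using assms
proof (induction I arbitrary: m rule: finite_induct)
  case empty
  then show ?case by (auto simp: one_apply mn_supp_def)
next
  case (insert i I)
  let ?B = "{sum \<phi> I | \<phi>. \<phi> \<in> PiE I A}"
  let ?R = "\<lambda>q. {\<phi> \<in> PiE I A. sum \<phi> I = q}"
  let ?R' = "{\<phi> \<in> PiE (insert i I) A. sum \<phi> (insert i I) = m}"
  let ?T = "{(p, q). p \<in> A i \<and> q \<in> ?B \<and> p + q = m}"
  let ?F = "\<Otimes>\<^bsub>mn_ring r\<^esub>i\<in>I. V i"
  have IH: "finite (?R q)" "mn_supp ?F \<subseteq> ?B" "?F q = (\<Sum>\<phi>\<in>?R q. \<Prod>i\<in>I. V i (\<phi> i))" for q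
    using insert by auto
  have woB: "wo ?B" by (rule wo_sum_PiE) (use insert in auto)
  have woA: "wo (A i)" using insert by auto
  have fin: "finite ?T" by (rule finite_sum_reps[OF woA woB])
  have V: "V j \<in> carrier (mn_ring r)" if "j \<in> insert i I" for j
    using insert.prems that by (blast intro: carrierI)
  have F: "(\<Otimes>\<^bsub>mn_ring r\<^esub>i\<in>insert i I. V i) = V i \<otimes>\<^bsub>mn_ring r\<^esub> ?F"
    using insert V by (intro mn.finprod_insert) auto
  have restr: "sum (restrict \<phi> I) I = sum \<phi> I" for \<phi> :: "'i \<Rightarrow> 'm" by simp
  have upd: "sum (\<phi>(i := p)) I = sum \<phi> I" for \<phi> :: "'i \<Rightarrow> 'm" and p
    using insert by (intro sum.cong) auto
  have updi: "sum (\<phi>(i := p)) (insert i I) = p + sum \<phi> I" for \<phi> :: "'i \<Rightarrow> 'm" and p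
    using insert upd by simp
  have upd': "(\<Prod>j\<in>I. V j ((\<phi>(i := p)) j)) = (\<Prod>j\<in>I. V j (\<phi> j))" for \<phi> p
    using insert by (intro prod.cong) auto
  \<comment> \<open>A choice of exponents on \<open>insert i I\<close> with sum \<open>m\<close> is
    the same as an exponent \<open>p\<close> at \<open>i\<close> and a choice on \<open>I\<close>
    whose sum \<open>q\<close> satisfies \<open>p + q = m\<close>.\<close>
  have bij: "bij_betw (\<lambda>(z, \<phi>). \<phi>(i := fst z)) (Sigma ?T (\<lambda>z. ?R (snd z))) ?R'"
  proof (rule bij_betw_byWitness[where f' = "\<lambda>\<phi>. ((\<phi> i, sum \<phi> I), restrict \<phi> I)"])
    show "\<forall>a\<in>Sigma ?T (\<lambda>z. ?R (snd z)). (\<lambda>\<phi>. ((\<phi> i, sum \<phi> I), restrict \<phi> I)) ((\<lambda>(z, \<phi>). \<phi>(i := fst z)) a) = a"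
    proof
      fix a assume mem: "a \<in> Sigma ?T (\<lambda>z. ?R (snd z))"
      obtain p q \<phi> where "a = ((p, q), \<phi>)" by (metis surj_pair)
      then have a: "a = ((p, sum \<phi> I), \<phi>)" "\<phi> \<in> PiE I A" using mem by simp_all
      have "restrict (\<phi>(i := p)) I = restrict \<phi> I"
        using insert(2) by (intro restrict_ext) auto
      also have "\<dots> = \<phi>" using a(2) by (rule PiE_restrict)
      finally have "restrict (\<phi>(i := p)) I = \<phi>" .
      then show "(\<lambda>\<phi>. ((\<phi> i, sum \<phi> I), restrict \<phi> I)) ((\<lambda>(z, \<phi>). \<phi>(i := fst z)) a) = a"
        using upd[of \<phi> p] by (simp add: a del: restrict_fupd)
    qed
    show "\<forall>a'\<in>?R'. (\<lambda>(z, \<phi>). \<phi>(i := fst z)) ((\<lambda>\<phi>. ((\<phi> i, sum \<phi> I), restrict \<phi> I)) a') = a'"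
    proof
      fix \<phi> assume "\<phi> \<in> ?R'"
      then have "restrict \<phi> (insert i I) = \<phi>" by (intro PiE_restrict) blast
      moreover have "(restrict \<phi> I)(i := \<phi> i) = restrict \<phi> (insert i I)"
        by (auto simp: restrict_def)
      ultimately show "(\<lambda>(z, \<phi>). \<phi>(i := fst z)) ((\<lambda>\<phi>. ((\<phi> i, sum \<phi> I), restrict \<phi> I)) \<phi>) = \<phi>"
        by simp
    qed
    show "(\<lambda>(z, \<phi>). \<phi>(i := fst z)) ` Sigma ?T (\<lambda>z. ?R (snd z)) \<subseteq> ?R'"
    proof
      fix \<psi> assume "\<psi> \<in> (\<lambda>(z, \<phi>). \<phi>(i := fst z)) ` Sigma ?T (\<lambda>z. ?R (snd z))"
      then obtain p \<phi> where \<psi>: "\<psi> = \<phi>(i := p)" "p \<in> A i" "\<phi> \<in> PiE I A" "p + sum \<phi> I = m" by auto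
      then show "\<psi> \<in> ?R'" using PiE_fun_upd[OF \<psi>(2,3)] updi[of \<phi> p] by simp
    qed
    show "(\<lambda>\<phi>. ((\<phi> i, sum \<phi> I), restrict \<phi> I)) ` ?R' \<subseteq> Sigma ?T (\<lambda>z. ?R (snd z))"
    proof
      fix x assume "x \<in> (\<lambda>\<phi>. ((\<phi> i, sum \<phi> I), restrict \<phi> I)) ` ?R'"
      then obtain \<phi> where \<phi>: "x = ((\<phi> i, sum \<phi> I), restrict \<phi> I)" "\<phi> \<in> PiE (insert i I) A"
          "sum \<phi> (insert i I) = m" by auto
      have "restrict \<phi> I \<in> PiE I A" using \<phi> by auto
      moreover from this have "sum \<phi> I \<in> ?B" using restr[of \<phi>] by (metis (mono_tags, lifting) mem_Collect_eq)
      ultimately show "x \<in> Sigma ?T (\<lambda>z. ?R (snd z))"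
        using \<phi> insert by auto
    qed
  qed
  have 1: "finite ?R'"
    using bij_betw_finite[OF bij] fin IH(1) by auto
  have 2: "mn_supp (\<Otimes>\<^bsub>mn_ring r\<^esub>i\<in>insert i I. V i) \<subseteq> {sum \<phi> (insert i I) | \<phi>. \<phi> \<in> PiE (insert i I) A}"
  proof -
    have "mn_supp (V i \<otimes>\<^bsub>mn_ring r\<^esub> ?F) \<subseteq> sumset (A i) ?B"
      using insert IH(2) by (intro supp_mult) auto
    also have "\<dots> \<subseteq> {sum \<phi> (insert i I) | \<phi>. \<phi> \<in> PiE (insert i I) A}"
    proof
      fix x assume "x \<in> sumset (A i) ?B"
      then obtain p \<phi> where "x = p + sum \<phi> I" "p \<in> A i" "\<phi> \<in> PiE I A"
        unfolding sumset_def by blast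
      then show "x \<in> {sum \<phi> (insert i I) | \<phi>. \<phi> \<in> PiE (insert i I) A}"
        using PiE_fun_upd[of p A i \<phi> I] by (intro CollectI exI[of _ "\<phi>(i := p)"]) (auto simp: updi simp del: fun_upd_apply)
    qed
    finally show ?thesis using F by simp
  qed
  have "(V i \<otimes>\<^bsub>mn_ring r\<^esub> ?F) m = (\<Sum>(p, q)\<in>?T. V i p * ?F q)"
    using insert IH(2) woA woB by (intro mult_eq) auto
  also have "\<dots> = (\<Sum>z\<in>?T. \<Sum>\<phi>\<in>?R (snd z). V i (fst z) * (\<Prod>j\<in>I. V j (\<phi> j)))"
    by (simp add: IH(3) sum_distrib_left case_prod_beta)
  also have "\<dots> = (\<Sum>(z, \<phi>)\<in>Sigma ?T (\<lambda>z. ?R (snd z)). V i (fst z) * (\<Prod>j\<in>I. V j (\<phi> j)))"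
    by (rule sum.Sigma) (use fin IH(1) in auto)
  also have "\<dots> = (\<Sum>\<phi>\<in>?R'. \<Prod>j\<in>insert i I. V j (\<phi> j))"
    unfolding sum.reindex_bij_betw[OF bij, symmetric] prod.insert[OF insert(1,2)]
    using insert by (intro sum.cong) (auto simp: upd' fun_upd_same simp del: fun_upd_apply)
  finally show ?case using 1 2 F by simp
qed

section \<open>Monomials and uniqueness of inverses\<close>

definition monomial :: "'r::comm_ring_1 \<Rightarrow> 'm \<Rightarrow> 'm \<Rightarrow> 'r" where
  "monomial u m = (\<lambda>x. if x = m then u else 0)"

lemma supp_monomial: "mn_supp (monomial u m) \<subseteq> {m}"
  by (auto simp: mn_supp_def monomial_def)

lemma monomial_closed [simp]: "monomial u m \<in> carrier (mn_ring r)"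
  by (rule carrierI[OF supp_monomial]) simp

text \<open>Multiplication by a monomial is a shift of the argument. Without subtraction, the shift
  has to be expressed by an explicit additive inverse \<open>m'\<close> of the exponent.\<close>

lemma mult_monomial_apply:
  fixes \<eta> :: "'m \<Rightarrow> 'r::comm_ring_1"
  assumes "m + m' = 0"
  shows "(\<eta> \<otimes>\<^bsub>mn_ring r\<^esub> monomial u m) x = \<eta> (x + m') * u"
proof -
  have 1: "p + m = x \<longleftrightarrow> p = x + m'" for p
  proof
    assume "p + m = x"
    then have "x + m' = p + (m + m')" by (metis add.assoc)
    then show "p = x + m'" using assms by simp
  next
    assume "p = x + m'"
    then have "p + m = x + (m + m')" by (metis add.assoc add.commute)
    then show "p + m = x" using assms by simp
  qed
  have "{(p, q). p + q = x \<and> \<eta> p \<noteq> 0 \<and> monomial u m q \<noteq> 0} = (if \<eta> (x + m') = 0 \<or> u = 0 then {} else {(x + m', m)})"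
    using 1 by (auto simp: monomial_def)
  then show ?thesis
    by (simp add: mn_ring_def monomial_def)
qed

lemma mn_t_eq_monomial: "mn_t m = monomial 1 m"
  by (simp add: mn_t_def monomial_def)

lemma t_closed [simp]: "mn_t m \<in> carrier (mn_ring r)"
  by (simp add: mn_t_eq_monomial)

lemma t_mult: "mn_t m \<otimes>\<^bsub>mn_ring r\<^esub> mn_t m' = mn_t (m + m')"
proof
  fix x
  have "(mn_t m \<otimes>\<^bsub>mn_ring r\<^esub> mn_t m') x = (\<Sum>(p, q)\<in>{(p, q). p \<in> {m} \<and> q \<in> {m'} \<and> p + q = x}. mn_t m p * mn_t m' q)"
    by (rule mult_eq) (simp_all add: mn_t_eq_monomial supp_monomial)
  also have "{(p, q). p \<in> {m} \<and> q \<in> {m'} \<and> p + q = x} = (if x = m + m' then {(m, m')} else {})"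
    by auto
  finally show "(mn_t m \<otimes>\<^bsub>mn_ring r\<^esub> mn_t m') x = mn_t (m + m') x"
    by (auto simp: mn_t_def)
qed

lemma t_zero: "mn_t 0 = \<one>\<^bsub>mn_ring r\<^esub>"
  by (auto simp: mn_t_def one_apply)

lemma t_pow: "mn_t m [^]\<^bsub>mn_ring r\<^esub> n = mn_t (\<Sum>i<n. m)" for n :: nat
  by (induction n) (auto simp: mn.nat_pow_Suc t_zero t_mult)

lemma finprod_t: "finite I \<Longrightarrow> (\<Otimes>\<^bsub>mn_ring r\<^esub>i\<in>I. mn_t (\<mu> i)) = mn_t (\<Sum>i\<in>I. \<mu> i)"
  by (induction I rule: finite_induct) (auto simp: mn.finprod_insert t_zero t_mult)

lemma inv_unique:
  assumes "x \<in> carrier (mn_ring r)" "y \<in> carrier (mn_ring r)" "x \<otimes>\<^bsub>mn_ring r\<^esub> y = \<one>\<^bsub>mn_ring r\<^esub>"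
  shows "inv\<^bsub>mn_ring r\<^esub> x = y" "x \<in> Units (mn_ring r)"
  using assms mn.comm_inv_char mult_comm[of x y] unfolding Units_def by auto

text \<open>Eventual stabilisation of every coefficient is the convergence of formal series.\<close>

lemma eventually_mult:
  assumes wo: "wo A" "wo B" and supp: "mn_supp \<eta> \<subseteq> A" "\<And>n. mn_supp (P n) \<subseteq> B" "mn_supp Q \<subseteq> B"
    and ev: "\<And>q. eventually (\<lambda>n. P n q = Q q) sequentially"
  shows "eventually (\<lambda>n. (\<eta> \<otimes>\<^bsub>mn_ring r\<^esub> P n) m = (\<eta> \<otimes>\<^bsub>mn_ring r\<^esub> Q) m) sequentially"
proof -
  let ?T = "{(p, q). p \<in> A \<and> q \<in> B \<and> p + q = m}"
  have "eventually (\<lambda>n. \<forall>z\<in>?T. P n (snd z) = Q (snd z)) sequentially"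
    by (rule eventually_ball_finite[OF finite_sum_reps[OF wo]]) (use ev in auto)
  then show ?thesis
  proof eventually_elim
    case (elim n)
    show ?case
      unfolding mult_eq[OF supp(1) supp(2) wo] mult_eq[OF supp(1) supp(3) wo]
      using elim by (intro sum.cong) auto
  qed
qed

section \<open>The geometric series as a coefficientwise limit\<close>

definition geo :: "('m \<Rightarrow> 'r::comm_ring_1) \<Rightarrow> nat \<Rightarrow> 'm \<Rightarrow> 'r" where
  "geo z n = (\<Oplus>\<^bsub>mn_ring r\<^esub>i\<in>{..<n}. z [^]\<^bsub>mn_ring r\<^esub> i)"

lemma geo_closed [simp]: "z \<in> carrier (mn_ring r) \<Longrightarrow> geo z n \<in> carrier (mn_ring r)"
  unfolding geo_def by (intro mn.finsum_closed) auto

lemma geo_apply: "z \<in> carrier (mn_ring r) \<Longrightarrow> geo z n m = (\<Sum>i<n. (z [^]\<^bsub>mn_ring r\<^esub> i) m)"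
  unfolding geo_def by (subst finsum_apply) auto

lemma geo_mult:
  assumes z: "z \<in> carrier (mn_ring r)"
  shows "(\<one>\<^bsub>mn_ring r\<^esub> \<ominus>\<^bsub>mn_ring r\<^esub> z) \<otimes>\<^bsub>mn_ring r\<^esub> geo z n = \<one>\<^bsub>mn_ring r\<^esub> \<ominus>\<^bsub>mn_ring r\<^esub> z [^]\<^bsub>mn_ring r\<^esub> n"
proof (induction n)
  case 0
  then show ?case using z by (simp add: geo_def mn.minus_eq mn.r_neg del: add_apply zero_apply)
next
  case (Suc n)
  have "geo z (Suc n) = geo z n \<oplus>\<^bsub>mn_ring r\<^esub> z [^]\<^bsub>mn_ring r\<^esub> n"
    using z by (simp add: fun_eq_iff geo_apply)
  then have "(\<one>\<^bsub>mn_ring r\<^esub> \<ominus>\<^bsub>mn_ring r\<^esub> z) \<otimes>\<^bsub>mn_ring r\<^esub> geo z (Suc n) =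
      (\<one>\<^bsub>mn_ring r\<^esub> \<ominus>\<^bsub>mn_ring r\<^esub> z [^]\<^bsub>mn_ring r\<^esub> n) \<oplus>\<^bsub>mn_ring r\<^esub> (\<one>\<^bsub>mn_ring r\<^esub> \<ominus>\<^bsub>mn_ring r\<^esub> z) \<otimes>\<^bsub>mn_ring r\<^esub> z [^]\<^bsub>mn_ring r\<^esub> n"
    using z Suc by (simp add: mn.r_distr)
  also have "(\<one>\<^bsub>mn_ring r\<^esub> \<ominus>\<^bsub>mn_ring r\<^esub> z) \<otimes>\<^bsub>mn_ring r\<^esub> z [^]\<^bsub>mn_ring r\<^esub> n =
      z [^]\<^bsub>mn_ring r\<^esub> n \<ominus>\<^bsub>mn_ring r\<^esub> z [^]\<^bsub>mn_ring r\<^esub> Suc n"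
    using z by (simp add: mn.minus_eq mn.l_distr mn.l_minus mn.nat_pow_Suc mult_comm[of z])
  finally show ?case
    using z by (simp add: fun_eq_iff minus_apply)
qed

lemma pow_eventually_zero:
  assumes S: "wo S" "\<And>s. s \<in> S \<Longrightarrow> 0 <\<^sub>r s" "mn_supp z \<subseteq> S"
  shows "eventually (\<lambda>n. (z [^]\<^bsub>mn_ring r\<^esub> n) m = 0) sequentially"
proof -
  obtain L where L: "\<And>xs. xs \<in> lists S \<Longrightarrow> sum_list xs = m \<Longrightarrow> length xs < L"
    using length_bounded[OF S(1,2), of m] by blast
  have "(z [^]\<^bsub>mn_ring r\<^esub> n) m = 0" if "n \<ge> L" for n
  proof (rule ccontr)
    assume "(z [^]\<^bsub>mn_ring r\<^esub> n) m \<noteq> 0"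
    then obtain xs where "xs \<in> lists S" "length xs = n" "m = sum_list xs"
      using supp_pow[OF S(3), of n] by (auto simp: mn_supp_def)
    then show False using L[of xs] that by auto
  qed
  then show ?thesis by (auto simp: eventually_sequentially)
qed

text \<open>The inverse \<open>Q\<close> of 1 - z is delivered together with the convergence of the
  partial sums, because \<open>parallel_log\<close> carries a property from the partial sums to the
  limit coefficient by coefficient.\<close>

lemma geo_limit:
  fixes z :: "'m \<Rightarrow> 'r::comm_ring_1"
  assumes S: "wo S" "\<And>s. s \<in> S \<Longrightarrow> 0 <\<^sub>r s" "mn_supp z \<subseteq> S"
  obtains Q where "mn_supp Q \<subseteq> gen S" "\<And>n. mn_supp (geo z n) \<subseteq> gen S"
    "\<And>m. eventually (\<lambda>n. geo z n m = Q m) sequentially"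
    "(\<one>\<^bsub>mn_ring r\<^esub> \<ominus>\<^bsub>mn_ring r\<^esub> z) \<otimes>\<^bsub>mn_ring r\<^esub> Q = \<one>\<^bsub>mn_ring r\<^esub>"
proof -
  have z: "z \<in> carrier (mn_ring r)" by (rule carrierI[OF S(3,1)])
  have pz: "eventually (\<lambda>n. (z [^]\<^bsub>mn_ring r\<^esub> n) m = 0) sequentially" for m
    by (rule pow_eventually_zero[OF S])
  have "\<exists>c. eventually (\<lambda>n. geo z n m = c) sequentially" for m
  proof -
    obtain L where L: "\<And>n::nat. n \<ge> L \<Longrightarrow> (z [^]\<^bsub>mn_ring r\<^esub> n) m = 0"
      using pz[of m] unfolding eventually_sequentially by blast
    have "geo z n m = geo z L m" if "n \<ge> L" for n
      unfolding geo_apply[OF z] by (rule sum.mono_neutral_right) (use that L in auto)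
    then show ?thesis by (auto simp: eventually_sequentially)
  qed
  then obtain Q where Q: "\<And>m. eventually (\<lambda>n. geo z n m = Q m) sequentially"
    by metis
  have sg: "mn_supp (geo z n) \<subseteq> gen S" for n
  proof
    fix m assume "m \<in> mn_supp (geo z n)"
    then have "(\<Sum>i<n. (z [^]\<^bsub>mn_ring r\<^esub> i) m) \<noteq> 0"
      by (simp add: mn_supp_def geo_apply[OF z])
    then obtain i :: nat where "(z [^]\<^bsub>mn_ring r\<^esub> i) m \<noteq> 0"
      by (rule sum.not_neutral_contains_not_neutral)
    then show "m \<in> gen S" using supp_pow_gen[OF S(3), of i] by (auto simp: mn_supp_def)
  qed
  have sQ: "mn_supp Q \<subseteq> gen S"
  proof
    fix m assume "m \<in> mn_supp Q"
    moreover obtain n where "geo z n m = Q m"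
      using eventually_happens[OF Q[of m]] by auto
    ultimately show "m \<in> gen S" using sg[of n] by (auto simp: mn_supp_def)
  qed
  have wg: "wo (gen S)" by (rule wo_gen[OF S(1,2)])
  let ?u = "\<one>\<^bsub>mn_ring r\<^esub> \<ominus>\<^bsub>mn_ring r\<^esub> z"
  have u: "?u \<in> carrier (mn_ring r)" using z by simp
  have "(?u \<otimes>\<^bsub>mn_ring r\<^esub> Q) m = \<one>\<^bsub>mn_ring r\<^esub> m" for m
  proof -
    have "eventually (\<lambda>n. (?u \<otimes>\<^bsub>mn_ring r\<^esub> geo z n) m = (?u \<otimes>\<^bsub>mn_ring r\<^esub> Q) m) sequentially"
      by (rule eventually_mult[OF _ wg order_refl sg sQ Q]) (use u in \<open>simp add: carrier_iff\<close>)
    moreover note pz[of m]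
    ultimately have "eventually (\<lambda>n. (?u \<otimes>\<^bsub>mn_ring r\<^esub> Q) m = \<one>\<^bsub>mn_ring r\<^esub> m) sequentially"
      by eventually_elim (use z in \<open>simp add: geo_mult minus_apply\<close>)
    then show ?thesis by simp
  qed
  then show ?thesis using that[OF sQ sg Q] by blast
qed

end

section \<open>Logarithmic differentials\<close>

text \<open>For \<open>d = 0\<close> the gcd is 0 and division by 0 gives the zero vector. This
  default matters: a parallel family has vanishing coefficients in x-degree 0, just as an exact
  differential has no residue.\<close>

definition prim_vec :: "int ^ 'n::finite \<Rightarrow> int ^ 'n" where
  "prim_vec d = (\<chi> j. d $ j div Gcd (range (\<lambda>i. d $ i)))"

lemma Gcd_prim_vec: "Gcd (range (\<lambda>i. d $ i)) * prim_vec d $ j = d $ j"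
  by (simp add: prim_vec_def)

text \<open>\<open>l\<close> divides every \<open>M * d $ j\<close>, hence also their gcd, which is
  \<open>M\<close> times the gcd of \<open>d\<close> up to sign. With \<open>c\<close> the quotient,
  cancelling \<open>l\<close> gives the claim.\<close>

lemma parallel_prim_vec:
  fixes w d :: "int ^ 'n::finite"
  assumes "l \<noteq> 0" "\<And>j. l * w $ j = M * d $ j"
  shows "\<exists>c. \<forall>j. w $ j = c * prim_vec d $ j"
proof -
  let ?g = "Gcd (range (\<lambda>i. d $ i))"
  have "l dvd Gcd ((*) M ` range (\<lambda>i. d $ i))"
  proof (rule Gcd_greatest)
    fix x assume "x \<in> (*) M ` range (\<lambda>i. d $ i)"
    then obtain i where "x = M * d $ i" by auto
    then show "l dvd x" using assms(2)[of i] by (metis dvd_triv_left)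
  qed
  then have "l dvd M * ?g"
    by (simp only: Gcd_mult dvd_normalize_iff)
  then obtain c where c: "M * ?g = l * c" by (auto simp: dvd_def)
  have "w $ j = c * prim_vec d $ j" for j
  proof -
    have "l * w $ j = M * ?g * prim_vec d $ j"
      using assms(2)[of j] Gcd_prim_vec[of d j] by (simp add: mult.assoc)
    also have "\<dots> = l * (c * prim_vec d $ j)" by (simp add: c)
    finally show ?thesis using assms(1) by simp
  qed
  then show ?thesis by blast
qed

text \<open>Exact differentials have this property, and it stands in for exactness where the
  coefficient ring does not contain the rationals.\<close>

definition parallel :: "('n::finite \<Rightarrow> 'g \<times> (int ^ 'n) \<Rightarrow> 'r::comm_ring_1) \<Rightarrow> bool" where
  "parallel V \<longleftrightarrow> (\<forall>s. \<exists>y. \<forall>j. V j s = y * of_int (prim_vec (snd s) $ j))"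

lemma parallelI: "(\<And>s. \<exists>y. \<forall>j. V j s = y * of_int (prim_vec (snd s) $ j)) \<Longrightarrow> parallel V"
  by (simp add: parallel_def)

lemma parallel_sum:
  assumes "\<And>i. i \<in> I \<Longrightarrow> parallel (V i)"
  shows "parallel (\<lambda>j s. \<Sum>i\<in>I. V i j s)"
proof (rule parallelI)
  fix s
  have "\<forall>i\<in>I. \<exists>y. \<forall>j. V i j s = y * of_int (prim_vec (snd s) $ j)"
    using assms unfolding parallel_def by blast
  then obtain y where "\<And>i j. i \<in> I \<Longrightarrow> V i j s = y i * of_int (prim_vec (snd s) $ j)" by metis
  then show "\<exists>y. \<forall>j. (\<Sum>i\<in>I. V i j s) = y * of_int (prim_vec (snd s) $ j)"
    by (intro exI[of _ "sum y I"]) (simp add: sum_distrib_right)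
qed

lemma parallel_uminus: "parallel V \<Longrightarrow> parallel (\<lambda>j s. - V j s)"
  unfolding parallel_def by (metis mult_minus_left)

locale to_monoid_x = to_monoid r for r :: "('g::comm_monoid_add \<times> (int ^ 'n::finite)) rel"
begin

text \<open>This is \<open>x_j\<close> times the partial derivative. Unlike \<open>mn_deriv\<close>,
  it scales coefficients without moving exponents, so it preserves well-ordered supports at
  once.\<close>

definition euler :: "'n \<Rightarrow> ('g \<times> (int ^ 'n) \<Rightarrow> 'r::comm_ring_1) \<Rightarrow> 'g \<times> (int ^ 'n) \<Rightarrow> 'r" where
  "euler j \<eta> = (\<lambda>m. of_int (snd m $ j) * \<eta> m)"

lemma supp_euler: "mn_supp (euler j \<eta>) \<subseteq> mn_supp \<eta>"
  by (auto simp: euler_def mn_supp_def)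

lemma euler_closed [simp]: "\<eta> \<in> carrier (mn_ring r) \<Longrightarrow> euler j \<eta> \<in> carrier (mn_ring r)"
  using supp_euler by (auto simp: carrier_iff intro: wo_subset)

lemma euler_mult:
  assumes "\<eta> \<in> carrier (mn_ring r)" "\<zeta> \<in> carrier (mn_ring r)"
  shows "euler j (\<eta> \<otimes>\<^bsub>mn_ring r\<^esub> \<zeta>) = euler j \<eta> \<otimes>\<^bsub>mn_ring r\<^esub> \<zeta> \<oplus>\<^bsub>mn_ring r\<^esub> \<eta> \<otimes>\<^bsub>mn_ring r\<^esub> euler j \<zeta>"
proof
  fix m
  have wo: "wo (mn_supp \<eta>)" "wo (mn_supp \<zeta>)" using assms by (auto simp: carrier_iff)
  note eq = mult_eq[OF _ _ wo, of _ _ m]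
  show "euler j (\<eta> \<otimes>\<^bsub>mn_ring r\<^esub> \<zeta>) m = (euler j \<eta> \<otimes>\<^bsub>mn_ring r\<^esub> \<zeta> \<oplus>\<^bsub>mn_ring r\<^esub> \<eta> \<otimes>\<^bsub>mn_ring r\<^esub> euler j \<zeta>) m"
    unfolding add_apply eq[OF supp_euler order_refl] eq[OF order_refl supp_euler] euler_def[of j "_ \<otimes>\<^bsub>mn_ring r\<^esub> _"]
      eq[OF order_refl order_refl] sum_distrib_left sum.distrib[symmetric]
    by (rule sum.cong) (auto simp: euler_def algebra_simps)
qed

lemma euler_one: "euler j \<one>\<^bsub>mn_ring r\<^esub> = \<zero>\<^bsub>mn_ring r\<^esub>"
  by (auto simp: euler_def one_apply fun_eq_iff zero_prod_def)

lemma euler_minus: "\<eta> \<in> carrier (mn_ring r) \<Longrightarrow> \<zeta> \<in> carrier (mn_ring r) \<Longrightarrow>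
    euler j (\<eta> \<ominus>\<^bsub>mn_ring r\<^esub> \<zeta>) = euler j \<eta> \<ominus>\<^bsub>mn_ring r\<^esub> euler j \<zeta>"
  by (rule ext, subst minus_apply[OF euler_closed euler_closed])
     (simp_all add: euler_def minus_apply right_diff_distrib)

text \<open>The coefficients of \<open>A\<^sup>n d A\<close> are sums over \<open>n + 1\<close> exponents in which one position is
  distinguished. Collecting the terms with the same coefficient product gives a set that is
  invariant under transposition of positions, so that \<open>n + 1\<close> times the sum of the distinguished
  degrees is a multiple of the total degree.\<close>

lemma parallel_pow_euler:
  fixes A :: "'g \<times> (int ^ 'n) \<Rightarrow> 'r::comm_ring_1"
  assumes A: "A \<in> carrier (mn_ring r)"
  shows "parallel (\<lambda>j. A [^]\<^bsub>mn_ring r\<^esub> (n::nat) \<otimes>\<^bsub>mn_ring r\<^esub> euler j A)"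
proof (rule parallelI)
  fix s
  let ?S = "mn_supp A" and ?I = "{..n}"
  define P where "P = {\<phi> \<in> PiE ?I (\<lambda>_. ?S). sum \<phi> ?I = s}"
  define c where "c \<phi> = (\<Prod>i\<in>?I. A (\<phi> i))" for \<phi> :: "nat \<Rightarrow> _"
  \<comment> \<open>Grouping by the value of the coefficient product leaves a plain integer vector
    \<open>w y\<close> for each value, so the division by n + 1 takes place before any ring element
    enters.\<close>
  define L where "L y = {\<phi> \<in> P. c \<phi> = y}" for y
  define w where "w y = (\<Sum>\<phi>\<in>L y. snd (\<phi> 0))" for y
  define V where "V j i = (if i = 0 then euler j A else A)" for j and i :: nat
  have wo: "wo ?S" using A by (simp add: carrier_iff)
  have sV: "mn_supp (V j i) \<subseteq> ?S" for j i
    using supp_euler by (auto simp: V_def)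
  have VC: "V j i \<in> carrier (mn_ring r)" for j i
    using sV wo by (rule carrierI)
  have fp: "finite {\<phi> \<in> PiE ?I (\<lambda>_. ?S). sum \<phi> ?I = s} \<and>
    mn_supp (\<Otimes>\<^bsub>mn_ring r\<^esub>i\<in>?I. V j i) \<subseteq> {sum \<phi> ?I | \<phi>. \<phi> \<in> PiE ?I (\<lambda>_. ?S)} \<and>
    (\<Otimes>\<^bsub>mn_ring r\<^esub>i\<in>?I. V j i) s = (\<Sum>\<phi>\<in>{\<phi> \<in> PiE ?I (\<lambda>_. ?S). sum \<phi> ?I = s}. \<Prod>i\<in>?I. V j i (\<phi> i))" for j
    by (rule finprod_eq) (use wo sV in auto)
  have finP: "finite P" unfolding P_def using fp by blast
  have I: "?I = insert 0 {1..n}" by auto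
  have pw: "(\<Otimes>\<^bsub>mn_ring r\<^esub>i\<in>?I. V j i) = A [^]\<^bsub>mn_ring r\<^esub> n \<otimes>\<^bsub>mn_ring r\<^esub> euler j A" for j
  proof -
    have "(\<Otimes>\<^bsub>mn_ring r\<^esub>i\<in>{1..n}. V j i) = (\<Otimes>\<^bsub>mn_ring r\<^esub>i\<in>{1..n}. A)"
      by (rule mn.finprod_cong') (use A in \<open>auto simp: V_def\<close>)
    also have "\<dots> = A [^]\<^bsub>mn_ring r\<^esub> n"
      using mn.finprod_const[OF A, of "{1..n}"] by simp
    finally show ?thesis
      unfolding I using VC A by (subst mn.finprod_insert) (auto simp: V_def[of _ 0] mult_comm)
  qed
  have tm: "(\<Prod>i\<in>?I. V j i (\<phi> i)) = c \<phi> * of_int (snd (\<phi> 0) $ j)" for j \<phi>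
  proof -
    have "(\<Prod>i\<in>{1..n}. V j i (\<phi> i)) = (\<Prod>i\<in>{1..n}. A (\<phi> i))"
      by (rule prod.cong) (auto simp: V_def)
    then show ?thesis
      unfolding c_def I by (simp add: V_def[of _ 0] euler_def)
  qed
  have swap: "(\<Sum>\<phi>\<in>L y. snd (\<phi> i)) = w y" if i: "i \<in> ?I" for y i
    unfolding w_def
  proof (rule sum.reindex_bij_witness[of _ "\<lambda>\<phi>. \<phi> \<circ> Transposition.transpose 0 i" "\<lambda>\<phi>. \<phi> \<circ> Transposition.transpose 0 i"])
    have perm: "Transposition.transpose 0 i permutes ?I"
      using i by (intro permutes_swap_id) auto
    have "\<phi> \<circ> Transposition.transpose 0 i \<in> L y" if "\<phi> \<in> L y" for \<phi>
    proof -
      have \<phi>: "\<phi> \<in> PiE ?I (\<lambda>_. ?S)" "sum \<phi> ?I = s" "c \<phi> = y"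
        using that by (auto simp: L_def P_def)
      have "\<phi> \<circ> Transposition.transpose 0 i \<in> PiE ?I (\<lambda>_. ?S)"
        using \<phi>(1) permutes_in_image[OF perm] permutes_not_in[OF perm]
        by (intro PiE_I) (auto dest: PiE_mem PiE_arb)
      moreover have "sum (\<phi> \<circ> Transposition.transpose 0 i) ?I = s"
        using \<phi>(2) sum.permute[OF perm, of \<phi>] by simp
      moreover have "c (\<phi> \<circ> Transposition.transpose 0 i) = y"
        using \<phi>(3) prod.permute[OF perm, of "\<lambda>i. A (\<phi> i)"] by (simp add: c_def comp_def)
      ultimately show ?thesis by (simp add: L_def P_def)
    qed
    then show "\<phi> \<circ> Transposition.transpose 0 i \<in> L y" "\<phi> \<circ> Transposition.transpose 0 i \<in> L y" if "\<phi> \<in> L y" for \<phi>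
      using that by blast+
  qed (auto simp: fun_eq_iff)
  have "\<exists>k. \<forall>j. w y $ j = k * prim_vec (snd s) $ j" for y
  proof (rule parallel_prim_vec)
    show "int (Suc n) \<noteq> 0" by simp
    fix j
    \<comment> \<open>Each of the n + 1 positions contributes the same vector \<open>w y\<close>,
      while for a fixed choice of exponents the degrees over all positions add up to
      \<open>snd s\<close>.\<close>
    have "(\<Sum>i\<in>?I. w y) = (\<Sum>i\<in>?I. \<Sum>\<phi>\<in>L y. snd (\<phi> i))"
      by (simp add: swap)
    also have "\<dots> = (\<Sum>\<phi>\<in>L y. \<Sum>i\<in>?I. snd (\<phi> i))"
      by (rule sum.swap)
    also have "\<dots> = (\<Sum>\<phi>\<in>L y. snd s)"
      by (rule sum.cong) (auto simp: L_def P_def snd_sum)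
    finally have "(\<Sum>i\<in>?I. w y $ j) = (\<Sum>\<phi>\<in>L y. snd s $ j)"
      by (simp only: sum_component[symmetric])
    then show "int (Suc n) * w y $ j = int (card (L y)) * snd s $ j" by simp
  qed
  then obtain k where k: "\<And>y j. w y $ j = k y * prim_vec (snd s) $ j" by metis
  have "(A [^]\<^bsub>mn_ring r\<^esub> n \<otimes>\<^bsub>mn_ring r\<^esub> euler j A) s = (\<Sum>y\<in>c ` P. y * of_int (k y)) * of_int (prim_vec (snd s) $ j)" for j
  proof -
    have "(A [^]\<^bsub>mn_ring r\<^esub> n \<otimes>\<^bsub>mn_ring r\<^esub> euler j A) s = (\<Sum>\<phi>\<in>P. c \<phi> * of_int (snd (\<phi> 0) $ j))"
      unfolding pw[symmetric] P_def using fp tm by auto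
    also have "\<dots> = (\<Sum>y\<in>c ` P. \<Sum>\<phi>\<in>L y. c \<phi> * of_int (snd (\<phi> 0) $ j))"
      unfolding L_def by (rule sum.group[symmetric]) (use finP in auto)
    also have "\<dots> = (\<Sum>y\<in>c ` P. y * of_int (w y $ j))"
      by (intro sum.cong refl) (simp add: w_def L_def sum_distrib_left)
    finally show ?thesis by (simp add: k sum_distrib_right mult.assoc)
  qed
  then show "\<exists>y. \<forall>j. (A [^]\<^bsub>mn_ring r\<^esub> n \<otimes>\<^bsub>mn_ring r\<^esub> euler j A) s = y * of_int (prim_vec (snd s) $ j)"
    by blast
qed

text \<open>Here \<open>Q\<close> is the limit of the geometric series, so the expression is dz / (1
  - z), the limit of sums of the parallel terms \<open>z^i dz\<close>.\<close>

lemma parallel_log: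
  fixes z :: "'g \<times> (int ^ 'n) \<Rightarrow> 'r::comm_ring_1"
  assumes S: "wo S" "\<And>s. s \<in> S \<Longrightarrow> 0 <\<^sub>r s" "mn_supp z \<subseteq> S"
    and Q: "mn_supp Q \<subseteq> gen S" "\<And>n. mn_supp (geo z n) \<subseteq> gen S" "\<And>m. eventually (\<lambda>n. geo z n m = Q m) sequentially"
  shows "parallel (\<lambda>j. euler j z \<otimes>\<^bsub>mn_ring r\<^esub> Q)"
proof (rule parallelI)
  fix s
  have z: "z \<in> carrier (mn_ring r)" by (rule carrierI[OF S(3,1)])
  have wg: "wo (gen S)" by (rule wo_gen[OF S(1,2)])
  \<comment> \<open>One \<open>n\<close> has to work for all \<open>j\<close> simultaneously,
    because the multiplier in \<open>parallel\<close> may depend on \<open>s\<close> but not on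
    \<open>j\<close>.\<close>
  have "eventually (\<lambda>n. \<forall>j\<in>UNIV. (euler j z \<otimes>\<^bsub>mn_ring r\<^esub> geo z n) s = (euler j z \<otimes>\<^bsub>mn_ring r\<^esub> Q) s) sequentially"
    by (intro eventually_ball_finite ballI finite
        eventually_mult[OF S(1) wg order_trans[OF supp_euler S(3)] Q(2,1,3)])
  then obtain n where n: "\<And>j. (euler j z \<otimes>\<^bsub>mn_ring r\<^esub> geo z n) s = (euler j z \<otimes>\<^bsub>mn_ring r\<^esub> Q) s"
    using eventually_happens by force
  have "parallel (\<lambda>j. euler j z \<otimes>\<^bsub>mn_ring r\<^esub> geo z n)"
  proof -
    have "euler j z \<otimes>\<^bsub>mn_ring r\<^esub> geo z n = (\<lambda>s. \<Sum>i<n. (z [^]\<^bsub>mn_ring r\<^esub> i \<otimes>\<^bsub>mn_ring r\<^esub> euler j z) s)" for j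
    proof -
      have "euler j z \<otimes>\<^bsub>mn_ring r\<^esub> geo z n = (\<Oplus>\<^bsub>mn_ring r\<^esub>i\<in>{..<n}. euler j z \<otimes>\<^bsub>mn_ring r\<^esub> z [^]\<^bsub>mn_ring r\<^esub> i)"
        unfolding geo_def using z by (intro mn.finsum_rdistr) auto
      then show ?thesis
        using z by (auto simp: fun_eq_iff finsum_apply mult_comm)
    qed
    then show ?thesis using parallel_sum[OF parallel_pow_euler[OF z]] by simp
  qed
  then show "\<exists>y. \<forall>j. (euler j z \<otimes>\<^bsub>mn_ring r\<^esub> Q) s = y * of_int (prim_vec (snd s) $ j)"
    unfolding n[symmetric] parallel_def by blast
qed

section \<open>Integer powers, and inversion of a series with an invertible leading term\<close>

lemma int_pow_eq:
  assumes "x \<in> carrier (mn_ring r)" "y \<in> carrier (mn_ring r)" "x \<otimes>\<^bsub>mn_ring r\<^esub> y = \<one>\<^bsub>mn_ring r\<^esub>"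
  shows "x [^]\<^bsub>mn_ring r\<^esub> (k::int) = (if k < 0 then y [^]\<^bsub>mn_ring r\<^esub> nat (- k) else x [^]\<^bsub>mn_ring r\<^esub> nat k)"
proof -
  have "x [^]\<^bsub>mn_ring r\<^esub> n \<otimes>\<^bsub>mn_ring r\<^esub> y [^]\<^bsub>mn_ring r\<^esub> n = \<one>\<^bsub>mn_ring r\<^esub>" for n :: nat
    using mn.nat_pow_distrib[OF assms(1,2), of n] assms(3) by simp
  then have "inv\<^bsub>mn_ring r\<^esub> (x [^]\<^bsub>mn_ring r\<^esub> n) = y [^]\<^bsub>mn_ring r\<^esub> n" for n :: nat
    using assms by (intro inv_unique) auto
  then show ?thesis by (subst int_pow_def2) (simp del: pow_nat)
qed

lemma int_pow_closed:
  assumes "x \<in> carrier (mn_ring r)" "y \<in> carrier (mn_ring r)" "x \<otimes>\<^bsub>mn_ring r\<^esub> y = \<one>\<^bsub>mn_ring r\<^esub>"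
  shows "x [^]\<^bsub>mn_ring r\<^esub> (k::int) \<in> carrier (mn_ring r)"
  unfolding int_pow_eq[OF assms] using assms(1,2) by (simp del: pow_nat)

text \<open>For positive k the expression is \<open>F^(k-1) dF\<close>. For negative k, the product
  rule applied to \<open>F * H = 1\<close> gives \<open>H * H * dF = -dH\<close>, and the expression
  becomes \<open>-H^(-k-1) dH\<close>. Both cases fall under
  \<open>parallel_pow_euler\<close>.\<close>

lemma parallel_int_pow:
  fixes F H :: "'g \<times> (int ^ 'n) \<Rightarrow> 'r::comm_ring_1"
  assumes F: "F \<in> carrier (mn_ring r)" and H: "H \<in> carrier (mn_ring r)"
    and FH: "F \<otimes>\<^bsub>mn_ring r\<^esub> H = \<one>\<^bsub>mn_ring r\<^esub>" and k: "k \<noteq> (0::int)"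
  shows "parallel (\<lambda>j. F [^]\<^bsub>mn_ring r\<^esub> k \<otimes>\<^bsub>mn_ring r\<^esub> (H \<otimes>\<^bsub>mn_ring r\<^esub> euler j F))"
proof (cases "k < 0")
  case False
  then obtain n where n: "nat k = Suc n" using k by (metis gr0_conv_Suc linorder_neqE_linordered_idom zero_less_nat_eq)
  have "F [^]\<^bsub>mn_ring r\<^esub> k \<otimes>\<^bsub>mn_ring r\<^esub> (H \<otimes>\<^bsub>mn_ring r\<^esub> euler j F) = F [^]\<^bsub>mn_ring r\<^esub> n \<otimes>\<^bsub>mn_ring r\<^esub> euler j F" for j
  proof -
    have "F [^]\<^bsub>mn_ring r\<^esub> k \<otimes>\<^bsub>mn_ring r\<^esub> (H \<otimes>\<^bsub>mn_ring r\<^esub> euler j F) =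
        F [^]\<^bsub>mn_ring r\<^esub> n \<otimes>\<^bsub>mn_ring r\<^esub> (F \<otimes>\<^bsub>mn_ring r\<^esub> H) \<otimes>\<^bsub>mn_ring r\<^esub> euler j F"
      using F H False n by (simp add: int_pow_eq[OF F H FH] mn.nat_pow_Suc mn.m_assoc)
    then show ?thesis using F FH by simp
  qed
  then show ?thesis using parallel_pow_euler[OF F] by simp
next
  case True
  then obtain n where n: "nat (- k) = Suc n" by (metis gr0_conv_Suc neg_0_less_iff_less zero_less_nat_eq)
  have euler: "euler j F \<otimes>\<^bsub>mn_ring r\<^esub> H \<oplus>\<^bsub>mn_ring r\<^esub> F \<otimes>\<^bsub>mn_ring r\<^esub> euler j H = \<zero>\<^bsub>mn_ring r\<^esub>" for j
    unfolding euler_mult[OF F H, symmetric] FH euler_one ..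
  have euH: "H \<otimes>\<^bsub>mn_ring r\<^esub> (H \<otimes>\<^bsub>mn_ring r\<^esub> euler j F) = \<ominus>\<^bsub>mn_ring r\<^esub> euler j H" for j
  proof -
    have "H \<otimes>\<^bsub>mn_ring r\<^esub> (H \<otimes>\<^bsub>mn_ring r\<^esub> euler j F) \<oplus>\<^bsub>mn_ring r\<^esub> euler j H =
      H \<otimes>\<^bsub>mn_ring r\<^esub> (euler j F \<otimes>\<^bsub>mn_ring r\<^esub> H) \<oplus>\<^bsub>mn_ring r\<^esub> (F \<otimes>\<^bsub>mn_ring r\<^esub> H) \<otimes>\<^bsub>mn_ring r\<^esub> euler j H"
      using F H by (simp add: FH mult_comm[of H "euler j F"])
    also have "\<dots> = H \<otimes>\<^bsub>mn_ring r\<^esub> (euler j F \<otimes>\<^bsub>mn_ring r\<^esub> H \<oplus>\<^bsub>mn_ring r\<^esub> F \<otimes>\<^bsub>mn_ring r\<^esub> euler j H)"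
      using F H by (simp add: mn.r_distr mn.m_assoc mn.m_lcomm mult_comm[of F H])
    also have "\<dots> = \<zero>\<^bsub>mn_ring r\<^esub>" using H euler by simp
    finally show ?thesis using F H by (intro mn.minus_equality[symmetric]) auto
  qed
  have "F [^]\<^bsub>mn_ring r\<^esub> k \<otimes>\<^bsub>mn_ring r\<^esub> (H \<otimes>\<^bsub>mn_ring r\<^esub> euler j F) =
      (\<lambda>s. - (H [^]\<^bsub>mn_ring r\<^esub> n \<otimes>\<^bsub>mn_ring r\<^esub> euler j H) s)" for j
  proof -
    have "F [^]\<^bsub>mn_ring r\<^esub> k \<otimes>\<^bsub>mn_ring r\<^esub> (H \<otimes>\<^bsub>mn_ring r\<^esub> euler j F) =
        H [^]\<^bsub>mn_ring r\<^esub> n \<otimes>\<^bsub>mn_ring r\<^esub> (H \<otimes>\<^bsub>mn_ring r\<^esub> (H \<otimes>\<^bsub>mn_ring r\<^esub> euler j F))"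
      using F H True n by (simp add: int_pow_eq[OF F H FH] mn.nat_pow_Suc mn.m_assoc)
    also have "\<dots> = \<ominus>\<^bsub>mn_ring r\<^esub> (H [^]\<^bsub>mn_ring r\<^esub> n \<otimes>\<^bsub>mn_ring r\<^esub> euler j H)"
      unfolding euH using H by (simp add: mn.r_minus)
    finally show ?thesis using H by (simp add: uminus_eq)
  qed
  then show ?thesis using parallel_uminus[OF parallel_pow_euler[OF H]] by simp
qed

text \<open>Factor F as (1 - z) times its leading monomial, where \<open>z\<close> has only positive
  exponents. The geometric series inverts the first factor, and \<open>u'\<close> with
  \<open>m'\<close> inverts the second. Logarithmic differentiation splits in the same way: the
  monomial gives the constant vector \<open>snd m\<close>, and the rest is -dz / (1 - z), which is
  parallel by \<open>parallel_log\<close>.\<close>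

lemma leading_term_inverse:
  fixes F :: "'g \<times> (int ^ 'n) \<Rightarrow> 'r::comm_ring_1"
  assumes F: "F \<in> carrier (mn_ring r)" and u: "F m * u' = 1" and m: "m + m' = 0"
    and least: "\<And>p. p \<in> mn_supp F \<Longrightarrow> m \<le>\<^sub>r p"
  obtains S H where "wo S" "\<And>s. s \<in> S \<Longrightarrow> 0 <\<^sub>r s"
    "mn_supp F \<subseteq> sumset {m} (gen S)" "mn_supp H \<subseteq> sumset {m'} (gen S)" "H \<in> carrier (mn_ring r)"
    "F \<otimes>\<^bsub>mn_ring r\<^esub> H = \<one>\<^bsub>mn_ring r\<^esub>"
    "parallel (\<lambda>j s. (H \<otimes>\<^bsub>mn_ring r\<^esub> euler j F) s - (if s = 0 then of_int (snd m $ j) else 0))"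
proof -
  \<comment> \<open>This solves F = (1 - z) * F(m) t^m for \<open>z\<close>. The value at 0 must be
    0 because \<open>F m * u' = 1\<close>.\<close>
  define z where "z s = (if s = 0 then 0 else - u' * F (m + s))" for s
  define S where "S = {s. s \<noteq> 0 \<and> m + s \<in> mn_supp F}"
  have mm: "m' + (m + x) = x" "m + (x + m') = x" for x
  proof -
    have "m' + (m + x) = (m + m') + x" "m + (x + m') = (m + m') + x"
      by (simp_all only: add_ac)
    then show "m' + (m + x) = x" "m + (x + m') = x"
      using m by simp_all
  qed
  have "S \<subseteq> (+) m' ` mn_supp F"
  proof
    fix s assume "s \<in> S"
    then show "s \<in> (+) m' ` mn_supp F"
      by (intro image_eqI[of _ _ "m + s"]) (auto simp: S_def mm)
  qed
  with wo_translate have S1: "wo S"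
    by (rule wo_subset) (use F in \<open>simp add: carrier_iff\<close>)
  have S2: "0 <\<^sub>r s" if "s \<in> S" for s
  proof -
    have "m + 0 \<le>\<^sub>r m + s" using that least by (simp add: S_def)
    then have "0 \<le>\<^sub>r s" by (simp only: add_le_iff)
    then show ?thesis using that by (auto simp: lt_le S_def)
  qed
  have S3: "mn_supp z \<subseteq> S" by (auto simp: mn_supp_def z_def S_def split: if_splits)
  have z: "z \<in> carrier (mn_ring r)" by (rule carrierI[OF S3 S1])
  obtain Q where Q: "mn_supp Q \<subseteq> gen S" "\<And>n. mn_supp (geo z n) \<subseteq> gen S"
    "\<And>m. eventually (\<lambda>n. geo z n m = Q m) sequentially"
    "(\<one>\<^bsub>mn_ring r\<^esub> \<ominus>\<^bsub>mn_ring r\<^esub> z) \<otimes>\<^bsub>mn_ring r\<^esub> Q = \<one>\<^bsub>mn_ring r\<^esub>"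
    using geo_limit[OF S1 S2 S3] by metis
  have wg: "wo (gen S)" by (rule wo_gen[OF S1 S2])
  have QC: "Q \<in> carrier (mn_ring r)" by (rule carrierI[OF Q(1) wg])
  let ?U = "\<one>\<^bsub>mn_ring r\<^esub> \<ominus>\<^bsub>mn_ring r\<^esub> z"
  let ?c = "monomial (F m) m" and ?c' = "monomial u' m'"
  have U: "?U \<in> carrier (mn_ring r)" using z by simp
  have FU: "F = ?U \<otimes>\<^bsub>mn_ring r\<^esub> ?c"
  proof
    fix x
    have "x + m' = 0 \<longleftrightarrow> x = m"
      using mm(2)[of x] m by (metis add.right_neutral)
    moreover have "F x = F m * (u' * F x)" using u by (simp add: mult.assoc[symmetric])
    ultimately show "F x = (?U \<otimes>\<^bsub>mn_ring r\<^esub> ?c) x"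
      using z by (auto simp: mult_monomial_apply[OF m] minus_apply one_apply z_def mm mult.commute)
  qed
  have cc: "?c \<otimes>\<^bsub>mn_ring r\<^esub> ?c' = \<one>\<^bsub>mn_ring r\<^esub>"
  proof
    fix x
    have "x + m = m \<longleftrightarrow> x = 0" using add_cancel_right[of x m 0] by simp
    then show "(?c \<otimes>\<^bsub>mn_ring r\<^esub> ?c') x = \<one>\<^bsub>mn_ring r\<^esub> x"
      using m u by (subst mult_monomial_apply[of _ m]) (auto simp: add.commute monomial_def one_apply)
  qed
  define H where "H = Q \<otimes>\<^bsub>mn_ring r\<^esub> ?c'"
  have HC: "H \<in> carrier (mn_ring r)" using QC by (simp add: H_def)
  have mul: "(X \<otimes>\<^bsub>mn_ring r\<^esub> Y) \<otimes>\<^bsub>mn_ring r\<^esub> (Z \<otimes>\<^bsub>mn_ring r\<^esub> W) = (X \<otimes>\<^bsub>mn_ring r\<^esub> Z) \<otimes>\<^bsub>mn_ring r\<^esub> (Y \<otimes>\<^bsub>mn_ring r\<^esub> W)"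
    if "X \<in> carrier (mn_ring r)" "Y \<in> carrier (mn_ring r)" "Z \<in> carrier (mn_ring r)" "W \<in> carrier (mn_ring r)"
    for X Y Z W :: "'g \<times> (int ^ 'n) \<Rightarrow> 'r"
    using that by (simp add: mn.m_assoc mn.m_lcomm)
  have FH: "F \<otimes>\<^bsub>mn_ring r\<^esub> H = \<one>\<^bsub>mn_ring r\<^esub>"
    unfolding H_def by (subst FU) (use U QC in \<open>simp add: mul Q(4) cc\<close>)
  have 0: "0 \<in> gen S" by (rule zero_in_gen)
  have "mn_supp ?U \<subseteq> gen S"
  proof
    fix x assume "x \<in> mn_supp ?U"
    then have "x = 0 \<or> x \<in> S"
      using S3 z by (auto simp: mn_supp_def minus_apply one_apply split: if_splits)
    then show "x \<in> gen S" using 0 gen_incl by blast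
  qed
  from supp_mult[OF supp_monomial this, of "F m" m] have sF: "mn_supp F \<subseteq> sumset {m} (gen S)"
    by (subst FU) (simp add: mult_comm)
  from supp_mult[OF supp_monomial Q(1), of u' m'] have sH: "mn_supp H \<subseteq> sumset {m'} (gen S)"
    by (simp add: H_def mult_comm)
  have euc: "euler j ?c = monomial (of_int (snd m $ j)) 0 \<otimes>\<^bsub>mn_ring r\<^esub> ?c" for j
  proof
    fix x
    have "x + m' = 0 \<longleftrightarrow> x = m"
      using mm(2)[of x] m by (metis add.right_neutral)
    then show "euler j ?c x = (monomial (of_int (snd m $ j)) 0 \<otimes>\<^bsub>mn_ring r\<^esub> ?c) x"
      by (simp only: mult_monomial_apply[OF m]) (auto simp: euler_def monomial_def)
  qed
  have euU: "euler j ?U = \<ominus>\<^bsub>mn_ring r\<^esub> euler j z" for j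
    unfolding euler_minus[OF mn.one_closed z] euler_one using z by (simp add: mn.minus_eq)
  have "(H \<otimes>\<^bsub>mn_ring r\<^esub> euler j F) s - (if s = 0 then of_int (snd m $ j) else 0) = - (euler j z \<otimes>\<^bsub>mn_ring r\<^esub> Q) s" for j s
  proof -
    let ?k = "monomial (of_int (snd m $ j)) 0 :: 'g \<times> (int ^ 'n) \<Rightarrow> 'r"
    have "euler j F = euler j (?U \<otimes>\<^bsub>mn_ring r\<^esub> ?c)" using FU by simp
    also have "\<dots> = (\<ominus>\<^bsub>mn_ring r\<^esub> euler j z) \<otimes>\<^bsub>mn_ring r\<^esub> ?c \<oplus>\<^bsub>mn_ring r\<^esub> ?U \<otimes>\<^bsub>mn_ring r\<^esub> (?k \<otimes>\<^bsub>mn_ring r\<^esub> ?c)"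
      using U by (simp only: euler_mult monomial_closed euc euU)
    also have "\<dots> = ((\<ominus>\<^bsub>mn_ring r\<^esub> euler j z) \<oplus>\<^bsub>mn_ring r\<^esub> ?U \<otimes>\<^bsub>mn_ring r\<^esub> ?k) \<otimes>\<^bsub>mn_ring r\<^esub> ?c"
      using U z by (simp add: mn.l_distr mn.m_assoc del: mn.minus_eq)
    finally have "H \<otimes>\<^bsub>mn_ring r\<^esub> euler j F = ((\<ominus>\<^bsub>mn_ring r\<^esub> euler j z) \<oplus>\<^bsub>mn_ring r\<^esub> ?U \<otimes>\<^bsub>mn_ring r\<^esub> ?k) \<otimes>\<^bsub>mn_ring r\<^esub> ?c \<otimes>\<^bsub>mn_ring r\<^esub> (Q \<otimes>\<^bsub>mn_ring r\<^esub> ?c')"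
      by (simp add: H_def mult_comm)
    also have "\<dots> = ((\<ominus>\<^bsub>mn_ring r\<^esub> euler j z) \<oplus>\<^bsub>mn_ring r\<^esub> ?U \<otimes>\<^bsub>mn_ring r\<^esub> ?k) \<otimes>\<^bsub>mn_ring r\<^esub> Q"
      using U z QC by (subst mul) (auto simp: cc)
    also have "\<dots> = (\<ominus>\<^bsub>mn_ring r\<^esub> euler j z) \<otimes>\<^bsub>mn_ring r\<^esub> Q \<oplus>\<^bsub>mn_ring r\<^esub> (?U \<otimes>\<^bsub>mn_ring r\<^esub> Q) \<otimes>\<^bsub>mn_ring r\<^esub> ?k"
    proof -
      have "?U \<otimes>\<^bsub>mn_ring r\<^esub> ?k \<otimes>\<^bsub>mn_ring r\<^esub> Q = (?U \<otimes>\<^bsub>mn_ring r\<^esub> Q) \<otimes>\<^bsub>mn_ring r\<^esub> ?k"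
        using U QC by (simp add: mn.m_assoc mult_comm[of ?k])
      then show ?thesis using U z QC by (simp add: mn.l_distr)
    qed
    also have "\<dots> = \<ominus>\<^bsub>mn_ring r\<^esub> (euler j z \<otimes>\<^bsub>mn_ring r\<^esub> Q) \<oplus>\<^bsub>mn_ring r\<^esub> ?k"
      using z QC by (simp add: Q(4) mn.l_minus)
    finally show ?thesis
      using z QC by (simp add: uminus_eq monomial_def)
  qed
  then have "parallel (\<lambda>j s. (H \<otimes>\<^bsub>mn_ring r\<^esub> euler j F) s - (if s = 0 then of_int (snd m $ j) else 0))"
    using parallel_uminus[OF parallel_log[OF S1 S2 S3 Q(1,2,3)]] by simp
  then show ?thesis
    using that[OF S1 S2 sF sH HC FH] by blast
qed

end

section \<open>Constant terms of determinants\<close>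

lemma det_of_int: "det (\<chi> i j. (of_int (M $ i $ j) :: 'r::comm_ring_1)) = of_int (det M)"
  by (simp add: det_def)

lemma prim_vec_zero [simp]: "prim_vec 0 = 0"
  by (simp add: prim_vec_def vec_eq_iff)

text \<open>Scaling row \<open>i\<close> by the gcd of \<open>d i\<close> turns it into
  \<open>d i\<close>, so these gcds are the coefficients of a linear relation between the rows in
  \<open>C\<close>. The relation is trivial only if all these \<open>d i\<close> vanish, and then
  \<open>B\<close> has a zero row. The relation is used over the reals, and injectivity of
  \<open>of_int\<close> brings the result back.\<close>

lemma det_prim_vec_eq_0:
  fixes B :: "int ^ 'n ^ 'n::finite" and d :: "'n \<Rightarrow> int ^ 'n"
  assumes C: "C \<noteq> {}" and d: "(\<Sum>i\<in>C. d i) = 0" and B: "\<And>i. i \<in> C \<Longrightarrow> B $ i = prim_vec (d i)"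
  shows "det B = 0"
proof -
  define g where "g i = Gcd (range (\<lambda>j. d i $ j))" for i
  have gd: "g i * prim_vec (d i) $ j = d i $ j" for i j
    unfolding g_def by (rule Gcd_prim_vec)
  define x :: "real ^ 'n" where "x = (\<chi> i. if i \<in> C then of_int (g i) else 0)"
  define A :: "real ^ 'n ^ 'n" where "A = (\<chi> i j. of_int (B $ i $ j))"
  show ?thesis
  proof (cases "\<forall>i\<in>C. g i = 0")
    case True
    obtain i where "i \<in> C" using C by auto
    then have "d i = 0" using True gd[of i] by (simp add: vec_eq_iff)
    then have "B $ i = 0" using B[OF \<open>i \<in> C\<close>] by simp
    then have "row i B = 0" by (simp add: row_def vec_eq_iff)
    then show ?thesis by (rule det_zero_row)
  next
    case False
    then have "x \<noteq> 0" by (auto simp: x_def vec_eq_iff)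
    moreover have "transpose A *v x = 0"
    proof -
      have "(\<Sum>i\<in>UNIV. A $ i $ j * x $ i) = 0" for j
      proof -
        have "(\<Sum>i\<in>UNIV. A $ i $ j * x $ i) = (\<Sum>i\<in>C. A $ i $ j * x $ i)"
          by (rule sum.mono_neutral_right) (auto simp: x_def)
        also have "\<dots> = (\<Sum>i\<in>C. of_int (d i $ j))"
          by (rule sum.cong) (auto simp: A_def x_def B gd[symmetric])
        also have "\<dots> = of_int ((\<Sum>i\<in>C. d i) $ j)" by simp
        finally show ?thesis by (simp add: d)
      qed
      then show ?thesis by (simp add: vec_eq_iff matrix_vector_mult_def transpose_def)
    qed
    ultimately have "det (transpose A) = 0"
      using invertible_det_nz[of "transpose A"] invertible_left_inverse[of "transpose A"]
        matrix_left_invertible_ker[of "transpose A"] by blast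
    then have "of_int (det B) = (0 :: real)"
      by (simp add: A_def det_of_int)
    then show ?thesis by simp
  qed
qed

context to_monoid_x
begin

lemma wo_UN: "finite I \<Longrightarrow> (\<And>i. i \<in> I \<Longrightarrow> wo (A i)) \<Longrightarrow> wo (\<Union>i\<in>I. A i)"
  by (induction I rule: finite_induct) (auto intro: wo_Un)

text \<open>The determinant is multilinear in its rows. Since \<open>A i\<close> bounds the supports
  of the whole row \<open>i\<close>, the choices of exponents do not depend on the permutation, and
  the signed sum moves inside.\<close>

lemma ring_det_apply:
  fixes M :: "'n \<Rightarrow> 'n \<Rightarrow> 'g \<times> (int ^ 'n) \<Rightarrow> 'r::comm_ring_1"
  assumes A: "\<And>i. wo (A i)" "\<And>i j. mn_supp (M i j) \<subseteq> A i"
  shows "finite {\<phi> \<in> PiE UNIV A. sum \<phi> UNIV = s}"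
    and "ring_det (mn_ring r) M s = (\<Sum>\<phi>\<in>{\<phi> \<in> PiE UNIV A. sum \<phi> UNIV = s}. det (\<chi> i j. M i j (\<phi> i)))"
proof -
  have M: "M i j \<in> carrier (mn_ring r)" for i j
    by (rule carrierI[OF A(2,1)])
  have fp: "finite {\<phi> \<in> PiE UNIV A. sum \<phi> UNIV = s} \<and>
    mn_supp (\<Otimes>\<^bsub>mn_ring r\<^esub>i\<in>UNIV. M i (p i)) \<subseteq> {sum \<phi> UNIV | \<phi>. \<phi> \<in> PiE UNIV A} \<and>
    (\<Otimes>\<^bsub>mn_ring r\<^esub>i\<in>UNIV. M i (p i)) s =
      (\<Sum>\<phi>\<in>{\<phi> \<in> PiE UNIV A. sum \<phi> UNIV = s}. \<Prod>i\<in>UNIV. M i (p i) (\<phi> i))" for p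
    by (rule finprod_eq) (use A in auto)
  show "finite {\<phi> \<in> PiE UNIV A. sum \<phi> UNIV = s}" using fp by blast
  have fC: "(\<Otimes>\<^bsub>mn_ring r\<^esub>i\<in>UNIV. M i (p i)) \<in> carrier (mn_ring r)" for p
    using M by (intro mn.finprod_closed) auto
  have "ring_det (mn_ring r) M s =
      (\<Sum>p | p permutes UNIV. of_int (sign p) * (\<Otimes>\<^bsub>mn_ring r\<^esub>i\<in>UNIV. M i (p i)) s)"
    unfolding ring_det_def
    by (subst finsum_apply) (auto simp: fC add_pow_apply finite_permutations intro!: mn.add.int_pow_closed)
  also have "\<dots> = (\<Sum>p | p permutes UNIV. \<Sum>\<phi>\<in>{\<phi> \<in> PiE UNIV A. sum \<phi> UNIV = s}.
      of_int (sign p) * (\<Prod>i\<in>UNIV. M i (p i) (\<phi> i)))"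
    using fp by (simp add: sum_distrib_left)
  also have "\<dots> = (\<Sum>\<phi>\<in>{\<phi> \<in> PiE UNIV A. sum \<phi> UNIV = s}. det (\<chi> i j. M i j (\<phi> i)))"
    unfolding det_def by (subst sum.swap) simp
  finally show "ring_det (mn_ring r) M s = (\<Sum>\<phi>\<in>{\<phi> \<in> PiE UNIV A. sum \<phi> UNIV = s}. det (\<chi> i j. M i j (\<phi> i)))" .
qed

lemma CT_ring_det:
  fixes V :: "'n \<Rightarrow> 'n \<Rightarrow> 'g \<times> (int ^ 'n) \<Rightarrow> 'r::comm_ring_1"
  assumes V: "\<And>i j. V i j \<in> carrier (mn_ring r)"
    and parallel1: "\<And>i. i \<in> K \<Longrightarrow> parallel (V i)"
    and parallel0: "\<And>i. i \<notin> K \<Longrightarrow> parallel (\<lambda>j s. V i j s - (if s = 0 then of_int (b $ i $ j) else 0))"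
  shows "ring_det (mn_ring r) V (g, 0) = (if K = {} \<and> g = 0 then of_int (det b) else 0)"
proof -
  \<comment> \<open>Inserting 0 guarantees that the all-zero choice, the only one that can
    contribute, occurs in the index set when \<open>g = 0\<close>.\<close>
  define A where "A i = insert 0 (\<Union>j\<in>UNIV. mn_supp (V i j))" for i
  have A: "wo (A i)" for i
  proof -
    have "wo ({0} \<union> (\<Union>j\<in>UNIV. mn_supp (V i j)))"
      using V by (intro wo_Un wo_singleton wo_UN finite) (simp add: carrier_iff)
    then show ?thesis by (simp add: A_def)
  qed
  have sA: "mn_supp (V i j) \<subseteq> A i" for i j by (auto simp: A_def)
  let ?\<Phi> = "{\<phi> \<in> PiE UNIV A. sum \<phi> UNIV = (g, 0)}"
  have det: "det (\<chi> i j. V i j (\<phi> i)) = (if K = {} \<and> \<phi> = (\<lambda>i. 0) then of_int (det b) else 0)"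
    if \<phi>: "\<phi> \<in> ?\<Phi>" for \<phi>
  proof -
    \<comment> \<open>These are the rows that are parallel at the chosen exponents: those in
      \<open>K\<close>, and those outside \<open>K\<close> whose exponent avoids the constant
      correction at 0.\<close>
    define C where "C = {i. i \<in> K \<or> \<phi> i \<noteq> 0}"
    have "\<exists>y. \<forall>j. V i j (\<phi> i) = y * of_int (prim_vec (snd (\<phi> i)) $ j)" if "i \<in> C" for i
    proof (cases "i \<in> K")
      case True
      then show ?thesis using parallel1 unfolding parallel_def by blast
    next
      case False
      then have "\<phi> i \<noteq> 0" using that by (auto simp: C_def)
      moreover obtain y where "\<forall>j. V i j (\<phi> i) - (if \<phi> i = 0 then of_int (b $ i $ j) else 0)
          = y * of_int (prim_vec (snd (\<phi> i)) $ j)"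
        using parallel0[OF False] unfolding parallel_def by blast
      ultimately show ?thesis by auto
    qed
    then obtain y where y: "\<And>i j. i \<in> C \<Longrightarrow> V i j (\<phi> i) = y i * of_int (prim_vec (snd (\<phi> i)) $ j)"
      by metis
    \<comment> \<open>At exponent 0 the primitive vector is zero, so the corrected row vanishes and
      the row itself is exactly \<open>b $ i\<close>.\<close>
    have nC: "V i j (\<phi> i) = of_int (b $ i $ j)" if "i \<notin> C" for i j
    proof -
      have i: "\<phi> i = 0" "i \<notin> K" using that by (auto simp: C_def)
      obtain y where "\<forall>j. V i j 0 - (if (0 :: 'g \<times> (int ^ 'n)) = 0 then of_int (b $ i $ j) else 0)
          = y * of_int (prim_vec (snd (0 :: 'g \<times> (int ^ 'n))) $ j)"
        using parallel0[OF i(2)] unfolding parallel_def by blast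
      then show ?thesis using i by simp
    qed
    \<comment> \<open>Once the scalars \<open>y i\<close> are pulled out of the rows in
      \<open>C\<close>, an integer matrix remains, whose determinant can be examined before it is
      mapped into the ring.\<close>
    define B where "B = (\<chi> i. if i \<in> C then prim_vec (snd (\<phi> i)) else b $ i)"
    define c where "c i = (if i \<in> C then y i else 1)" for i
    have "(\<chi> i j. V i j (\<phi> i)) = (\<chi> i. c i *s ((\<chi> i j. of_int (B $ i $ j)) :: 'r ^ 'n ^ 'n) $ i)"
      by (auto simp: vec_eq_iff c_def B_def y nC)
    then have det: "det (\<chi> i j. V i j (\<phi> i)) = prod c UNIV * of_int (det B)"
      by (simp add: det_rows_mul det_of_int)
    show ?thesis
    proof (cases "C = {}")
      case True
      then have "K = {}" "\<phi> = (\<lambda>i. 0)" "B = b" "prod c UNIV = 1"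
        by (auto simp: C_def B_def c_def vec_eq_iff)
      then show ?thesis using det by simp
    next
      case False
      \<comment> \<open>Rows outside \<open>C\<close> have exponent 0, so the degrees over
        \<open>C\<close> already add up to the total x-degree 0.\<close>
      have "(\<Sum>i\<in>C. snd (\<phi> i)) = (\<Sum>i\<in>UNIV. snd (\<phi> i))"
        by (rule sum.mono_neutral_left) (auto simp: C_def)
      also have "\<dots> = 0" using \<phi> by (simp flip: snd_sum)
      finally have "det B = 0"
        by (rule det_prim_vec_eq_0[OF False]) (simp add: B_def)
      moreover have "\<not> (K = {} \<and> \<phi> = (\<lambda>i. 0))" using False by (auto simp: C_def)
      ultimately show ?thesis using det by auto
    qed
  qed
  have fin: "finite ?\<Phi>" by (rule ring_det_apply(1)[OF A sA])
  have "ring_det (mn_ring r) V (g, 0) = (\<Sum>\<phi>\<in>?\<Phi>. if K = {} \<and> \<phi> = (\<lambda>i. 0) then of_int (det b) else 0)"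
    unfolding ring_det_apply(2)[OF A sA] by (rule sum.cong) (use det in auto)
  also have "\<dots> = (if K = {} \<and> (\<lambda>i. 0) \<in> ?\<Phi> then of_int (det b) else 0)"
  proof (cases "K = {}")
    case True
    then show ?thesis using sum.delta[OF fin, of "\<lambda>i. 0" "\<lambda>_. of_int (det b)"] by simp
  qed simp
  also have "(\<lambda>i. 0) \<in> ?\<Phi> \<longleftrightarrow> (0 :: 'g \<times> (int ^ 'n)) = (g, 0)"
    by (auto simp: A_def)
  also have "\<dots> \<longleftrightarrow> g = 0"
    by (auto simp: zero_prod_def)
  finally show ?thesis .
qed

lemma ring_det_distrib:
  fixes M :: "'n \<Rightarrow> 'n \<Rightarrow> 'g \<times> (int ^ 'n) \<Rightarrow> 'r::comm_ring_1"
  assumes c: "\<And>i. c i \<in> carrier (mn_ring r)" and M: "\<And>i j. M i j \<in> carrier (mn_ring r)"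
  shows "(\<Otimes>\<^bsub>mn_ring r\<^esub>i\<in>UNIV. c i) \<otimes>\<^bsub>mn_ring r\<^esub> ring_det (mn_ring r) M
    = ring_det (mn_ring r) (\<lambda>i j. c i \<otimes>\<^bsub>mn_ring r\<^esub> M i j)"
proof -
  let ?c = "\<Otimes>\<^bsub>mn_ring r\<^esub>i\<in>UNIV. c i"
  have C: "?c \<in> carrier (mn_ring r)" using c by (intro mn.finprod_closed) auto
  have P: "(\<Otimes>\<^bsub>mn_ring r\<^esub>i\<in>UNIV. M i (p i)) \<in> carrier (mn_ring r)" for p
    using M by (intro mn.finprod_closed) auto
  have "?c \<otimes>\<^bsub>mn_ring r\<^esub> ring_det (mn_ring r) M =
      (\<Oplus>\<^bsub>mn_ring r\<^esub>p\<in>{p. p permutes UNIV}. ?c \<otimes>\<^bsub>mn_ring r\<^esub> ([sign p] \<cdot>\<^bsub>mn_ring r\<^esub> (\<Otimes>\<^bsub>mn_ring r\<^esub>i\<in>UNIV. M i (p i))))"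
    unfolding ring_det_def using C P
    by (intro mn.finsum_rdistr) (auto simp: finite_permutations intro!: mn.add.int_pow_closed)
  also have "\<dots> = ring_det (mn_ring r) (\<lambda>i j. c i \<otimes>\<^bsub>mn_ring r\<^esub> M i j)"
    unfolding ring_det_def
  proof (rule mn.finsum_cong')
    fix p
    have "?c \<otimes>\<^bsub>mn_ring r\<^esub> (\<Otimes>\<^bsub>mn_ring r\<^esub>i\<in>UNIV. M i (p i)) = (\<Otimes>\<^bsub>mn_ring r\<^esub>i\<in>UNIV. c i \<otimes>\<^bsub>mn_ring r\<^esub> M i (p i))"
      using c M by (intro mn.finprod_multf[symmetric]) auto
    then show "?c \<otimes>\<^bsub>mn_ring r\<^esub> ([sign p] \<cdot>\<^bsub>mn_ring r\<^esub> (\<Otimes>\<^bsub>mn_ring r\<^esub>i\<in>UNIV. M i (p i))) =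
        [sign p] \<cdot>\<^bsub>mn_ring r\<^esub> (\<Otimes>\<^bsub>mn_ring r\<^esub>i\<in>UNIV. c i \<otimes>\<^bsub>mn_ring r\<^esub> M i (p i))"
      using mn.add_pow_rdistr_int[OF C P] by simp
  qed (use c M in \<open>auto intro!: mn.add.int_pow_closed mn.finprod_closed\<close>)
  finally show ?thesis .
qed

section \<open>The logarithmic Jacobian and its products with monomials in the F_i\<close>

lemma mn_deriv_eq: "mn_deriv j \<eta> = mn_t (0, - axis j 1) \<otimes>\<^bsub>mn_ring r\<^esub> euler j \<eta>"
proof
  fix x :: "'g \<times> (int ^ 'n)"
  have "(0, - axis j 1) + (0, axis j 1) = (0 :: 'g \<times> (int ^ 'n))"
    by (simp add: zero_prod_def)
  from mult_monomial_apply[OF this, of "euler j \<eta>" 1 x]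
  show "mn_deriv j \<eta> x = (mn_t (0, - axis j 1) \<otimes>\<^bsub>mn_ring r\<^esub> euler j \<eta>) x"
    by (cases x) (simp add: mn_t_eq_monomial mult_comm mn_deriv_def euler_def axis_def)
qed

text \<open>The factors \<open>mn_X i\<close> and \<open>H i\<close> are distributed over the rows,
  whereas the inverse variables coming from the derivatives belong to the columns. They do not
  cancel entry by entry, but every permutation uses each column once, so they cancel in each term of
  the determinant.\<close>

lemma log_jacobian_eq:
  fixes F H :: "'n \<Rightarrow> 'g \<times> (int ^ 'n) \<Rightarrow> 'r::comm_ring_1"
  assumes F: "\<And>i. F i \<in> carrier (mn_ring r)" and H: "\<And>i. H i \<in> carrier (mn_ring r)"
    and FH: "\<And>i. F i \<otimes>\<^bsub>mn_ring r\<^esub> H i = \<one>\<^bsub>mn_ring r\<^esub>"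
  shows "log_jacobian r F = ring_det (mn_ring r) (\<lambda>i j. H i \<otimes>\<^bsub>mn_ring r\<^esub> euler j (F i))"
proof -
  let ?X = "\<Otimes>\<^bsub>mn_ring r\<^esub>i\<in>UNIV. (mn_X i :: 'g \<times> (int ^ 'n) \<Rightarrow> 'r)"
  let ?F = "\<Otimes>\<^bsub>mn_ring r\<^esub>i\<in>UNIV. F i" and ?H = "\<Otimes>\<^bsub>mn_ring r\<^esub>i\<in>UNIV. H i"
  let ?T = "\<lambda>j. mn_t (0, - axis j 1) :: 'g \<times> (int ^ 'n) \<Rightarrow> 'r"
  have XC: "(mn_X i :: 'g \<times> (int ^ 'n) \<Rightarrow> 'r) \<in> carrier (mn_ring r)" for i by (simp add: mn_X_def)
  have HC: "?H \<in> carrier (mn_ring r)" using H by (intro mn.finprod_closed) auto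
  have FC: "?F \<in> carrier (mn_ring r)" using F by (intro mn.finprod_closed) auto
  have "?F \<otimes>\<^bsub>mn_ring r\<^esub> ?H = \<one>\<^bsub>mn_ring r\<^esub>"
    using F H mn.finprod_multf[of F UNIV H] by (simp add: FH)
  then have inv: "inv\<^bsub>mn_ring r\<^esub> ?F = ?H" by (rule inv_unique(1)[OF FC HC])
  have XT: "?X \<otimes>\<^bsub>mn_ring r\<^esub> (\<Otimes>\<^bsub>mn_ring r\<^esub>i\<in>UNIV. ?T (p i)) = \<one>\<^bsub>mn_ring r\<^esub>" if p: "p permutes UNIV" for p
  proof -
    have "(\<Sum>i\<in>UNIV. (0 :: 'g, - axis (p i) 1 :: int ^ 'n)) = (\<Sum>i\<in>UNIV. (0, - axis i 1))"
      using sum.permute[OF p, of "\<lambda>i. (0 :: 'g, - axis i 1 :: int ^ 'n)"] by (simp add: comp_def)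
    moreover have "(\<Sum>i\<in>UNIV. (0 :: 'g, axis i 1 :: int ^ 'n)) + (\<Sum>i\<in>UNIV. (0, - axis i 1)) = 0"
      unfolding sum.distrib[symmetric] by (simp add: zero_prod_def[symmetric])
    ultimately show ?thesis
      by (simp add: mn_X_def finprod_t t_mult t_zero)
  qed
  have EC: "euler j (F i) \<in> carrier (mn_ring r)" for i j using F by simp
  have "(?X \<otimes>\<^bsub>mn_ring r\<^esub> ?H) \<otimes>\<^bsub>mn_ring r\<^esub> ring_det (mn_ring r) (\<lambda>i j. mn_deriv j (F i)) =
     (\<Otimes>\<^bsub>mn_ring r\<^esub>i\<in>UNIV. mn_X i \<otimes>\<^bsub>mn_ring r\<^esub> H i) \<otimes>\<^bsub>mn_ring r\<^esub> ring_det (mn_ring r) (\<lambda>i j. mn_deriv j (F i))"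
    using XC H by (subst mn.finprod_multf) auto
  also have "\<dots> = ring_det (mn_ring r) (\<lambda>i j. (mn_X i \<otimes>\<^bsub>mn_ring r\<^esub> H i) \<otimes>\<^bsub>mn_ring r\<^esub> (?T j \<otimes>\<^bsub>mn_ring r\<^esub> euler j (F i)))"
    unfolding mn_deriv_eq using XC H EC by (intro ring_det_distrib) auto
  also have "\<dots> = ring_det (mn_ring r) (\<lambda>i j. H i \<otimes>\<^bsub>mn_ring r\<^esub> euler j (F i))"
    unfolding ring_det_def
  proof (rule mn.finsum_cong')
    fix p assume "p \<in> {p :: 'n \<Rightarrow> 'n. p permutes UNIV}"
    then have p: "p permutes UNIV" by simp
    have HE: "(\<Otimes>\<^bsub>mn_ring r\<^esub>i\<in>UNIV. H i \<otimes>\<^bsub>mn_ring r\<^esub> euler (p i) (F i)) \<in> carrier (mn_ring r)"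
      using H EC by (intro mn.finprod_closed) auto
    have "(\<Otimes>\<^bsub>mn_ring r\<^esub>i\<in>UNIV. (mn_X i \<otimes>\<^bsub>mn_ring r\<^esub> H i) \<otimes>\<^bsub>mn_ring r\<^esub> (?T (p i) \<otimes>\<^bsub>mn_ring r\<^esub> euler (p i) (F i))) =
       (\<Otimes>\<^bsub>mn_ring r\<^esub>i\<in>UNIV. (mn_X i \<otimes>\<^bsub>mn_ring r\<^esub> ?T (p i)) \<otimes>\<^bsub>mn_ring r\<^esub> (H i \<otimes>\<^bsub>mn_ring r\<^esub> euler (p i) (F i)))"
      using XC H EC by (intro mn.finprod_cong') (auto simp: mn.m_assoc mn.m_lcomm)
    also have "\<dots> = (?X \<otimes>\<^bsub>mn_ring r\<^esub> (\<Otimes>\<^bsub>mn_ring r\<^esub>i\<in>UNIV. ?T (p i))) \<otimes>\<^bsub>mn_ring r\<^esub>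
        (\<Otimes>\<^bsub>mn_ring r\<^esub>i\<in>UNIV. H i \<otimes>\<^bsub>mn_ring r\<^esub> euler (p i) (F i))"
      using XC H EC by (subst mn.finprod_multf, auto)+
    finally show "[sign p] \<cdot>\<^bsub>mn_ring r\<^esub> (\<Otimes>\<^bsub>mn_ring r\<^esub>i\<in>UNIV. (mn_X i \<otimes>\<^bsub>mn_ring r\<^esub> H i) \<otimes>\<^bsub>mn_ring r\<^esub> (?T (p i) \<otimes>\<^bsub>mn_ring r\<^esub> euler (p i) (F i))) =
       [sign p] \<cdot>\<^bsub>mn_ring r\<^esub> (\<Otimes>\<^bsub>mn_ring r\<^esub>i\<in>UNIV. H i \<otimes>\<^bsub>mn_ring r\<^esub> euler (p i) (F i))"
      using XT[OF p] HE by simp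
  qed (use H EC in \<open>auto intro!: mn.add.int_pow_closed mn.finprod_closed\<close>)
  finally show ?thesis
    unfolding log_jacobian_def inv .
qed

text \<open>Row \<open>i\<close> absorbs the power of \<open>F i\<close>. This makes the row
  parallel if \<open>k $ i\<close> is nonzero and leaves the logarithmic differential unchanged
  otherwise, so \<open>CT_ring_det\<close> applies with \<open>K\<close> the support of
  \<open>k\<close>.\<close>

lemma CT_monomial:
  fixes F H :: "'n \<Rightarrow> 'g \<times> (int ^ 'n) \<Rightarrow> 'r::comm_ring_1"
  assumes F: "\<And>i. F i \<in> carrier (mn_ring r)" and H: "\<And>i. H i \<in> carrier (mn_ring r)"
    and FH: "\<And>i. F i \<otimes>\<^bsub>mn_ring r\<^esub> H i = \<one>\<^bsub>mn_ring r\<^esub>"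
    and parallel: "\<And>i. parallel (\<lambda>j s. (H i \<otimes>\<^bsub>mn_ring r\<^esub> euler j (F i)) s - (if s = 0 then of_int (b $ i $ j) else 0))"
  shows "(mpow (mn_ring r) F k \<otimes>\<^bsub>mn_ring r\<^esub> log_jacobian r F) (g, 0)
    = (if k = 0 \<and> g = 0 then of_int (det b) else 0)"
proof -
  have P: "F i [^]\<^bsub>mn_ring r\<^esub> (k $ i) \<in> carrier (mn_ring r)" for i
    by (rule int_pow_closed[OF F H FH])
  have HE: "H i \<otimes>\<^bsub>mn_ring r\<^esub> euler j (F i) \<in> carrier (mn_ring r)" for i j using F H by simp
  have "mpow (mn_ring r) F k \<otimes>\<^bsub>mn_ring r\<^esub> log_jacobian r F =
    ring_det (mn_ring r) (\<lambda>i j. F i [^]\<^bsub>mn_ring r\<^esub> (k $ i) \<otimes>\<^bsub>mn_ring r\<^esub> (H i \<otimes>\<^bsub>mn_ring r\<^esub> euler j (F i)))"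
    unfolding log_jacobian_eq[OF F H FH] mpow_def by (rule ring_det_distrib[OF P HE])
  moreover have "ring_det (mn_ring r) (\<lambda>i j. F i [^]\<^bsub>mn_ring r\<^esub> (k $ i) \<otimes>\<^bsub>mn_ring r\<^esub> (H i \<otimes>\<^bsub>mn_ring r\<^esub> euler j (F i))) (g, 0)
    = (if {i. k $ i \<noteq> 0} = {} \<and> g = 0 then of_int (det b) else 0)"
  proof (rule CT_ring_det)
    fix i j
    show "F i [^]\<^bsub>mn_ring r\<^esub> (k $ i) \<otimes>\<^bsub>mn_ring r\<^esub> (H i \<otimes>\<^bsub>mn_ring r\<^esub> euler j (F i)) \<in> carrier (mn_ring r)"
      using P HE by simp
  next
    fix i assume "i \<in> {i. k $ i \<noteq> 0}"
    then show "parallel (\<lambda>j. F i [^]\<^bsub>mn_ring r\<^esub> (k $ i) \<otimes>\<^bsub>mn_ring r\<^esub> (H i \<otimes>\<^bsub>mn_ring r\<^esub> euler j (F i)))"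
      by (intro parallel_int_pow[OF F H FH]) simp
  next
    fix i assume "i \<notin> {i. k $ i \<noteq> 0}"
    then have "k $ i = 0" by simp
    then have "F i [^]\<^bsub>mn_ring r\<^esub> (k $ i) = \<one>\<^bsub>mn_ring r\<^esub>"
      by (simp add: int_pow_eq[OF F H FH])
    then show "parallel (\<lambda>j s. (F i [^]\<^bsub>mn_ring r\<^esub> (k $ i) \<otimes>\<^bsub>mn_ring r\<^esub> (H i \<otimes>\<^bsub>mn_ring r\<^esub> euler j (F i))) s -
        (if s = 0 then of_int (b $ i $ j) else 0))"
      using parallel HE by simp
  qed
  ultimately show ?thesis by (simp add: vec_eq_iff)
qed

end

section \<open>Initial terms and substitution\<close>

context to_monoid
begin

lemma wo_translateD:
  assumes "wo ((+) z ` A)"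
  shows "wo A"
  unfolding wo_def
proof (intro allI impI)
  fix T assume T: "T \<subseteq> A" "T \<noteq> {}"
  then have "(+) z ` T \<subseteq> (+) z ` A" "(+) z ` T \<noteq> {}" by auto
  then obtain y where "y \<in> (+) z ` T" "\<forall>x\<in>(+) z ` T. y \<le>\<^sub>r x"
    using assms unfolding wo_def by meson
  then obtain x where "x \<in> T" "\<forall>y\<in>T. x \<le>\<^sub>r y" by auto
  then show "\<exists>x\<in>T. \<forall>y\<in>T. x \<le>\<^sub>r y" by blast
qed

lemma mn_ord_eqI: "m \<in> mn_supp \<eta> \<Longrightarrow> (\<And>p. p \<in> mn_supp \<eta> \<Longrightarrow> m \<le>\<^sub>r p) \<Longrightarrow> mn_ord r \<eta> = m"
  unfolding mn_ord_def by (rule the_equality) (auto simp: le_def[symmetric] intro: le_antisym)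

text \<open>In \<open>a\<close> times its inverse, the coefficient at the sum of both orders is the
  product of the leading coefficients. It is nonzero because the one of \<open>a\<close> is
  invertible, so this sum must be the only exponent of the unit series, namely 0.\<close>

lemma Units_order_invertible:
  fixes a :: "'m \<Rightarrow> 'r::comm_ring_1"
  assumes a: "a \<in> Units (mn_ring r)" and u: "a (mn_ord r a) dvd 1"
  shows "\<exists>g'. mn_ord r a + g' = 0"
proof -
  obtain c where aC: "a \<in> carrier (mn_ring r)" and cC: "c \<in> carrier (mn_ring r)"
    and inv: "a \<otimes>\<^bsub>mn_ring r\<^esub> c = \<one>\<^bsub>mn_ring r\<^esub>"
    using a by (auto simp: Units_def)
  have c0: "c \<noteq> (\<lambda>m. 0)"
  proof
    assume "c = (\<lambda>m. 0)"
    then have "\<one>\<^bsub>mn_ring r\<^esub> 0 = (0 :: 'r)" unfolding inv[symmetric] by (simp add: mn_ring_def)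
    then show False by (simp add: one_apply)
  qed
  have a0: "a \<noteq> (\<lambda>m. 0)"
  proof
    assume "a = (\<lambda>m. 0)"
    then show False using u by simp
  qed
  let ?p = "mn_ord r a" and ?q = "mn_ord r c"
  note la = mn_ord_least[OF lin aC a0, folded le_def] and lc = mn_ord_least[OF lin cC c0, folded le_def]
  have uniq: "{(p, q). p \<in> mn_supp a \<and> q \<in> mn_supp c \<and> p + q = ?p + ?q} = {(?p, ?q)}"
  proof -
    have "p = ?p \<and> q = ?q" if "a p \<noteq> 0" "c q \<noteq> 0" "p + q = ?p + ?q" for p q
    proof -
      have "?p = p"
      proof (rule ccontr)
        assume "?p \<noteq> p"
        then have "?p <\<^sub>r p" using la(2)[OF that(1)] by (simp add: lt_le)
        from add_less_le_mono[OF this lc(2)[OF that(2)]] show False using that(3) by simp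
      qed
      then show ?thesis using that(3) by auto
    qed
    then show ?thesis using la(1) lc(1) by (auto simp: mn_supp_def)
  qed
  have "(a \<otimes>\<^bsub>mn_ring r\<^esub> c) (?p + ?q) = a ?p * c ?q"
    using aC cC unfolding carrier_iff by (subst mult_eq[OF order_refl order_refl]) (simp_all add: uniq)
  moreover have "a ?p * c ?q \<noteq> 0"
  proof
    assume 0: "a ?p * c ?q = 0"
    obtain v where "1 = a ?p * v" using u by (auto simp: dvd_def)
    then have "c ?q = (a ?p * c ?q) * v" by (metis mult.assoc mult.commute mult_1)
    then show False using 0 lc(1) by simp
  qed
  ultimately have "\<one>\<^bsub>mn_ring r\<^esub> (?p + ?q) \<noteq> (0 :: 'r)" using inv by simp
  then have "?p + ?q = 0" by (simp add: one_apply split: if_splits)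
  then show ?thesis by blast
qed

text \<open>The k-fold multiple of \<open>m\<close> for an integer k, in a monoid without negation:
  \<open>m'\<close> stands for the inverse of \<open>m\<close>.\<close>

definition int_multiple :: "'m \<Rightarrow> 'm \<Rightarrow> int \<Rightarrow> 'm" where
  "int_multiple m m' k = (if k < 0 then (\<Sum>i<nat (- k). m') else (\<Sum>i<nat k. m))"

lemma int_multiple_0 [simp]: "int_multiple m m' 0 = 0"
  by (simp add: int_multiple_def)

lemma int_multiple_Suc:
  assumes "m + m' = 0"
  shows "int_multiple m m' (k + 1) = int_multiple m m' k + m"
proof (cases "k < 0")
  case False
  then have "nat (k + 1) = Suc (nat k)" by simp
  then show ?thesis using False by (simp add: int_multiple_def lessThan_Suc add.commute)
next
  case True
  define p where "p = nat (- (k + 1))"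
  have p: "nat (- k) = Suc p" using True by (simp add: p_def)
  have "int_multiple m m' k + m = (\<Sum>i<p. m') + (m + m')"
    using True p by (simp add: int_multiple_def lessThan_Suc add_ac)
  moreover have "int_multiple m m' (k + 1) = (\<Sum>i<p. m')"
    using True by (auto simp: int_multiple_def p_def)
  ultimately show ?thesis using assms by simp
qed

lemma int_multiple_1: "m + m' = 0 \<Longrightarrow> int_multiple m m' 1 = m"
  using int_multiple_Suc[of m m' 0] by simp

text \<open>The upward recurrence also fixes the values at negative integers, by cancellation.
  Additivity of \<open>int_multiple\<close> follows from it without distinguishing signs.\<close>

lemma int_hom_unique:
  fixes h h' :: "int \<Rightarrow> 'm"
  assumes "h 0 = h' 0" "\<And>k. h (k + 1) = h k + m" "\<And>k. h' (k + 1) = h' k + m"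
  shows "h k = h' k"
proof (induction k rule: int_induct[where k = 0])
  case (step2 i)
  have "h (i - 1) + m = h' (i - 1) + m"
    using assms(2)[of "i - 1"] assms(3)[of "i - 1"] step2 by simp
  then show ?case by simp
qed (use assms in auto)

lemma int_multiple_add: "m + m' = 0 \<Longrightarrow> int_multiple m m' (k + l) = int_multiple m m' k + int_multiple m m' l"
  by (rule int_hom_unique[where m = m and h = "\<lambda>l. int_multiple m m' (k + l)"])
     (simp_all add: int_multiple_Suc add.assoc[symmetric])

text \<open>Translates of one submonoid multiply into translates of the same submonoid. This keeps
  the supports of all power products uniformly controlled, however large the exponents are.\<close>

lemma sumset_assoc_gen:
  assumes "x \<in> sumset {p} (gen S)" "y \<in> sumset {q} (gen S)"
  shows "x + y \<in> sumset {p + q} (gen S)"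
proof -
  obtain c d where "x = p + c" "c \<in> gen S" "y = q + d" "d \<in> gen S"
    using assms unfolding sumset_def by blast
  moreover have "(p + c) + (q + d) = (p + q) + (c + d)" by (simp add: add_ac)
  ultimately show ?thesis using gen_add[of c S d] by (auto simp: sumset_def)
qed

lemma supp_mult_gen:
  assumes "mn_supp \<eta> \<subseteq> sumset {p} (gen S)" "mn_supp \<zeta> \<subseteq> sumset {q} (gen S)"
  shows "mn_supp (\<eta> \<otimes>\<^bsub>mn_ring r\<^esub> \<zeta>) \<subseteq> sumset {p + q} (gen S)"
proof
  fix x assume "x \<in> mn_supp (\<eta> \<otimes>\<^bsub>mn_ring r\<^esub> \<zeta>)"
  then have "x \<in> sumset (sumset {p} (gen S)) (sumset {q} (gen S))"
    using supp_mult[OF assms] by blast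
  then obtain y z where "x = y + z" "y \<in> sumset {p} (gen S)" "z \<in> sumset {q} (gen S)"
    unfolding sumset_def by blast
  then show "x \<in> sumset {p + q} (gen S)" using sumset_assoc_gen by blast
qed

lemma supp_one_gen: "mn_supp \<one>\<^bsub>mn_ring r\<^esub> \<subseteq> sumset {0} (gen S)"
proof
  fix x :: 'm assume "x \<in> mn_supp (\<one>\<^bsub>mn_ring r\<^esub> :: 'm \<Rightarrow> 'r::comm_ring_1)"
  then have "x = 0 + 0" using supp_one by auto
  then show "x \<in> sumset {0} (gen S)" using zero_in_gen sumsetI[of 0 "{0}" 0 "gen S"] by auto
qed

lemma supp_pow_sumset:
  "mn_supp \<eta> \<subseteq> sumset {m} (gen S) \<Longrightarrow>
    mn_supp (\<eta> [^]\<^bsub>mn_ring r\<^esub> n) \<subseteq> sumset {\<Sum>i<n. m} (gen S)" for n :: nat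
proof (induction n)
  case 0
  then show ?case using supp_one_gen by (simp add: mn.nat_pow_0)
next
  case (Suc n)
  from supp_mult_gen[OF Suc.IH[OF Suc.prems] Suc.prems] show ?case
    by (simp add: mn.nat_pow_Suc lessThan_Suc add.commute)
qed

lemma supp_finprod_gen:
  assumes "finite I" "\<And>i. i \<in> I \<Longrightarrow> V i \<in> carrier (mn_ring r)"
    "\<And>i. i \<in> I \<Longrightarrow> mn_supp (V i) \<subseteq> sumset {\<mu> i} (gen S)"
  shows "mn_supp (\<Otimes>\<^bsub>mn_ring r\<^esub>i\<in>I. V i) \<subseteq> sumset {\<Sum>i\<in>I. \<mu> i} (gen S)"
  using assms
proof (induction I rule: finite_induct)
  case empty
  then show ?case using supp_one_gen by simp
next
  case (insert i I)
  have "(\<Otimes>\<^bsub>mn_ring r\<^esub>i\<in>insert i I. V i) = V i \<otimes>\<^bsub>mn_ring r\<^esub> (\<Otimes>\<^bsub>mn_ring r\<^esub>i\<in>I. V i)"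
    using insert by (intro mn.finprod_insert) auto
  moreover have "mn_supp (V i \<otimes>\<^bsub>mn_ring r\<^esub> (\<Otimes>\<^bsub>mn_ring r\<^esub>i\<in>I. V i)) \<subseteq> sumset {\<mu> i + (\<Sum>i\<in>I. \<mu> i)} (gen S)"
    using insert by (intro supp_mult_gen) auto
  ultimately show ?case using insert by simp
qed

end

context to_monoid_x
begin

lemma supp_int_pow:
  assumes "F \<in> carrier (mn_ring r)" "H \<in> carrier (mn_ring r)" "F \<otimes>\<^bsub>mn_ring r\<^esub> H = \<one>\<^bsub>mn_ring r\<^esub>"
    "mn_supp F \<subseteq> sumset {m} (gen S)" "mn_supp H \<subseteq> sumset {m'} (gen S)"
  shows "mn_supp (F [^]\<^bsub>mn_ring r\<^esub> (k::int)) \<subseteq> sumset {int_multiple m m' k} (gen S)"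
  unfolding int_pow_eq[OF assms(1-3)] int_multiple_def
  using supp_pow_sumset[OF assms(4), of "nat k"] supp_pow_sumset[OF assms(5), of "nat (- k)"] by (simp del: pow_nat)

text \<open>An explicit form of the endomorphism that \<open>mn_endo\<close> describes, with
  \<open>\<mu> i\<close> the order of the initial term and \<open>\<mu>' i\<close> its additive
  inverse.\<close>

definition endo :: "('n \<Rightarrow> 'g \<times> (int ^ 'n)) \<Rightarrow> ('n \<Rightarrow> 'g \<times> (int ^ 'n)) \<Rightarrow> 'g \<times> (int ^ 'n) \<Rightarrow> 'g \<times> (int ^ 'n)" where
  "endo \<mu> \<mu>' h = (fst h, 0) + (\<Sum>i\<in>UNIV. int_multiple (\<mu> i) (\<mu>' i) (snd h $ i))"

lemma vec_sum_axis: "(\<Sum>i\<in>UNIV. axis i (k $ i)) = (k :: int ^ 'n)"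
  by (simp add: vec_eq_iff axis_def if_distrib cong: if_cong)

lemma mn_endo_eq:
  fixes f :: "'n \<Rightarrow> 'g \<times> (int ^ 'n) \<Rightarrow> 'r::comm_ring_1"
  assumes \<mu>: "\<And>i. mn_ord r (f i) = \<mu> i" "\<And>i. \<mu> i + \<mu>' i = 0"
  shows "mn_endo r f = endo \<mu> \<mu>'"
  unfolding mn_endo_def
proof (rule the_equality)
  have "endo \<mu> \<mu>' (h + h') = endo \<mu> \<mu>' h + endo \<mu> \<mu>' h'" for h h'
  proof -
    have "(fst h + fst h', 0 :: int ^ 'n) = (fst h, 0) + (fst h', 0)" by simp
    then show ?thesis
      by (simp add: endo_def int_multiple_add[OF \<mu>(2)] sum.distrib add_ac del: add_Pair)
  qed
  moreover have "endo \<mu> \<mu>' (g, 0) = (g, 0)" for g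
    by (simp add: endo_def)
  moreover have "endo \<mu> \<mu>' (0, axis i 1) = mn_ord r (f i)" for i
  proof -
    have "(\<Sum>j\<in>UNIV. int_multiple (\<mu> j) (\<mu>' j) (axis i 1 $ j)) = (\<Sum>j\<in>UNIV. if j = i then \<mu> i else 0)"
      by (rule sum.cong) (auto simp: axis_def int_multiple_1[OF \<mu>(2)])
    then show ?thesis by (simp add: endo_def \<mu>(1) zero_prod_def[symmetric])
  qed
  ultimately show "(\<forall>h h'. endo \<mu> \<mu>' (h + h') = endo \<mu> \<mu>' h + endo \<mu> \<mu>' h') \<and>
      (\<forall>g. endo \<mu> \<mu>' (g, 0) = (g, 0)) \<and> (\<forall>i. endo \<mu> \<mu>' (0, axis i 1) = mn_ord r (f i))"
    by blast
next
  fix \<phi> :: "'g \<times> (int ^ 'n) \<Rightarrow> 'g \<times> (int ^ 'n)"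
  assume *: "(\<forall>h h'. \<phi> (h + h') = \<phi> h + \<phi> h') \<and> (\<forall>g. \<phi> (g, 0) = (g, 0)) \<and> (\<forall>i. \<phi> (0, axis i 1) = mn_ord r (f i))"
  have add: "\<phi> (h + h') = \<phi> h + \<phi> h'" for h h' using * by blast
  have g: "\<phi> (g, 0) = (g, 0)" for g using * by blast
  have e: "\<phi> (0, axis i 1) = \<mu> i" for i using * \<mu>(1) by simp
  have ax: "\<phi> (0, axis i k) = int_multiple (\<mu> i) (\<mu>' i) k" for i k
  proof (rule int_hom_unique[where m = "\<mu> i" and h = "\<lambda>k. \<phi> (0, axis i k)"])
    show "\<phi> (0, axis i 0) = int_multiple (\<mu> i) (\<mu>' i) 0"
    proof -
      have "axis i 0 = (0 :: int ^ 'n)" by (simp add: vec_eq_iff axis_def)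
      then show ?thesis unfolding int_multiple_0 using g[of 0] by (simp only: zero_prod_def)
    qed
    show "\<phi> (0, axis i (k + 1)) = \<phi> (0, axis i k) + \<mu> i" for k
    proof -
      have "(0 :: 'g, axis i (k + 1) :: int ^ 'n) = (0, axis i k) + (0, axis i 1)"
        by (simp add: vec_eq_iff axis_def)
      then show ?thesis by (simp only: add e)
    qed
  qed (rule int_multiple_Suc[OF \<mu>(2)])
  have sm: "\<phi> (sum h I) = (\<Sum>i\<in>I. \<phi> (h i))" if "finite I" for I :: "'n set" and h
    using that by (induction I rule: finite_induct) (use g[of 0] in \<open>simp_all add: add zero_prod_def\<close>)
  show "\<phi> = endo \<mu> \<mu>'"
  proof
    fix h :: "'g \<times> (int ^ 'n)"
    have "(\<Sum>i\<in>UNIV. (0 :: 'g, axis i (snd h $ i))) = (0, snd h)"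
      by (simp add: sum_prod vec_sum_axis)
    then have "h = (fst h, 0) + (\<Sum>i\<in>UNIV. (0, axis i (snd h $ i)))"
      by (simp add: prod_eq_iff)
    then have "\<phi> h = \<phi> (fst h, 0) + \<phi> (\<Sum>i\<in>UNIV. (0, axis i (snd h $ i)))"
      using add by metis
    then show "\<phi> h = endo \<mu> \<mu>' h" by (simp add: sm ax endo_def g)
  qed
qed

section \<open>Initial terms and their orders\<close>

lemma xterm_apply:
  fixes c :: "'g \<Rightarrow> 'r::comm_ring_1"
  shows "(mn_embG c \<otimes>\<^bsub>mn_ring r\<^esub> mpow (mn_ring r) mn_X k) (g, l) = (if l = k then c g else 0)"
proof -
  have X: "mn_X i [^]\<^bsub>mn_ring r\<^esub> (k $ i) = (mn_t (0, axis i (k $ i)) :: 'g \<times> (int ^ 'n) \<Rightarrow> 'r)" for i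
  proof -
    have 1: "mn_t (0, axis i 1) \<otimes>\<^bsub>mn_ring r\<^esub> mn_t (0, - axis i 1) = (\<one>\<^bsub>mn_ring r\<^esub> :: 'g \<times> (int ^ 'n) \<Rightarrow> 'r)"
      by (simp add: t_mult t_zero[symmetric] zero_prod_def)
    have it: "(\<Sum>j<n. (0 :: 'g, axis i c)) = (0, axis i (of_nat n * c))" for n and c :: int
      by (induction n) (auto simp: zero_prod_def vec_eq_iff axis_def algebra_simps)
    have "- axis i (1::int) = axis i (- 1)" by (simp add: vec_eq_iff axis_def)
    then show ?thesis
      unfolding mn_X_def int_pow_eq[OF t_closed t_closed 1] t_pow by (simp add: it)
  qed
  have "mpow (mn_ring r) mn_X k = (mn_t (\<Sum>i\<in>UNIV. (0, axis i (k $ i))) :: 'g \<times> (int ^ 'n) \<Rightarrow> 'r)"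
    unfolding mpow_def X by (rule finprod_t) simp
  also have "(\<Sum>i\<in>UNIV. (0 :: 'g, axis i (k $ i))) = (0, k)"
    by (simp add: sum_prod vec_sum_axis)
  finally have "(mn_embG c \<otimes>\<^bsub>mn_ring r\<^esub> mpow (mn_ring r) mn_X k) (g, l) =
      (mn_embG c \<otimes>\<^bsub>mn_ring r\<^esub> mn_t (0, k)) (g, l)" by simp
  also have "\<dots> = mn_embG c ((g, l) + (0, - k))"
    unfolding mn_t_eq_monomial by (subst mult_monomial_apply[of _ "(0, - k)"]) (auto simp: zero_prod_def)
  finally show ?thesis by (simp add: mn_embG_def)
qed

lemma to_monoid_ordG: "to_monoid (ordG r)"
proof
  have i: "(x, y) \<in> ordG r \<longleftrightarrow> (x, 0) \<le>\<^sub>r (y, 0)" for x y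
    by (simp add: ordG_def le_def)
  have "linear_order (ordG r)"
    unfolding order_on_defs total_on_def refl_on_def trans_def antisym_def i
    using le_trans not_le lt_le by (auto dest: le_antisym)
  moreover have "(z + x, 0) \<le>\<^sub>r (z + y, 0) \<and> z + x \<noteq> z + y"
    if "(x, 0) \<le>\<^sub>r (y, 0)" "x \<noteq> y" for x y z
    using add_le[OF that(1), of "(z, 0)"] add_cancel[of "(z, 0)" "(x, 0)" "(y, 0)"] that(2) by simp
  ultimately show "totally_ordered_monoid (ordG r)"
    unfolding totally_ordered_monoid_def by (auto simp: i add.commute)
qed

text \<open>The order of \<open>f\<close> is the order of \<open>a\<close> paired with
  \<open>b\<close>, and \<open>F\<close> has the same coefficient there as \<open>f\<close>. It
  bounds the whole support of \<open>F\<close>, since each exponent lies above the order of its own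
  x-term and the x-initial term has the least order among these.\<close>

lemma initial_term:
  fixes F f :: "'g \<times> (int ^ 'n) \<Rightarrow> 'r::comm_ring_1"
  assumes F: "F \<in> carrier (mn_ring r)" and init: "is_xinitial r F f"
    and f: "f = mn_embG a \<otimes>\<^bsub>mn_ring r\<^esub> mpow (mn_ring r) mn_X b"
    and a: "a \<in> Units (mn_ring (ordG r))" and u: "a (mn_ord (ordG r) a) dvd 1"
  obtains m' where "mn_ord r f + m' = 0" "snd (mn_ord r f) = b" "F (mn_ord r f) dvd 1"
    "\<And>p. p \<in> mn_supp F \<Longrightarrow> mn_ord r f \<le>\<^sub>r p"
proof -
  interpret G: to_monoid "ordG r" by (rule to_monoid_ordG)
  have fa: "f (g, l) = (if l = b then a g else 0)" for g l
    unfolding f by (rule xterm_apply)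
  have xa: "xterm r F k (g, l) = (if l = k then F (g, l) else 0)" for k g l
    unfolding xterm_def xterm_apply by (simp add: xcoeff_def)
  let ?g = "mn_ord (ordG r) a"
  have aC: "a \<in> carrier (mn_ring (ordG r))" using a by (simp add: Units_def)
  have a0: "a \<noteq> (\<lambda>m. 0)"
  proof
    assume "a = (\<lambda>m. 0)"
    then show False using u by simp
  qed
  note la = mn_ord_least[OF G.lin aC a0]
  \<comment> \<open>\<open>is_xinitial\<close> provides some x-degree \<open>k\<close>; that it
    equals \<open>b\<close> is forced by the nonzero coefficient at \<open>(?g, b)\<close>.\<close>
  obtain k where "f = xterm r F k" using init by (auto simp: is_xinitial_def)
  then have "f (?g, b) = (if b = k then F (?g, b) else 0)" by (simp add: xa)
  then have aF: "a ?g = F (?g, b)" using fa la(1) by (auto split: if_splits)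
  have ord: "mn_ord r f = (?g, b)"
  proof (rule mn_ord_eqI)
    show "(?g, b) \<in> mn_supp f" using la(1) by (simp add: mn_supp_def fa)
  next
    fix p assume p: "p \<in> mn_supp f"
    then obtain g where g: "p = (g, b)" "a g \<noteq> 0"
      by (cases p) (auto simp: mn_supp_def fa split: if_splits)
    then have "(?g, 0) \<le>\<^sub>r (g, 0)" using la(2) by (simp add: ordG_def le_def)
    from add_le[OF this, of "(0, b)"] show "(?g, b) \<le>\<^sub>r p" using g by simp
  qed
  obtain g' where "?g + g' = 0" using G.Units_order_invertible[OF a u] by blast
  then have 1: "mn_ord r f + (g', - b) = 0" by (simp add: ord zero_prod_def)
  have 2: "F (mn_ord r f) dvd 1" using u aF by (simp add: ord)
  have 3: "mn_ord r f \<le>\<^sub>r p" if p: "p \<in> mn_supp F" for p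
  proof -
    let ?x = "xterm r F (snd p)"
    have xp: "?x p \<noteq> 0" using p by (cases p) (simp add: xa mn_supp_def)
    have "mn_supp ?x \<subseteq> mn_supp F" by (auto simp: mn_supp_def xa split: if_splits)
    then have xC: "?x \<in> carrier (mn_ring r)" using F by (auto simp: carrier_iff intro: wo_subset)
    have x0: "?x \<noteq> (\<lambda>m. 0)" using xp by metis
    then have "?x \<noteq> \<zero>\<^bsub>mn_ring r\<^esub>" by (simp add: mn_ring_def)
    then have "mn_ord r f \<le>\<^sub>r mn_ord r ?x"
      using init by (auto simp: is_xinitial_def le_def)
    also have "mn_ord r ?x \<le>\<^sub>r p"
      using mn_ord_least(2)[OF lin xC x0 xp] by (simp add: le_def)
    finally show ?thesis .
  qed
  show ?thesis
    by (rule that[OF 1 _ 2 3]) (simp add: ord)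
qed

text \<open>Injectivity on the support comes from the antisymmetry contained in
  \<open>well_order_on\<close>: two points with the same image precede each other in the pulled-back
  relation.\<close>

lemma inv_image_carrier:
  assumes "\<Phi> \<in> carrier (mn_ring (inv_image r h))"
  shows "inj_on h (mn_supp \<Phi>)" "wo (h ` mn_supp \<Phi>)"
proof -
  let ?S = "mn_supp \<Phi>"
  let ?s = "Restr (inv_image r h) ?S"
  have s: "(x, y) \<in> ?s \<longleftrightarrow> x \<in> ?S \<and> y \<in> ?S \<and> h x \<le>\<^sub>r h y" for x y
    by (auto simp: le_def)
  have wf: "wf (?s - Id)" and anti: "antisym ?s"
    using assms by (auto simp: mn_ring_def well_order_on_def order_on_defs)
  show "inj_on h ?S"
  proof (rule inj_onI)
    fix x y assume "x \<in> ?S" "y \<in> ?S" "h x = h y"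
    then have "(x, y) \<in> ?s" "(y, x) \<in> ?s" unfolding s by auto
    then show "x = y" by (rule antisymD[OF anti])
  qed
  show "wo (h ` ?S)"
    unfolding wo_def
  proof (intro allI impI)
    fix T assume T: "T \<subseteq> h ` ?S" "T \<noteq> {}"
    then obtain x0 where "x0 \<in> {x \<in> ?S. h x \<in> T}" by blast
    from wfE_min[OF wf this] obtain x where x: "x \<in> ?S" "h x \<in> T"
      and min: "\<And>y. (y, x) \<in> ?s - Id \<Longrightarrow> y \<notin> {x \<in> ?S. h x \<in> T}" by blast
    have "h x \<le>\<^sub>r t" if t: "t \<in> T" for t
    proof (rule ccontr)
      assume "\<not> h x \<le>\<^sub>r t"
      then have lt: "t <\<^sub>r h x" by (simp add: not_le)
      obtain y where y: "y \<in> ?S" "t = h y" using T t by blast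
      then have "(y, x) \<in> ?s - Id" using lt x unfolding Diff_iff s by (auto simp: lt_le)
      then show False using min y t by blast
    qed
    then show "\<exists>x\<in>T. \<forall>y\<in>T. x \<le>\<^sub>r y" using x by blast
  qed
qed

text \<open>The factor \<open>mn_embG c\<close> lives in x-degree 0, so only the part of
  \<open>E\<close> in x-degree 0 can meet \<open>(g, 0)\<close>, and that part is the constant
  \<open>e\<close>.\<close>

lemma CT_embG_mult:
  fixes c :: "'g \<Rightarrow> 'r::comm_ring_1"
  assumes c: "mn_embG c \<in> carrier (mn_ring r)" and E: "E \<in> carrier (mn_ring r)"
    and CT: "\<And>g. E (g, 0) = (if g = 0 then e else 0)"
  shows "(mn_embG c \<otimes>\<^bsub>mn_ring r\<^esub> E) (g, 0) = c g * e"
proof -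
  let ?c = "mn_embG c :: 'g \<times> (int ^ 'n) \<Rightarrow> 'r"
  \<comment> \<open>The supports are enlarged so that the surviving pair belongs to the index set
    even when a coefficient there is zero.\<close>
  let ?A = "mn_supp (?c) \<union> {(g, 0)}" and ?B = "mn_supp E \<union> {0}"
  have wo: "wo ?A" "wo ?B" using c E by (auto simp: carrier_iff intro!: wo_Un wo_singleton simp del: Un_insert_right)
  have "(?c \<otimes>\<^bsub>mn_ring r\<^esub> E) (g, 0) =
      (\<Sum>(p, q)\<in>{(p, q). p \<in> ?A \<and> q \<in> ?B \<and> p + q = (g, 0)}. ?c p * E q)"
    by (rule mult_eq[OF _ _ wo]) auto
  also have "\<dots> = (\<Sum>(p, q)\<in>{((g, 0), 0)}. ?c p * E q)"
  proof (rule sum.mono_neutral_right)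
    show "finite {(p, q). p \<in> ?A \<and> q \<in> ?B \<and> p + q = (g, 0)}"
      by (rule finite_sum_reps[OF wo])
    show "\<forall>i\<in>{(p, q). p \<in> ?A \<and> q \<in> ?B \<and> p + q = (g, 0)} - {((g, 0), 0)}. (case i of (p, q) \<Rightarrow> ?c p * E q) = 0"
    proof
      fix z assume z: "z \<in> {(p, q). p \<in> ?A \<and> q \<in> ?B \<and> p + q = (g, 0)} - {((g, 0), 0)}"
      obtain p1 p2 q1 q2 where z': "z = ((p1, p2), (q1, q2))" by (metis surj_pair)
      then have sum: "p1 + q1 = g" "p2 + q2 = 0" and ne: "\<not> ((p1, p2) = (g, 0) \<and> (q1, q2) = 0)"
        using z by auto
      have "?c (p1, p2) * E (q1, q2) = 0"
      proof (cases "p2 = 0")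
        case True
        then have "q2 = 0" using sum by simp
        moreover have "q1 \<noteq> 0" using ne sum True \<open>q2 = 0\<close> by (auto simp: zero_prod_def)
        ultimately show ?thesis using CT by simp
      qed (simp add: mn_embG_def)
      then show "(case z of (p, q) \<Rightarrow> ?c p * E q) = 0" by (simp add: z')
    qed
  qed auto
  also have "\<dots> = c g * e" using CT[of 0] by (simp add: mn_embG_def zero_prod_def)
  finally show ?thesis .
qed

end

context to_monoid_x
begin

text \<open>A fixed coefficient of the product involves finitely many exponents of the substituted
  series, and each of them receives contributions from finitely many k. The sums can therefore be
  exchanged, and \<open>CT_monomial\<close> leaves only k = 0.\<close>

lemma CT_subst:
  fixes F H :: "'n \<Rightarrow> 'g \<times> (int ^ 'n) \<Rightarrow> 'r::comm_ring_1"
  assumes F: "\<And>i. F i \<in> carrier (mn_ring r)" and H: "\<And>i. H i \<in> carrier (mn_ring r)"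
    and FH: "\<And>i. F i \<otimes>\<^bsub>mn_ring r\<^esub> H i = \<one>\<^bsub>mn_ring r\<^esub>"
    and parallel: "\<And>i. parallel (\<lambda>j s. (H i \<otimes>\<^bsub>mn_ring r\<^esub> euler j (F i)) s - (if s = 0 then of_int (b $ i $ j) else 0))"
    and N: "wo (gen S)" and sF: "\<And>i. mn_supp (F i) \<subseteq> sumset {\<mu> i} (gen S)"
    and sH: "\<And>i. mn_supp (H i) \<subseteq> sumset {\<mu>' i} (gen S)"
    and \<Phi>: "\<Phi> \<in> carrier (mn_ring (inv_image r (endo \<mu> \<mu>')))"
  shows "(mn_subst r \<Phi> F \<otimes>\<^bsub>mn_ring r\<^esub> log_jacobian r F) (g, 0) = of_int (det b) * \<Phi> (g, 0)"
proof -
  let ?e = "endo \<mu> \<mu>'"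
  let ?W = "?e ` mn_supp \<Phi>"
  let ?D = "sumset ?W (gen S)"
  define J where "J = log_jacobian r F"
  define Q where "Q k = mpow (mn_ring r) F k" for k
  define B where "B k = (mn_embG (xcoeff \<Phi> k) :: 'g \<times> (int ^ 'n) \<Rightarrow> 'r)" for k
  define P where "P k = B k \<otimes>\<^bsub>mn_ring r\<^esub> Q k" for k
  note inj = inv_image_carrier(1)[OF \<Phi>] and woW = inv_image_carrier(2)[OF \<Phi>]
  have pC: "F i [^]\<^bsub>mn_ring r\<^esub> (k $ i) \<in> carrier (mn_ring r)" for i and k :: "int ^ 'n"
    by (rule int_pow_closed[OF F H FH])
  have QC: "Q k \<in> carrier (mn_ring r)" for k
    unfolding Q_def mpow_def using pC by (intro mn.finprod_closed) auto
  have JC: "J \<in> carrier (mn_ring r)"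
    unfolding J_def log_jacobian_eq[OF F H FH] ring_det_def using F H
    by (intro mn.finsum_closed funcsetI mn.add.int_pow_closed mn.finprod_closed) auto
  have sQ: "mn_supp (Q k) \<subseteq> sumset {\<Sum>i\<in>UNIV. int_multiple (\<mu> i) (\<mu>' i) (k $ i)} (gen S)" for k
    unfolding Q_def mpow_def
    by (rule supp_finprod_gen[OF finite pC supp_int_pow[OF F H FH sF sH]])
  have sB: "p \<in> mn_supp (B k) \<Longrightarrow> \<exists>g. p = (g, 0) \<and> (g, k) \<in> mn_supp \<Phi>" for p k
    by (cases p) (auto simp: B_def mn_embG_def xcoeff_def mn_supp_def split: if_splits)
  have BC: "B k \<in> carrier (mn_ring r)" for k
  proof -
    \<comment> \<open>Translated by the image of (0, k), the slice of \<Phi> at \<open>k\<close>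
      falls into the well-ordered set \<open>?W\<close>. By \<open>wo_translateD\<close>,
      well-ordering can be pulled back along the translation.\<close>
    have "(+) (\<Sum>i\<in>UNIV. int_multiple (\<mu> i) (\<mu>' i) (k $ i)) ` mn_supp (B k) \<subseteq> ?W"
    proof
      fix x assume "x \<in> (+) (\<Sum>i\<in>UNIV. int_multiple (\<mu> i) (\<mu>' i) (k $ i)) ` mn_supp (B k)"
      then obtain g where "x = (\<Sum>i\<in>UNIV. int_multiple (\<mu> i) (\<mu>' i) (k $ i)) + (g, 0)" "(g, k) \<in> mn_supp \<Phi>"
        using sB by blast
      then show "x \<in> ?W"
        by (intro image_eqI[of _ _ "(g, k)"]) (simp_all add: endo_def add.commute)
    qed
    then show ?thesis
      unfolding carrier_iff using woW wo_subset wo_translateD by blast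
  qed
  have sP: "\<exists>g n. p = ?e (g, k) + n \<and> (g, k) \<in> mn_supp \<Phi> \<and> n \<in> gen S" if p: "p \<in> mn_supp (P k)" for p k
  proof -
    obtain x y where "p = x + y" "x \<in> mn_supp (B k)" "y \<in> mn_supp (Q k)"
      using supp_mult[OF order_refl order_refl] p unfolding P_def sumset_def by blast
    moreover from this obtain g n where "x = (g, 0)" "(g, k) \<in> mn_supp \<Phi>"
        "y = (\<Sum>i\<in>UNIV. int_multiple (\<mu> i) (\<mu>' i) (k $ i)) + n" "n \<in> gen S"
      using sB[of x k] sQ[of k] unfolding sumset_def by blast
    ultimately have "p = ?e (g, k) + n \<and> (g, k) \<in> mn_supp \<Phi> \<and> n \<in> gen S"
      by (simp add: endo_def add.assoc)
    then show ?thesis by blast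
  qed
  have woD: "wo ?D" by (rule wo_sumset[OF woW N])
  have PD: "mn_supp (P k) \<subseteq> ?D" for k
    using sP by blast
  \<comment> \<open>A contribution to \<open>p\<close> writes it as \<open>w + n\<close> with
    \<open>w\<close> in \<open>?W\<close> and \<open>n\<close> in \<open>gen S\<close>. There are
    finitely many such pairs, and \<open>w\<close> determines \<open>k\<close> by
    injectivity.\<close>
  have finK: "finite {k. P k p \<noteq> 0}" for p
  proof (rule finite_subset)
    let ?R = "{(w, n). w \<in> ?W \<and> n \<in> gen S \<and> w + n = p}"
    show "finite ((\<lambda>(w, n). snd (inv_into (mn_supp \<Phi>) ?e w)) ` ?R)"
      by (intro finite_imageI finite_sum_reps[OF woW N])
    show "{k. P k p \<noteq> 0} \<subseteq> (\<lambda>(w, n). snd (inv_into (mn_supp \<Phi>) ?e w)) ` ?R"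
    proof
      fix k assume "k \<in> {k. P k p \<noteq> 0}"
      then obtain g n where *: "p = ?e (g, k) + n" "(g, k) \<in> mn_supp \<Phi>" "n \<in> gen S"
        using sP[of p k] by (auto simp: mn_supp_def)
      then show "k \<in> (\<lambda>(w, n). snd (inv_into (mn_supp \<Phi>) ?e w)) ` ?R"
        by (intro image_eqI[of _ _ "(?e (g, k), n)"]) (auto simp: inv_into_f_f[OF inj])
    qed
  qed
  have subst: "mn_subst r \<Phi> F p = (\<Sum>k\<in>K. P k p)" if "finite K" "{k. P k p \<noteq> 0} \<subseteq> K" for p K
    using Sum_any.expand_superset[OF that] by (simp add: mn_subst_def P_def B_def Q_def)
  have sD: "mn_supp (mn_subst r \<Phi> F) \<subseteq> ?D"
  proof
    fix p assume "p \<in> mn_supp (mn_subst r \<Phi> F)"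
    then have "(\<Sum>k\<in>{k. P k p \<noteq> 0}. P k p) \<noteq> 0"
      using subst[OF finK order_refl, of p] by (simp add: mn_supp_def)
    then obtain k where "P k p \<noteq> 0" by (rule sum.not_neutral_contains_not_neutral)
    then show "p \<in> ?D" using PD[of k] by (auto simp: mn_supp_def)
  qed
  have woJ: "wo (mn_supp J)" using JC by (simp add: carrier_iff)
  let ?T = "{(p, q). p \<in> ?D \<and> q \<in> mn_supp J \<and> p + q = (g, 0)}"
  have finT: "finite ?T" by (rule finite_sum_reps[OF woD woJ])
  \<comment> \<open>A finite set of k that works for all exponents in \<open>?T\<close> at once; 0
    is added so that the surviving term is always present.\<close>
  define K where "K = insert 0 (\<Union>z\<in>?T. {k. P k (fst z) \<noteq> 0})"
  have finite_K: "finite K" unfolding K_def using finT finK by simp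
  have "(mn_subst r \<Phi> F \<otimes>\<^bsub>mn_ring r\<^esub> J) (g, 0) = (\<Sum>(p, q)\<in>?T. mn_subst r \<Phi> F p * J q)"
    by (rule mult_eq[OF sD order_refl woD woJ])
  also have "\<dots> = (\<Sum>(p, q)\<in>?T. \<Sum>k\<in>K. P k p * J q)"
  proof (rule sum.cong[OF refl])
    fix z assume z: "z \<in> ?T"
    have "mn_subst r \<Phi> F (fst z) = (\<Sum>k\<in>K. P k (fst z))"
      by (rule subst[OF finite_K]) (use z K_def in blast)
    then show "(case z of (p, q) \<Rightarrow> mn_subst r \<Phi> F p * J q) = (case z of (p, q) \<Rightarrow> \<Sum>k\<in>K. P k p * J q)"
      by (simp add: case_prod_beta sum_distrib_right)
  qed
  also have "\<dots> = (\<Sum>k\<in>K. \<Sum>(p, q)\<in>?T. P k p * J q)"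
    unfolding case_prod_beta by (rule sum.swap)
  also have "\<dots> = (\<Sum>k\<in>K. (P k \<otimes>\<^bsub>mn_ring r\<^esub> J) (g, 0))"
    by (simp only: mult_eq[OF PD order_refl woD woJ])
  also have "\<dots> = (\<Sum>k\<in>K. if k = 0 then \<Phi> (g, 0) * of_int (det b) else 0)"
  proof (rule sum.cong[OF refl])
    fix k
    have "P k \<otimes>\<^bsub>mn_ring r\<^esub> J = B k \<otimes>\<^bsub>mn_ring r\<^esub> (Q k \<otimes>\<^bsub>mn_ring r\<^esub> J)"
      unfolding P_def by (rule mn.m_assoc[OF BC QC JC])
    moreover have "(B k \<otimes>\<^bsub>mn_ring r\<^esub> (Q k \<otimes>\<^bsub>mn_ring r\<^esub> J)) (g, 0) =
        xcoeff \<Phi> k g * (if k = 0 then of_int (det b) else 0)"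
      unfolding B_def
    proof (rule CT_embG_mult)
      show "mn_embG (xcoeff \<Phi> k) \<in> carrier (mn_ring r)" using BC[of k] by (simp add: B_def)
      show "Q k \<otimes>\<^bsub>mn_ring r\<^esub> J \<in> carrier (mn_ring r)" using QC JC by simp
      show "(Q k \<otimes>\<^bsub>mn_ring r\<^esub> J) (g', 0) = (if g' = 0 then if k = 0 then of_int (det b) else 0 else 0)" for g'
        unfolding Q_def J_def CT_monomial[OF F H FH parallel] by simp
    qed
    ultimately show "(P k \<otimes>\<^bsub>mn_ring r\<^esub> J) (g, 0) = (if k = 0 then \<Phi> (g, 0) * of_int (det b) else 0)"
      by (simp add: xcoeff_def)
  qed
  also have "\<dots> = \<Phi> (g, 0) * of_int (det b)"
    using finite_K by (simp add: K_def)
  finally show ?thesis by (simp add: J_def mult.commute)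
qed

end

theorem mainTheorem1:
  fixes r :: "(('g::comm_monoid_add) \<times> (int ^ 'n::finite)) rel"
    and F f :: "'n \<Rightarrow> 'g \<times> (int ^ 'n) \<Rightarrow> 'r::comm_ring_1"
    and a :: "'n \<Rightarrow> 'g \<Rightarrow> 'r"
    and b :: "int ^ 'n ^ 'n"
    and \<Phi> :: "'g \<times> (int ^ 'n) \<Rightarrow> 'r"
  assumes "totally_ordered_monoid r"
    and "\<And>i. F i \<in> carrier (mn_ring r)"
    and "\<And>i. is_xinitial r (F i) (f i)"
    and "\<And>i. f i = mn_embG (a i) \<otimes>\<^bsub>mn_ring r\<^esub> mpow (mn_ring r) mn_X (b $ i)"
    and "\<And>i. a i \<in> Units (mn_ring (ordG r))"
    and "\<And>i. a i (mn_ord (ordG r) (a i)) dvd 1"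
    and "det b \<noteq> 0"
    and "\<Phi> \<in> carrier (mn_ring (inv_image r (mn_endo r f)))"
  shows "xCT (mn_subst r \<Phi> F \<otimes>\<^bsub>mn_ring r\<^esub> log_jacobian r F)
       = (\<lambda>g. of_int (det b) * xCT \<Phi> g)"
proof -
  interpret to_monoid_x r by unfold_locales (rule assms(1))
  define \<mu> where "\<mu> i = mn_ord r (f i)" for i
  have "\<exists>m'. \<mu> i + m' = 0 \<and> snd (\<mu> i) = b $ i \<and> F i (\<mu> i) dvd 1 \<and> (\<forall>p\<in>mn_supp (F i). \<mu> i \<le>\<^sub>r p)" for i
    unfolding \<mu>_def by (rule initial_term[OF assms(2-6)]) blast
  then obtain \<mu>' where \<mu>': "\<And>i. \<mu> i + \<mu>' i = 0" and deg: "\<And>i. snd (\<mu> i) = b $ i"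
    and unit: "\<And>i. F i (\<mu> i) dvd 1" and least: "\<And>i p. p \<in> mn_supp (F i) \<Longrightarrow> \<mu> i \<le>\<^sub>r p"
    by metis
  \<comment> \<open>Bundling the properties lets \<open>S\<close> and \<open>H\<close> be chosen for
    all \<open>i\<close> at once.\<close>
  define P where "P i S H \<longleftrightarrow> wo S \<and> (\<forall>s\<in>S. 0 <\<^sub>r s) \<and> mn_supp (F i) \<subseteq> sumset {\<mu> i} (gen S) \<and>
      mn_supp H \<subseteq> sumset {\<mu>' i} (gen S) \<and> H \<in> carrier (mn_ring r) \<and>
      F i \<otimes>\<^bsub>mn_ring r\<^esub> H = \<one>\<^bsub>mn_ring r\<^esub> \<and>
      parallel (\<lambda>j s. (H \<otimes>\<^bsub>mn_ring r\<^esub> euler j (F i)) s - (if s = 0 then of_int (b $ i $ j) else 0))" for i S H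
  have "\<exists>S H. P i S H" for i
  proof -
    obtain u where u: "F i (\<mu> i) * u = 1" using unit[of i] by (auto simp: dvd_def)
    show ?thesis
      unfolding P_def
      by (rule leading_term_inverse[OF assms(2) u \<mu>' least, unfolded deg])
        (assumption, (intro exI conjI ballI; (assumption | simp)))
  qed
  then obtain S H where SH: "\<And>i. P i (S i) (H i)" by metis
  have S: "wo (S i)" "s \<in> S i \<Longrightarrow> 0 <\<^sub>r s"
    and sF: "mn_supp (F i) \<subseteq> sumset {\<mu> i} (gen (S i))"
    and sH: "mn_supp (H i) \<subseteq> sumset {\<mu>' i} (gen (S i))"
    and H: "H i \<in> carrier (mn_ring r)" and FH: "F i \<otimes>\<^bsub>mn_ring r\<^esub> H i = \<one>\<^bsub>mn_ring r\<^esub>"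
    and parallel: "parallel (\<lambda>j s. (H i \<otimes>\<^bsub>mn_ring r\<^esub> euler j (F i)) s - (if s = 0 then of_int (b $ i $ j) else 0))"
    for i s
    using SH[of i] by (simp_all add: P_def)
  \<comment> \<open>The finite union is still well-ordered and positive, and its submonoid contains
    all the \<open>gen (S i)\<close>, which gives the common support bound that
    \<open>CT_subst\<close> requires.\<close>
  let ?S = "\<Union>i\<in>UNIV. S i"
  have mono: "sumset {x} (gen (S i)) \<subseteq> sumset {x} (gen ?S)" for x i
    using gen_mono[of "S i" ?S] unfolding sumset_def by blast
  have wo: "wo (gen ?S)"
    using S by (intro wo_gen wo_UN) auto
  have "\<Phi> \<in> carrier (mn_ring (inv_image r (endo \<mu> \<mu>')))"
    using assms(8) mn_endo_eq[of f \<mu> \<mu>'] \<mu>' by (simp add: \<mu>_def)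
  from CT_subst[OF assms(2) H FH parallel wo order_trans[OF sF mono] order_trans[OF sH mono] this]
  show ?thesis
    by (simp add: xCT_def xcoeff_def fun_eq_iff)
qed

end
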